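(* Let $K$ be a field of characteristic zero and let $\alpha\in K((T^{-1}))$. If $\alpha=[0,a_1,a_2,\ldots]$, where $(a_i)_{i\ge 1}$ is an infinite sequence beginning with arbitrarily long palindromes, then $\alpha$ is either transcendental or quadratic over $K(T)$.
   Context: $K((T^{-1}))$ is the field of formal Laurent series in $T^{-1}$ over $K$, i.e. the completion of $K(T)$ for the ultrametric absolute value $|a/b|=\mu^{\deg a-\deg b}$ (for nonzero $a,b\in K[T]$), $|0|=0$, where $\mu>1$ is a fixed real number. Continued fractions: for nonzero $\alpha=\sum_{i\le k}b_iT^i\in K((T^{-1}))$ with $b_k\neq 0$, put $\lfloor\alpha\rfloor=\sum_{i=0}^k b_iT^i\in K[T]$ if $k\ge 0$ and $\lfloor\alpha\rfloor=0$ otherwise. The continued fraction expansion $\alpha=\alpha_0=[a_0,a_1,\ldots]$ is obtained by $a_i=\lfloor\alpha_i\rfloor$, $\alpha_{i+1}=1/(\alpha_i-a_i)$ for $i\ge 0$ (stopping if $\alpha_i=a_i$). Thus $a_i\in K[T]$ and $\deg a_i\ge 1$ for $i\ge 1$. The sequence $(a_i)_{i\ge 1}$ begins with arbitrarily long palindromes if there exist infinitely many integers $n$ such that $(a_1,\ldots,a_n)$ is a palindrome, i.e. $a_j=a_{n+1-j}$ for all $1\le j\le n$. "Transcendental" means transcendental over $K(T)$; "quadratic" means algebraic of degree $2$ over $K(T)$. *)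

theory Defs
  imports "HOL-Computational_Algebra.Computational_Algebra"
begin

(* The field K((T^{-1})) is the type of formal Laurent series over K whose formal
   variable fls_X plays the role of T^{-1}; hence T is fls_X_inv, and the coefficient of T^i
   in \<alpha> is fls_nth \<alpha> (- i). *)

definition poly_T :: "'a::field poly \<Rightarrow> 'a fls" where
  "poly_T p = poly (map_poly fls_const p) fls_X_inv"

definition rational_functions_T :: "'a::field fls set" where
  "rational_functions_T = {poly_T p / poly_T q | p q. q \<noteq> 0}"


(* In the next three definitions F is meant to be a subfield. *)

definition algebraic_over :: "'b::field set \<Rightarrow> 'b \<Rightarrow> bool" where
  "algebraic_over F x \<longleftrightarrow> (\<exists>p. (\<forall>i. coeff p i \<in> F) \<and> p \<noteq> 0 \<and> poly p x = 0)"

definition minimal_polynomial_over :: "'b::field set \<Rightarrow> 'b \<Rightarrow> 'b poly \<Rightarrow> bool" where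
  "minimal_polynomial_over F x p \<longleftrightarrow>
     (\<forall>i. coeff p i \<in> F) \<and> lead_coeff p = 1 \<and> poly p x = 0 \<and>
     (\<forall>q. (\<forall>i. coeff q i \<in> F) \<and> q \<noteq> 0 \<and> poly q x = 0 \<longrightarrow> degree p \<le> degree q)"

definition quadratic_over :: "'b::field set \<Rightarrow> 'b \<Rightarrow> bool" where
  "quadratic_over F x \<longleftrightarrow> (\<exists>p. minimal_polynomial_over F x p \<and> degree p = 2)"


(* fls_prpart collects the terms b_i T^i with i > 0, as a polynomial in T without
   constant term. *)
definition poly_floor :: "'a::field fls \<Rightarrow> 'a poly" where
  "poly_floor \<alpha> = fls_prpart \<alpha> + [:fls_nth \<alpha> 0:]"

(* If the expansion stops at i, then this total version continues with zeros; infinite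
   expansions are singled out in has_infinite_cf. *)
primrec complete_quotient :: "'a::field fls \<Rightarrow> nat \<Rightarrow> 'a fls" where
  "complete_quotient \<alpha> 0 = \<alpha>"
| "complete_quotient \<alpha> (Suc i) =
     1 / (complete_quotient \<alpha> i - poly_T (poly_floor (complete_quotient \<alpha> i)))"

definition has_infinite_cf :: "'a::field fls \<Rightarrow> (nat \<Rightarrow> 'a poly) \<Rightarrow> bool" where
  "has_infinite_cf \<alpha> a \<longleftrightarrow>
     (\<forall>i. a i = poly_floor (complete_quotient \<alpha> i) \<and> complete_quotient \<alpha> i \<noteq> poly_T (a i))"

(* The palindromic prefixes start at index 1; a 0 plays no role. *)
definition begins_with_long_palindromes :: "(nat \<Rightarrow> 'b) \<Rightarrow> bool" where
  "begins_with_long_palindromes a \<longleftrightarrow>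
     infinite {n::nat. \<forall>j. 1 \<le> j \<and> j \<le> n \<longrightarrow> a j = a (n + 1 - j)}"

end

theory Submission
  imports
    "HOL-Algebra.Algebraic_Closure_Type"
    "Jordan_Normal_Form.Char_Poly"
    Defs
begin

hide_const (open) Polynomials.degree up_ring.coeff up_ring.monom Module.smult Coset.order

text \<open>
  Write p_n / q_n for the convergents of \<alpha>. If a_1, ..., a_n is a palindrome, then the product of the
  symmetric matrices (a_i, 1; 1, 0) is symmetric, so p_n = q_(n-1). Consequently p_n / q_n
  approximates \<alpha>, while p_(n-1) / q_n = (p_(n-1) / q_(n-1)) (p_n / q_n) approximates \<alpha>^2, with the
  same denominator: for q = q_n, p = p_n and r = p_(n-1) both q \<alpha> - p and q \<alpha>^2 - r have absolute
  value at most 1 / |q| (lemma \<open>palindromic_approximations\<close>). Now \<alpha> is not rational, because its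
  continued fraction is infinite. If it is not quadratic either, then 1, \<alpha>, \<alpha>^2 are linearly
  independent over K(T), while the product of the three linear forms q, q \<alpha> - p, q \<alpha>^2 - r is at most
  1 / |q|; for algebraic \<alpha> Schmidt's subspace theorem would forbid this when q is large. The instance
  of the subspace theorem that is needed is proved here by the Wronskian method, which works because
  the characteristic is zero.

  The field of constants may be enlarged to its algebraic closure C. Let \<theta> be a primitive element,
  integral over C[T], of the Galois closure of C(T, \<alpha>), and let g be its minimal polynomial, of
  degree m. Every root of g generates \<alpha> (\<open>normal_generator\<close>, \<open>conjugate_roots_generate\<close>), and by
  Puiseux's theorem (\<open>puiseux\<close>) all roots of g are Laurent series in a parameter X with T = X^(-e).
  Let V_N be the space spanned by the T^j \<theta>^k with j \<le> N and k < m, and suppose for simplicity that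
  multiplication by \<alpha> and \<alpha>^2 maps V_N into V_(N+D) for all N (in general a multiple c \<alpha> does so).
  Consider the Wronskian of the 3 m (N + D + 1) functions T^j \<theta>^k x, where j \<le> N + D, k < m and x
  is one of q, p, r. It is

  \<^item> nonzero if q is large: a linear relation between these functions with constant coefficients
    would make a fixed finite-dimensional space of combinations of 1, \<alpha>, \<alpha>^2 contain nonzero
    elements of arbitrarily high order (\<open>approx_wronskian_nonzero\<close>, \<open>finite_family_bounded_order\<close>);

  \<^item> a polynomial in T and \<theta>, if derivatives are taken with respect to the vector field
    g_y d/dt - g_t d/dy tangent to the curve g(t, y) = 0. The product over all roots \<theta> of g is
    therefore a polynomial in T (\<open>norm_is_polynomial\<close>), nonzero, and hence of absolute value at
    least 1;

  \<^item> small at every root: a unimodular change of the family replaces, for j \<le> N, the functions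
    T^j \<theta>^k p and T^j \<theta>^k r by T^j \<theta>^k (q \<alpha> - p) and T^j \<theta>^k (q \<alpha>^2 - r). Up to factors that do not
    depend on q, now 2 m (N + 1) functions have size 1 / |q| and the other m (N + 1) + 3 m D have
    size |q|, so that the Wronskian has size at most |q|^(-m (N + 1 - 3 D)) (\<open>approx_wronskian_small\<close>).

  With N = 3 D the last two points contradict each other as soon as |q| is large.
\<close>

section \<open>Hensel's lemma and Puiseux's theorem\<close>

lemma coprime_product_decomposition:
  fixes g h r :: "'a::field_gcd poly"
  assumes "coprime g h" and "degree r < degree g + degree h" and deg: "degree g > 0" "degree h > 0"
  shows "\<exists>a b. (a = 0 \<or> degree a < degree g) \<and> (b = 0 \<or> degree b < degree h) \<and> g * b + h * a = r"
proof -
  have ng: "g \<noteq> 0" "h \<noteq> 0" using deg by auto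
  obtain u v where uv: "u * g + v * h = 1"
    using assms(1) by (metis bezout_coefficients_fst_snd coprime_imp_gcd_eq_1)
  define a where "a = (v * r) mod g"
  have "g dvd (v * r - a)" unfolding a_def by (simp add: minus_mod_eq_mult_div)
  then have "g dvd h * (v * r - a)" by simp
  moreover have "r - h * a = g * (u * r) + h * (v * r - a)"
    using arg_cong[OF uv, of "\<lambda>x. x * r"] by (simp add: algebra_simps)
  ultimately have "g dvd r - h * a" by simp
  then obtain b where b: "r - h * a = g * b" by (elim dvdE)
  have da: "a = 0 \<or> degree a < degree g" unfolding a_def using degree_mod_less[OF ng(1)] by blast
  have "b = 0 \<or> degree b < degree h"
  proof (rule ccontr)
    assume "\<not> (b = 0 \<or> degree b < degree h)"
    then have nb: "b \<noteq> 0" "degree b \<ge> degree h" by auto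
    have "degree (g * b) = degree g + degree b" using nb ng by (simp add: degree_mult_eq)
    moreover have "degree (h * a) < degree g + degree h"
      using da deg by (cases "a = 0") (auto simp: degree_mult_eq ng)
    then have "degree (r - h * a) < degree g + degree h"
      using assms(2) by (intro degree_diff_less)
    ultimately show False using b nb by simp
  qed
  then show ?thesis using da b by (intro exI[of _ a] exI[of _ b]) (auto simp: algebra_simps)
qed

text \<open>
  A polynomial in y over K[[z]] is the same as a power series in z whose coefficients (the slices) are
  polynomials in y of bounded degree.
\<close>
lemma polynomial_from_slices:
  fixes g :: "nat \<Rightarrow> 'a::comm_ring_1 poly"
  assumes "\<And>n. degree (g n) \<le> k"
  shows "\<exists>G :: 'a fps poly. (\<forall>i n. fps_nth (coeff G i) n = coeff (g n) i) \<and> degree G \<le> k"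
proof -
  define G where "G = (\<Sum>i\<le>k. monom (Abs_fps (\<lambda>n. coeff (g n) i)) i)"
  have "coeff G i = (if i \<le> k then Abs_fps (\<lambda>n. coeff (g n) i) else 0)" for i
    unfolding G_def by (simp add: coeff_sum if_distrib sum.delta cong: if_cong)
  moreover have "coeff (g n) i = 0" if "i > k" for i n
    using assms[of n] that by (intro coeff_eq_0) linarith
  moreover have "degree G \<le> k" unfolding G_def
    by (intro degree_sum_le) (auto intro: order_trans[OF degree_monom_le])
  ultimately show ?thesis by (intro exI[of _ G]) auto
qed

text \<open>
  Hensel's lemma for the power series ring: the slices of the two factors are found one after the
  other. If all slices below n are known, then the n-th slices a, b of G, H must satisfy
  g0 b + h0 a = r for a known polynomial r, which is solvable because g0 and h0 are coprime; the degree
  bounds on a and b keep the factors monic.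
\<close>
lemma hensel_factorization:
  fixes F :: "'a::field_gcd fps poly" and g0 h0 :: "'a poly"
  assumes monic: "lead_coeff F = 1"
    and red: "map_poly (\<lambda>a. fps_nth a 0) F = g0 * h0"
    and cop: "coprime g0 h0" and mg: "lead_coeff g0 = 1" and mh: "lead_coeff h0 = 1"
    and pos: "degree g0 > 0" "degree h0 > 0"
  shows "\<exists>G H. F = G * H \<and> lead_coeff G = 1 \<and> lead_coeff H = 1 \<and>
           degree G = degree g0 \<and> degree H = degree h0"
proof -
  define S where "S n = map_poly (\<lambda>a. fps_nth a n) F" for n
  have cS: "coeff (S n) i = fps_nth (coeff F i) n" for n i
    unfolding S_def by (simp add: coeff_map_poly)
  have dF: "degree F = degree g0 + degree h0"
  proof -
    have "coeff (S 0) (degree F) = 1" using monic by (simp add: cS)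
    then have "degree F \<le> degree (S 0)" by (intro le_degree) auto
    moreover have "degree (S 0) \<le> degree F" unfolding S_def by (rule degree_map_poly_le)
    moreover have "degree (S 0) = degree g0 + degree h0"
      using red mg mh unfolding S_def by (metis degree_mult_eq leading_coeff_0_iff zero_neq_one)
    ultimately show ?thesis by simp
  qed
  have dS: "degree (S n) < degree g0 + degree h0" if "n > 0" for n
  proof -
    have "degree (S n) \<le> degree F" unfolding S_def by (rule degree_map_poly_le)
    moreover have "coeff (S n) (degree F) = 0" using monic that by (simp add: cS)
    ultimately have "degree (S n) < degree F \<or> S n = 0" by (metis le_neq_implies_less leading_coeff_0_iff)
    then show ?thesis using dF pos by auto
  qed
  \<comment> \<open>The specification of the n-th pair of slices in terms of the earlier ones.\<close>
  define P :: "(nat \<Rightarrow> 'a poly \<times> 'a poly) \<Rightarrow> nat \<Rightarrow> 'a poly \<times> 'a poly \<Rightarrow> bool" where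
    "P f n r \<longleftrightarrow> (if n = 0 then r = (g0, h0) else
       (fst r = 0 \<or> degree (fst r) < degree g0) \<and> (snd r = 0 \<or> degree (snd r) < degree h0) \<and>
       g0 * snd r + h0 * fst r + (\<Sum>m\<in>{1..<n}. fst (f m) * snd (f (n - m))) = S n)" for f n r
  have "\<exists>f. \<forall>n. P f n (f n)"
  proof (rule dependent_wellorder_choice)
    fix r :: "'a poly \<times> 'a poly" and f g :: "nat \<Rightarrow> 'a poly \<times> 'a poly" and x :: nat
    assume "\<And>y. y < x \<Longrightarrow> f y = g y"
    then have "(\<Sum>m\<in>{1..<x}. fst (f m) * snd (f (x - m))) = (\<Sum>m\<in>{1..<x}. fst (g m) * snd (g (x - m)))"
      by (intro sum.cong) auto
    then show "P f x r = P g x r" unfolding P_def by simp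
  next
    fix x :: nat and f :: "nat \<Rightarrow> 'a poly \<times> 'a poly"
    assume IH: "\<And>y. y < x \<Longrightarrow> P f y (f y)"
    show "\<exists>r. P f x r"
    proof (cases "x = 0")
      case True then show ?thesis unfolding P_def by auto
    next
      case False
      define r where "r = S x - (\<Sum>m\<in>{1..<x}. fst (f m) * snd (f (x - m)))"
      have "degree (\<Sum>m\<in>{1..<x}. fst (f m) * snd (f (x - m))) < degree g0 + degree h0"
      proof (rule degree_sum_less)
        fix m assume m: "m \<in> {1..<x}"
        then have 1: "fst (f m) = 0 \<or> degree (fst (f m)) < degree g0" using IH[of m] unfolding P_def by auto
        have 2: "snd (f (x - m)) = 0 \<or> degree (snd (f (x - m))) < degree h0"
          using IH[of "x - m"] m unfolding P_def by auto
        show "degree (fst (f m) * snd (f (x - m))) < degree g0 + degree h0"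
          using 1 2 pos by (cases "fst (f m) = 0"; cases "snd (f (x - m)) = 0") (auto simp: degree_mult_eq)
      qed (use pos in auto)
      then have "degree r < degree g0 + degree h0" unfolding r_def
        using dS[of x] False pos by (intro degree_diff_less) auto
      from coprime_product_decomposition[OF cop this pos] obtain a b where
        "a = 0 \<or> degree a < degree g0" "b = 0 \<or> degree b < degree h0" "g0 * b + h0 * a = r" by blast
      then have "P f x (a, b)" unfolding P_def r_def using False by (simp add: algebra_simps)
      then show ?thesis by blast
    qed
  qed
  then obtain f where f: "\<And>n. P f n (f n)" by blast
  define gs where "gs n = fst (f n)" for n
  define hs where "hs n = snd (f n)" for n
  have 0: "gs 0 = g0" "hs 0 = h0" using f[of 0] unfolding P_def gs_def hs_def by auto
  have dgs: "gs n = 0 \<or> degree (gs n) < degree g0" if "n > 0" for n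
    using f[of n] that unfolding P_def gs_def by auto
  have dhs: "hs n = 0 \<or> degree (hs n) < degree h0" if "n > 0" for n
    using f[of n] that unfolding P_def hs_def by auto
  have conv: "(\<Sum>m=0..n. gs m * hs (n - m)) = S n" for n
  proof (cases n)
    case 0 then show ?thesis using red \<open>gs 0 = g0\<close> \<open>hs 0 = h0\<close> by (simp add: S_def)
  next
    case (Suc k)
    have "{0..n} = insert 0 (insert n {1..<n})" using Suc by auto
    then have "(\<Sum>m=0..n. gs m * hs (n - m)) = g0 * hs n + gs n * h0 + (\<Sum>m\<in>{1..<n}. gs m * hs (n - m))"
      using Suc 0 by (simp add: add.assoc)
    also have "\<dots> = S n" using f[of n] Suc unfolding P_def gs_def hs_def by (simp add: algebra_simps)
    finally show ?thesis .
  qed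
  have "\<And>n. degree (gs n) \<le> degree g0" using dgs 0 by (metis bot_nat_0.not_eq_extremum degree_0 le0 less_imp_le order_refl)
  from polynomial_from_slices[of gs, OF this] obtain G where
    G: "\<And>i n. fps_nth (coeff G i) n = coeff (gs n) i" "degree G \<le> degree g0" by blast
  have "\<And>n. degree (hs n) \<le> degree h0" using dhs 0 by (metis bot_nat_0.not_eq_extremum degree_0 le0 less_imp_le order_refl)
  from polynomial_from_slices[of hs, OF this] obtain H where
    H: "\<And>i n. fps_nth (coeff H i) n = coeff (hs n) i" "degree H \<le> degree h0" by blast
  have "F = G * H"
  proof (rule poly_eqI, rule fps_ext)
    fix i n
    have "fps_nth (coeff (G * H) i) n = (\<Sum>j\<le>i. \<Sum>m=0..n. coeff (gs m) j * coeff (hs (n - m)) (i - j))"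
      by (simp add: coeff_mult fps_sum_nth fps_mult_nth G H)
    also have "\<dots> = (\<Sum>m=0..n. \<Sum>j\<le>i. coeff (gs m) j * coeff (hs (n - m)) (i - j))"
      by (rule sum.swap)
    also have "\<dots> = coeff (\<Sum>m=0..n. gs m * hs (n - m)) i"
      by (simp add: coeff_sum coeff_mult)
    also have "\<dots> = fps_nth (coeff F i) n" by (simp add: conv cS)
    finally show "fps_nth (coeff F i) n = fps_nth (coeff (G * H) i) n" by simp
  qed
  moreover have lG: "coeff G (degree g0) = 1"
  proof (rule fps_ext)
    fix n show "fps_nth (coeff G (degree g0)) n = fps_nth 1 n"
      using dgs[of n] mg 0 by (cases "n = 0") (auto simp: G coeff_eq_0)
  qed
  moreover have lH: "coeff H (degree h0) = 1"
  proof (rule fps_ext)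
    fix n show "fps_nth (coeff H (degree h0)) n = fps_nth 1 n"
      using dhs[of n] mh 0 by (cases "n = 0") (auto simp: H coeff_eq_0)
  qed
  moreover have "degree G = degree g0" using G(2) lG le_degree[of G "degree g0"] by auto
  moreover have "degree H = degree h0" using H(2) lH le_degree[of H "degree h0"] by auto
  ultimately show ?thesis by metis
qed

definition splits :: "'a::field poly \<Rightarrow> bool" where
  "splits P \<longleftrightarrow> (\<exists>as. P = (\<Prod>a\<leftarrow>as. [:-a, 1:]))"

lemma splits_mult: "splits P \<Longrightarrow> splits Q \<Longrightarrow> splits (P * Q)"
  unfolding splits_def by (metis map_append prod_list.append)

lemma (in field_hom) splits_map_poly:
  assumes "splits P" shows "splits (map_poly hom P)"
proof -
  interpret m: map_poly_inj_comm_ring_hom hom ..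
  from assms obtain as where "P = (\<Prod>a\<leftarrow>as. [:-a, 1:])" unfolding splits_def by blast
  then have "map_poly hom P = (\<Prod>a\<leftarrow>map hom as. [:-a, 1:])"
    by (simp add: m.hom_prod_list o_def hom_uminus)
  then show ?thesis unfolding splits_def by blast
qed

lemma splits_shift:
  assumes "splits (pcompose P [:c, 1:])" shows "splits P"
proof -
  from assms obtain as where as: "pcompose P [:c, 1:] = (\<Prod>a\<leftarrow>as. [:-a, 1:])" unfolding splits_def by blast
  have "P = pcompose (pcompose P [:c, 1:]) [:-c, 1:]"
    by (simp add: pcompose_assoc[symmetric] pcompose_pCons)
  also have "\<dots> = pcompose (\<Prod>a\<leftarrow>as. [:-a, 1:]) [:-c, 1:]" by (simp add: as)
  also have "\<dots> = (\<Prod>a\<leftarrow>map (\<lambda>a. a + c) as. [:-a, 1:])"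
    by (induction as) (simp_all add: pcompose_1 pcompose_mult pcompose_pCons del: mult_pCons_left)
  finally show ?thesis unfolding splits_def by blast
qed

text \<open>
  If P is monic of degree d and t s^d = 1, then t P(s y) is monic again, and its roots are those of P
  divided by s.
\<close>
lemma splits_scale:
  assumes "splits (smult t (pcompose P [:0, s:]))" and s: "s \<noteq> 0" and "lead_coeff P = 1" and "t * s ^ degree P = 1"
  shows "splits P"
proof -
  from assms(1) obtain as where as: "smult t (pcompose P [:0, s:]) = (\<Prod>a\<leftarrow>as. [:-a, 1:])" unfolding splits_def by blast
  have t: "t \<noteq> 0" using assms(4) by auto
  have "length as = degree P"
  proof -
    have "degree (\<Prod>a\<leftarrow>as. [:-a, 1:]) = length as"
      by (induction as) (simp_all add: degree_mult_eq prod_list_zero_iff image_iff del: mult_pCons_left)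
    then show ?thesis using as t s by (metis degree_pcompose degree_pCons_eq_if degree_smult_eq mult.right_neutral one_neq_zero One_nat_def pCons_eq_0_iff degree_0)
  qed
  then have len: "t * s ^ length as = 1" using assms(4) by simp
  have "smult (s ^ length as) (pcompose (\<Prod>a\<leftarrow>as. [:-a, 1:]) [:0, inverse s:]) = (\<Prod>a\<leftarrow>map (\<lambda>a. s * a) as. [:-a, 1:])"
  proof (induction as)
    case (Cons a as)
    have "smult (s ^ length (a # as)) (pcompose (\<Prod>a\<leftarrow>a#as. [:-a, 1:]) [:0, inverse s:])
      = smult s (pcompose [:-a, 1:] [:0, inverse s:]) * smult (s ^ length as) (pcompose (\<Prod>a\<leftarrow>as. [:-a, 1:]) [:0, inverse s:])"
      by (simp add: pcompose_mult mult.commute del: mult_pCons_left mult_pCons_right)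
    also have "smult s (pcompose [:-a, 1:] [:0, inverse s:]) = [:-(s*a), 1:]" using s by (simp add: pcompose_pCons)
    finally show ?case using Cons.IH by simp
  qed (simp add: pcompose_1)
  also have "smult (s ^ length as) (pcompose (\<Prod>a\<leftarrow>as. [:-a, 1:]) [:0, inverse s:]) = 
     smult (s ^ length as * t) (pcompose (pcompose P [:0, s:]) [:0, inverse s:])"
    by (simp add: as[symmetric] pcompose_smult)
  also have "\<dots> = P" using s len by (simp add: pcompose_assoc[symmetric] pcompose_pCons mult.commute)
  finally show ?thesis unfolding splits_def by blast
qed

lemma field_hom_fls_compose_power:
  assumes "e > 0" shows "field_hom (\<lambda>a::'a::field fls. fls_compose_power a e)"
  using assms by unfold_locales simp_all

lemma fls_compose_power_compose:
  assumes "d > 0" "e > 0"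
  shows "fls_compose_power (fls_compose_power a d) e = fls_compose_power a (d * e)"
proof (rule fls_eqI)
  fix n
  show "fls_nth (fls_compose_power (fls_compose_power a d) e) n = fls_nth (fls_compose_power a (d * e)) n"
    using assms by (auto simp: fls_nth_compose_power zdiv_zmult2_eq mult.commute dvd_div_iff_mult elim: dvd_mult_left)
qed

lemma fls_subdegree_compose_power:
  assumes "d > 0" shows "fls_subdegree (fls_compose_power a d) = int d * fls_subdegree (a::'a::field fls)"
proof (cases "a = 0")
  case False
  show ?thesis
  proof (rule fls_subdegree_eqI)
    show "fls_nth (fls_compose_power a d) (int d * fls_subdegree a) \<noteq> 0"
      using assms False by (simp add: fls_nth_compose_power)
    fix k assume "k < int d * fls_subdegree a"
    then show "fls_nth (fls_compose_power a d) k = 0"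
      using assms by (auto simp: fls_nth_compose_power elim!: dvdE)
  qed
qed simp

lemma coeff_pcompose_scale: "coeff (pcompose P [:0, s:]) i = s ^ i * coeff (P::'a::field poly) i"
proof (induction P arbitrary: i)
  case (pCons a P)
  show ?case by (cases i) (simp_all add: pcompose_pCons pCons.IH mult.assoc)
qed simp

text \<open>Characteristic zero enters Puiseux's theorem here: the Tschirnhaus substitution divides by the degree.\<close>
lemma kill_second_coeff:
  fixes P :: "'a::field_char_0 poly"
  assumes "lead_coeff P = 1" "degree P = Suc n"
  defines "Q \<equiv> pcompose P [:- (coeff P n / of_nat (Suc n)), 1:]"
  shows "coeff Q n = 0" and "lead_coeff Q = 1" and "degree Q = Suc n"
proof -
  define c where "c = - (coeff P n / of_nat (Suc n))"
  show "degree Q = Suc n" unfolding Q_def by (simp add: degree_pcompose assms)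
  show "lead_coeff Q = 1" unfolding Q_def by (subst lead_coeff_comp) (simp_all add: assms(1)[unfolded assms(2)] assms(2))
  define R where "R = P - monom 1 (Suc n) - monom (coeff P n) n"
  have R: "degree R < n \<or> R = 0"
  proof -
    have "coeff R i = 0" if "i \<ge> n" for i
      using that assms(1,2) by (cases "i = n"; cases "i = Suc n") (auto simp: R_def coeff_eq_0)
    then show ?thesis by (metis leading_coeff_0_iff not_le)
  qed
  have mono: "pcompose (monom a k) [:c, 1:] = smult a ([:c, 1:] ^ k)" for a :: 'a and k
    by (induction k) (simp_all add: monom_0 monom_Suc pcompose_pCons)
  have "P = monom 1 (Suc n) + monom (coeff P n) n + R" by (simp add: R_def)
  then have "Q = pcompose (monom 1 (Suc n) + monom (coeff P n) n + R) [:c, 1:]"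
    unfolding Q_def c_def[symmetric] by (rule arg_cong[where f = "\<lambda>P. pcompose P [:c, 1:]"])
  then have "Q = [:c, 1:] ^ Suc n + smult (coeff P n) ([:c, 1:] ^ n) + pcompose R [:c, 1:]"
    by (simp only: pcompose_add mono smult_1_left)
  moreover have "coeff (pcompose R [:c, 1:]) n = 0"
  proof (cases "R = 0")
    case False
    then have "degree (pcompose R [:c, 1:]) < n" using R by (simp add: degree_pcompose)
    then show ?thesis by (rule coeff_eq_0)
  qed simp
  ultimately have "coeff Q n = of_nat (Suc n) * c + coeff P n"
    using coeff_linear_poly_power[of n "Suc n" c 1] coeff_linear_poly_power[of n n c 1]
    by (simp only: coeff_add coeff_smult) simp
  then show "coeff Q n = 0" unfolding c_def by (simp add: field_simps del: of_nat_Suc)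
qed

text \<open>
  If the reduction f of F modulo z were a power (y - c)^(n + 1), then its vanishing second coefficient
  would force c = 0, contradicting the unit coefficient of index i. So f has a nontrivial coprime
  factorization, which lifts by Hensel's lemma.
\<close>
lemma proper_factorization_over_power_series:
  fixes F :: "'a::{alg_closed_field, field_gcd, field_char_0} fps poly"
  assumes "lead_coeff F = 1" and "degree F = Suc n" and "coeff F n = 0"
    and "i < Suc n" and "fps_nth (coeff F i) 0 \<noteq> 0"
  shows "\<exists>G H. F = G * H \<and> lead_coeff G = 1 \<and> lead_coeff H = 1 \<and> degree G < Suc n \<and> degree H < Suc n"
proof -
  define f where "f = map_poly (\<lambda>a. fps_nth a 0) F"
  have cf: "coeff f j = fps_nth (coeff F j) 0" for j unfolding f_def by (simp add: coeff_map_poly)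
  have "coeff f (Suc n) = 1" using assms(1,2) by (simp add: cf)
  moreover have "degree f \<le> Suc n" unfolding f_def using assms(2) by (metis degree_map_poly_le)
  ultimately have df: "degree f = Suc n" "lead_coeff f = 1" using le_degree[of f "Suc n"] by auto
  then have f0: "f \<noteq> 0" by auto
  obtain c where c: "poly f c = 0" using alg_closed_imp_poly_has_root[of f] df by auto
  define k where "k = order c f"
  have k: "k > 0" unfolding k_def using c f0 order_root by auto
  obtain h where h: "f = [:-c, 1:] ^ k * h" "\<not> [:-c, 1:] dvd h" unfolding k_def using order_decomp[OF f0] by blast
  have lh: "lead_coeff h = 1" using df(2) h(1) by (simp add: lead_coeff_mult lead_coeff_power)
  have h0: "h \<noteq> 0" using lh by auto
  have dh: "Suc n = k + degree h" using df h0 unfolding h(1) by (simp add: degree_mult_eq degree_power_eq)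
  have "degree h > 0"
  proof (rule ccontr)
    assume "\<not> degree h > 0"
    then have "h = 1" "k = Suc n" using lh dh by (auto elim!: degree_eq_zeroE)
    then have fe: "f = [:-c, 1:] ^ Suc n" using h(1) by simp
    have "coeff f n = 0" using assms(3) by (simp add: cf)
    moreover have "coeff f n = of_nat (Suc n) * (-c)"
      using coeff_linear_poly_power[of n "Suc n" "-c" 1] by (simp only: fe) simp
    ultimately have "c = 0" by (simp del: of_nat_Suc)
    then have "coeff f i = 0" using coeff_linear_poly_power[of i "Suc n" "-c" 1] assms(4) by (simp only: fe) simp
    then show False using assms(5) by (simp add: cf)
  qed
  moreover have "coprime ([:-c, 1:] ^ k) h"
    using h(2) prime_elem_linear_field_poly[of 1 "-c"] 
    by (intro coprime_power_left_iff[THEN iffD2] disjI1 prime_elem_imp_coprime) auto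
  moreover have deg_k: "degree ([:-c, 1:] ^ k) = k" by (simp add: degree_power_eq)
  moreover have "lead_coeff ([:-c, 1:] ^ k) = 1" by (simp add: lead_coeff_power)
  ultimately obtain G H where "F = G * H" "lead_coeff G = 1" "lead_coeff H = 1"
    "degree G = degree ([:-c, 1:] ^ k)" "degree H = degree h"
    using hensel_factorization[OF assms(1), of "[:-c, 1:] ^ k" h] h(1) lh k \<open>degree h > 0\<close> deg_k unfolding f_def by metis
  then show ?thesis using dh k \<open>degree h > 0\<close> deg_k by (intro exI[of _ G] exI[of _ H]) auto
qed

text \<open>
  The substitution of z^e for z is the field embedding \<open>\<lambda>a. fls_compose_power a e\<close>. Induction on the
  degree: after removal of the second coefficient, the smallest slope of the Newton polygon tells how
  to rescale y (after a ramification) such that all coefficients become integral and one of the lower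
  ones becomes a unit. Then the polynomial factors over the power series ring.
\<close>
theorem puiseux:
  fixes G :: "'a::{alg_closed_field, field_gcd, field_char_0} fls poly"
  assumes "lead_coeff G = 1"
  shows "\<exists>e>0. splits (map_poly (\<lambda>a. fls_compose_power a e) G)"
  using assms
proof (induction "degree G" arbitrary: G rule: less_induct)
  case less
  define cp :: "nat \<Rightarrow> 'a fls \<Rightarrow> 'a fls" where "cp e a = fls_compose_power a e" for e a
  have cpf: "(\<lambda>a. fls_compose_power a e) = cp e" for e by (simp add: cp_def fun_eq_iff)
  note IH = less(1)[unfolded cpf]
  have hom: "field_hom (cp e)" if "e > 0" for e
    using field_hom_fls_compose_power[OF that, where 'a = 'a] unfolding cpf .
  have cpcp: "map_poly (cp e) (map_poly (cp d) P) = map_poly (cp (d * e)) P" if "d > 0" "e > 0" for d e P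
    using that by (intro poly_eqI) (simp add: coeff_map_poly cp_def fls_compose_power_compose)
  have "\<exists>e>0. splits (map_poly (cp e) G)"
  proof (cases "degree G")
    case 0
    then have "G = 1" using less(2) by (auto elim!: degree_eq_zeroE)
    then have "map_poly (cp 1) G = (\<Prod>a\<leftarrow>[]. [:-a, 1:])"
      by (intro poly_eqI) (simp add: coeff_map_poly cp_def fls_compose_power_1_left)
    then show ?thesis unfolding splits_def by blast
  next
    case (Suc n)
    define c where "c = - (coeff G n / of_nat (Suc n))"
    define G1 where "G1 = pcompose G [:c, 1:]"
    have G1: "coeff G1 n = 0" "lead_coeff G1 = 1" "degree G1 = Suc n"
      using kill_second_coeff[OF less(2) Suc] unfolding G1_def c_def by auto
    have "\<exists>e>0. splits (map_poly (cp e) G1)"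
    proof (cases "\<exists>i<Suc n. coeff G1 i \<noteq> 0")
      case False
      have G1e: "G1 = monom 1 (Suc n)"
      proof (rule poly_eqI)
        fix i show "coeff G1 i = coeff (monom 1 (Suc n)) i"
          using False G1 by (cases "i < Suc n"; cases "i = Suc n") (auto simp: coeff_eq_0)
      qed
      have "map_poly (cp 1) G1 = monom 1 (Suc n)" unfolding G1e
        by (intro poly_eqI) (simp add: coeff_map_poly cp_def)
      also have "\<dots> = [:-0, 1:] ^ Suc n" by (simp add: monom_altdef del: power_Suc)
      also have "\<dots> = (\<Prod>a\<leftarrow>replicate (Suc n) 0. [:-a, 1:])" by (simp only: prod_list_replicate map_replicate)
      finally show ?thesis unfolding splits_def by blast
    next
      case True
      define v where "v i = fls_subdegree (coeff G1 i)" for i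
      define I where "I = {i. i < Suc n \<and> coeff G1 i \<noteq> 0}"
      have "finite I" "I \<noteq> {}" using True unfolding I_def by auto
      then obtain j where j: "j \<in> I" "\<And>i. i \<in> I \<Longrightarrow> 
          of_int (v j) / of_nat (Suc n - j) \<le> (of_int (v i) / of_nat (Suc n - i) :: rat)"
        using ex_min_if_finite[of "(\<lambda>i. of_int (v i) / of_nat (Suc n - i) :: rat) ` I"]
        by (metis (mono_tags, lifting) arg_min_if_finite(1) arg_min_least)
      \<comment> \<open>The slope is v j / e; substituting z^e for z makes it an integer.\<close>
      define e where "e = Suc n - j"
      have e0: "e > 0" using j(1) unfolding e_def I_def by auto
      have min: "v j * int (Suc n - i) \<le> int e * v i" if "i < Suc n" "coeff G1 i \<noteq> 0" for i
      proof -
        have "of_int (v j) / of_nat e \<le> (of_int (v i) / of_nat (Suc n - i) :: rat)"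
          using j(2)[of i] that unfolding I_def e_def by auto
        then have "of_int (v j) * of_nat (Suc n - i) \<le> (of_nat e * of_int (v i) :: rat)"
          using that e0 by (simp add: field_simps del: of_nat_diff)
        then have "of_int (v j * int (Suc n - i)) \<le> (of_int (int e * v i) :: rat)" by (simp del: of_nat_diff)
        then show ?thesis by (simp only: of_int_le_iff)
      qed
      interpret he: field_hom "cp e" by (rule hom[OF e0])
      define G2 where "G2 = map_poly (cp e) G1"
      have cG2: "coeff G2 i = cp e (coeff G1 i)" for i unfolding G2_def by (simp add: coeff_map_poly)
      have G2: "degree G2 = Suc n" "lead_coeff G2 = 1" unfolding G2_def using G1 by auto
      define s :: "'a fls" where "s = fls_X_intpow (v j)"
      define t :: "'a fls" where "t = fls_X_intpow (- v j * int (Suc n))"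
      have s0: "s \<noteq> 0" unfolding s_def by simp
      have ts: "t * s ^ Suc n = 1" unfolding s_def t_def fls_X_intpow_power fls_X_intpow_times_fls_X_intpow
        by (simp add: algebra_simps)
      define G3 where "G3 = smult t (pcompose G2 [:0, s:])"
      have cG3: "coeff G3 i = fls_shift (v j * (int (Suc n) - int i)) (cp e (coeff G1 i))" for i
        unfolding G3_def coeff_smult coeff_pcompose_scale cG2 s_def t_def fls_X_intpow_power
          mult.assoc[symmetric] fls_X_intpow_times_fls_X_intpow fls_X_intpow_times_conv_shift(1)
        by (simp add: algebra_simps)
      have G3n: "fls_nth (coeff G3 i) k = fls_nth (cp e (coeff G1 i)) (k + v j * (int (Suc n) - int i))" for i k
        unfolding cG3 by simp
      have subc: "fls_subdegree (cp e a) = int e * fls_subdegree a" for a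
        unfolding cp_def using e0 by (rule fls_subdegree_compose_power)
      have lG3: "coeff G3 (Suc n) = 1" unfolding cG3 using G1 by simp
      have dG3: "degree G3 = Suc n" unfolding G3_def using G2 s0 ts by (auto simp: degree_pcompose)
      have integral: "fls_nth (coeff G3 i) k = 0" if "k < 0" for i k
      proof (cases "i < Suc n \<and> coeff G1 i \<noteq> 0")
        case True
        then have "k + v j * (int (Suc n) - int i) < fls_subdegree (cp e (coeff G1 i))"
          using min[of i] that unfolding subc v_def[symmetric] by (simp add: of_nat_diff)
        then show ?thesis unfolding G3n by simp
      next
        case False
        then show ?thesis using lG3 that dG3 by (cases "i < Suc n"; cases "i = Suc n") (auto simp: G3n coeff_eq_0)
      qed
      define F where "F = map_poly fls_regpart G3"
      have cF: "coeff F i = fls_regpart (coeff G3 i)" for i unfolding F_def by (simp add: coeff_map_poly)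
      have G3F: "G3 = map_poly fps_to_fls F"
      proof (rule poly_eqI, rule fls_eqI)
        fix i k show "fls_nth (coeff G3 i) k = fls_nth (coeff (map_poly fps_to_fls F) i) k"
          using integral[of k i] by (cases "k < 0") (simp_all add: coeff_map_poly cF)
      qed
      have "degree F = degree G3" unfolding G3F by (rule degree_map_poly[symmetric]) auto
      then have dF: "degree F = Suc n" using dG3 by simp
      have "fps_nth (coeff F j) 0 \<noteq> 0"
      proof -
        have "coeff G1 j \<noteq> 0" "j < Suc n" using j(1) unfolding I_def by auto
        moreover have "v j * (int (Suc n) - int j) = fls_subdegree (cp e (coeff G1 j))"
          unfolding subc v_def[symmetric] using \<open>j < Suc n\<close> by (simp add: e_def of_nat_diff)
        ultimately show ?thesis unfolding cF by (simp add: G3n)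
      qed
      moreover have "lead_coeff F = 1" using lG3 by (simp add: dF cF)
      moreover have "coeff F n = 0" unfolding cF cG3 G1(1) by simp
      ultimately obtain P Q where PQ: "F = P * Q" "lead_coeff P = 1" "lead_coeff Q = 1" "degree P < Suc n" "degree Q < Suc n"
        using proper_factorization_over_power_series[of F n j] dF j(1) unfolding I_def by blast
      interpret ff: inj_comm_ring_hom "fps_to_fls :: 'a fps \<Rightarrow> 'a fls"
        by unfold_locales (auto simp: fls_times_fps_to_fls)
      interpret fm: map_poly_inj_comm_ring_hom "fps_to_fls :: 'a fps \<Rightarrow> 'a fls" ..
      define P' where "P' = map_poly fps_to_fls P"
      define Q' where "Q' = map_poly fps_to_fls Q"
      have G3PQ: "G3 = P' * Q'" unfolding G3F PQ(1) P'_def Q'_def by (rule fm.hom_mult)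
      obtain d1 where d1: "d1 > 0" "splits (map_poly (cp d1) P')"
        using IH[of P'] PQ Suc unfolding P'_def by auto
      interpret h1: field_hom "cp d1" by (rule hom[OF d1(1)])
      interpret m1: map_poly_inj_comm_ring_hom "cp d1" ..
      have "lead_coeff (map_poly (cp d1) Q') = 1" "degree (map_poly (cp d1) Q') < degree G"
        using PQ Suc unfolding Q'_def by auto
      then obtain d2 where d2: "d2 > 0" "splits (map_poly (cp d2) (map_poly (cp d1) Q'))"
        using IH by blast
      interpret h2: field_hom "cp d2" by (rule hom[OF d2(1)])
      define d where "d = d1 * d2"
      have d0: "d > 0" unfolding d_def using d1 d2 by simp
      interpret h: field_hom "cp d" by (rule hom[OF d0])
      interpret m: map_poly_inj_comm_ring_hom "cp d" ..
      have "splits (map_poly (cp d) P')" using h2.splits_map_poly[OF d1(2)] cpcp[OF d1(1) d2(1)] by (simp add: d_def)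
      moreover have "splits (map_poly (cp d) Q')" using d2(2) cpcp[OF d1(1) d2(1)] by (simp add: d_def)
      ultimately have "splits (map_poly (cp d) G3)" unfolding G3PQ m.hom_mult by (rule splits_mult)
      moreover have "map_poly (cp d) G3 = smult (cp d t) (pcompose (map_poly (cp d) G2) [:0, cp d s:])"
        unfolding G3_def by (simp add: h.map_poly_pcompose h.map_poly_hom_smult h.map_poly_pCons_hom)
      moreover have "cp d t * cp d s ^ Suc n = 1"
        using arg_cong[OF ts, of "cp d"] by (simp only: h.hom_mult h.hom_power h.hom_one)
      ultimately have "splits (map_poly (cp d) G2)"
        using splits_scale[of "cp d t" "map_poly (cp d) G2" "cp d s"] G2 s0 by simp
      then have "splits (map_poly (cp (e * d)) G1)" unfolding G2_def using cpcp[OF e0 d0] by simp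
      then show ?thesis using e0 d0 by (intro exI[of _ "e * d"]) simp
    qed
    then obtain e where e: "e > 0" "splits (map_poly (cp e) G1)" by blast
    interpret h: field_hom "cp e" by (rule hom[OF e(1)])
    have "map_poly (cp e) G1 = pcompose (map_poly (cp e) G) [:cp e c, 1:]"
      unfolding G1_def by (simp add: h.map_poly_pcompose h.map_poly_pCons_hom)
    then have "splits (map_poly (cp e) G)" using e(2) by (metis splits_shift)
    then show ?thesis using e(1) by blast
  qed
  then show ?case by (simp add: cpf)
qed

section \<open>Primitive elements and normal generators\<close>

text \<open>The results of this part are applied to the field of fractions of a polynomial ring.\<close>
instance fract :: ("{idom, ring_char_0}") field_char_0
proof
  show "inj (of_nat :: nat \<Rightarrow> 'a fract)"
    by (auto simp: inj_def of_nat_fract eq_fract)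
qed

text \<open>A nonzero element of least degree in the ideal generated by g and q divides both, so it is a unit.\<close>
lemma irreducible_bezout:
  fixes g q :: "'a::field poly"
  assumes "irreducible g" and "\<not> g dvd q"
  shows "\<exists>u v. u * g + v * q = 1"
proof -
  define I where "I = {u * g + v * q | u v. True}"
  have gI: "g \<in> I" "q \<in> I" unfolding I_def
    by (auto intro: exI[of _ 1] exI[of _ 0])
  have g0: "g \<noteq> 0" using assms(1) by auto
  then have "\<exists>d. d \<in> I \<and> d \<noteq> 0" using gI by blast
  then obtain d where d: "d \<in> I" "d \<noteq> 0" "\<And>e. e \<in> I \<Longrightarrow> e \<noteq> 0 \<Longrightarrow> degree d \<le> degree e"
    using ex_has_least_nat[of "\<lambda>d. d \<in> I \<and> d \<noteq> 0" _ degree] by blast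
  have dd: "d dvd x" if x: "x \<in> I" for x
  proof -
    from x d(1) obtain u v u' v' where "x = u * g + v * q" "d = u' * g + v' * q" unfolding I_def by blast
    then have "x mod d = (u - x div d * u') * g + (v - x div d * v') * q"
      by (simp add: minus_div_mult_eq_mod[symmetric] algebra_simps)
    then have "x mod d \<in> I" unfolding I_def by blast
    then have "x mod d = 0" using d(3) degree_mod_less[OF d(2), of x] by force
    then show ?thesis by (rule mod_0_imp_dvd)
  qed
  from dd[OF gI(1)] obtain e where e: "g = d * e" by (elim dvdE)
  have "is_unit d"
  proof (rule ccontr)
    assume "\<not> is_unit d"
    then have "is_unit e" using assms(1) e by (metis irreducibleD)
    then have "g dvd d" unfolding e by (simp add: mult_unit_dvd_iff)
    then show False using dd[OF gI(2)] assms(2) dvd_trans by blast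
  qed
  then obtain w where w: "1 = d * w" by (elim dvdE)
  from d(1) obtain u v where "d = u * g + v * q" unfolding I_def by blast
  then have "(w * u) * g + (w * v) * q = 1" using w by (simp add: algebra_simps)
  then show ?thesis by blast
qed

text \<open>
  Subfields are represented by their sets of elements, so that a tower of extensions can be treated
  inside one type.
\<close>
locale type_subfield =
  fixes E :: "'l::field set"
  assumes zero_in: "0 \<in> E" and one_in: "1 \<in> E"
    and add_in: "x \<in> E \<Longrightarrow> y \<in> E \<Longrightarrow> x + y \<in> E"
    and minus_in: "x \<in> E \<Longrightarrow> - x \<in> E"
    and mult_in: "x \<in> E \<Longrightarrow> y \<in> E \<Longrightarrow> x * y \<in> E"
    and inverse_in: "x \<in> E \<Longrightarrow> inverse x \<in> E"
begin

definition polys :: "'l poly set" where "polys = {p. \<forall>i. coeff p i \<in> E}"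

lemma sum_in: "(\<And>i. i \<in> A \<Longrightarrow> f i \<in> E) \<Longrightarrow> sum f A \<in> E"
  by (induction A rule: infinite_finite_induct) (auto intro: zero_in add_in)

lemma diff_in: "x \<in> E \<Longrightarrow> y \<in> E \<Longrightarrow> x - y \<in> E"
  using add_in[of x "-y"] minus_in by simp

lemma of_nat_in: "of_nat n \<in> E"
  by (induction n) (auto intro: zero_in one_in add_in)

lemma power_in: "x \<in> E \<Longrightarrow> x ^ n \<in> E"
  by (induction n) (auto intro: one_in mult_in)

lemma polys_add: "p \<in> polys \<Longrightarrow> q \<in> polys \<Longrightarrow> p + q \<in> polys"
  and polys_diff: "p \<in> polys \<Longrightarrow> q \<in> polys \<Longrightarrow> p - q \<in> polys"
  and polys_smult: "c \<in> E \<Longrightarrow> p \<in> polys \<Longrightarrow> smult c p \<in> polys"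
  and polys_monom: "c \<in> E \<Longrightarrow> monom c n \<in> polys"
  and polys_0: "0 \<in> polys"
  unfolding polys_def by (auto intro: add_in diff_in mult_in zero_in)

lemma polys_mult: "p \<in> polys \<Longrightarrow> q \<in> polys \<Longrightarrow> p * q \<in> polys"
  unfolding polys_def by (auto simp: coeff_mult intro: sum_in mult_in)

lemma polys_pCons: "c \<in> E \<Longrightarrow> p \<in> polys \<Longrightarrow> pCons c p \<in> polys"
  unfolding polys_def by (auto simp: coeff_pCons split: nat.split)

lemma polys_pderiv: "p \<in> polys \<Longrightarrow> pderiv p \<in> polys"
  unfolding polys_def by (auto simp: coeff_pderiv intro: mult_in of_nat_in simp del: of_nat_Suc)

lemma poly_in: "p \<in> polys \<Longrightarrow> x \<in> E \<Longrightarrow> poly p x \<in> E"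
  unfolding polys_def by (auto simp: poly_altdef intro: sum_in mult_in power_in)

lemma polys_pcompose:
  assumes "q \<in> polys" shows "p \<in> polys \<Longrightarrow> pcompose p q \<in> polys"
proof (induction p)
  case (pCons a p)
  have "a \<in> E" using pCons(3) unfolding polys_def by (auto simp: coeff_pCons dest: spec[of _ 0])
  moreover have "p \<in> polys" unfolding polys_def
  proof safe
    fix i show "coeff p i \<in> E" using pCons(3) unfolding polys_def by (auto simp: coeff_pCons dest: spec[of _ "Suc i"])
  qed
  ultimately show ?case using pCons(2) assms
    by (auto simp: pcompose_pCons intro!: polys_add polys_mult polys_pCons polys_0)
qed (simp add: polys_0)

lemma minimal_polynomial_exists:
  assumes "p \<in> polys" "p \<noteq> 0" "poly p x = 0"
  obtains m where "m \<in> polys" "lead_coeff m = 1" "poly m x = 0"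
    "\<And>q. q \<in> polys \<Longrightarrow> poly q x = 0 \<Longrightarrow> m dvd q"
proof -
  have "\<exists>m. (m \<in> polys \<and> m \<noteq> 0 \<and> poly m x = 0) \<and>
      (\<forall>q. q \<in> polys \<and> q \<noteq> 0 \<and> poly q x = 0 \<longrightarrow> degree m \<le> degree q)"
    by (rule ex_has_least_nat) (use assms in blast)
  then obtain m' where m': "m' \<in> polys" "m' \<noteq> 0" "poly m' x = 0"
    "\<And>q. q \<in> polys \<Longrightarrow> q \<noteq> 0 \<Longrightarrow> poly q x = 0 \<Longrightarrow> degree m' \<le> degree q" by blast
  define m where "m = smult (inverse (lead_coeff m')) m'"
  have lc: "lead_coeff m' \<in> E" using m'(1) unfolding polys_def by blast
  have m: "m \<in> polys" "lead_coeff m = 1" "poly m x = 0" "degree m = degree m'"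
    unfolding m_def using m' lc by (auto intro: polys_smult inverse_in)
  have "m dvd q" if "q \<in> polys" "poly q x = 0" for q
    using that
  proof (induction "degree q" arbitrary: q rule: less_induct)
    case less
    show ?case
    proof (cases "q = 0")
      case False
      define t where "t = monom (lead_coeff q) (degree q - degree m)"
      have dq: "degree m \<le> degree q" using m'(4)[OF less(2) False less(3)] m(4) by simp
      have "lead_coeff q \<in> E" using less(2) unfolding polys_def by blast
      then have tp: "t * m \<in> polys" unfolding t_def using m(1) by (intro polys_mult polys_monom)
      define r where "r = q - t * m"
      have r: "r \<in> polys" "poly r x = 0" unfolding r_def using less(2,3) tp m(3) by (auto intro: polys_diff)
      have lq: "lead_coeff q \<noteq> 0" using False by simp
      then have t0: "t \<noteq> 0" "degree t = degree q - degree m" "lead_coeff t = lead_coeff q"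
        unfolding t_def by (simp_all add: degree_monom_eq)
      have m0: "m \<noteq> 0" using m(2) by auto
      have "degree (t * m) = degree q" using t0 m0 dq by (simp add: degree_mult_eq)
      moreover have "lead_coeff (t * m) = lead_coeff q" using t0 m(2) by (simp add: lead_coeff_mult)
      ultimately have "degree r \<le> degree q" "coeff r (degree q) = 0" unfolding r_def
        by (auto intro: degree_diff_le)
      then have "r = 0 \<or> degree r < degree q" by (metis le_neq_implies_less leading_coeff_0_iff)
      then have "m dvd r" using less(1)[OF _ r] by auto
      then have "m dvd r + t * m" by simp
      then show ?thesis unfolding r_def by simp
    qed simp
  qed
  then show ?thesis using that m by blast
qed

text \<open>
  The field generated by x. Fractions make closure under inverses evident, whether or not x is
  algebraic.
\<close>
definition adjoin :: "'l \<Rightarrow> 'l set" where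
  "adjoin x = {poly p x / poly q x | p q. p \<in> polys \<and> q \<in> polys}"

lemma adjoinI: "p \<in> polys \<Longrightarrow> q \<in> polys \<Longrightarrow> poly p x / poly q x \<in> adjoin x"
  unfolding adjoin_def by blast

lemma subset_adjoin: "E \<subseteq> adjoin x"
proof
  fix c assume "c \<in> E"
  then have "poly [:c:] x / poly [:1:] x \<in> adjoin x"
    by (intro adjoinI polys_pCons polys_0 one_in)
  then show "c \<in> adjoin x" by simp
qed

lemma generator_in_adjoin: "x \<in> adjoin x"
proof -
  have "poly [:0, 1:] x / poly [:1:] x \<in> adjoin x"
    by (intro adjoinI polys_pCons polys_0 one_in zero_in)
  then show ?thesis by simp
qed

lemma subfield_adjoin: "type_subfield (adjoin x)"
proof
  show "0 \<in> adjoin x" "1 \<in> adjoin x" using subset_adjoin zero_in one_in by auto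
next
  fix y z assume "y \<in> adjoin x" "z \<in> adjoin x"
  then obtain p q p' q' where e: "y = poly p x / poly q x" "z = poly p' x / poly q' x"
    and in_polys: "p \<in> polys" "q \<in> polys" "p' \<in> polys" "q' \<in> polys" unfolding adjoin_def by blast
  show "y * z \<in> adjoin x"
    using adjoinI[of "p * p'" "q * q'" x] in_polys by (simp add: e polys_mult)
  show "y + z \<in> adjoin x"
  proof (cases "poly q x = 0 \<or> poly q' x = 0")
    case True
    then show ?thesis using adjoinI[of p q x] adjoinI[of p' q' x] in_polys by (auto simp: e)
  next
    case False
    then have "y + z = poly (p * q' + p' * q) x / poly (q * q') x" by (simp add: e field_simps)
    moreover have "p * q' + p' * q \<in> polys" "q * q' \<in> polys" using in_polys by (auto intro: polys_add polys_mult)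
    ultimately show ?thesis using adjoinI by metis
  qed
next
  fix y assume "y \<in> adjoin x"
  then obtain p q where e: "y = poly p x / poly q x" and in_polys: "p \<in> polys" "q \<in> polys"
    unfolding adjoin_def by blast
  show "- y \<in> adjoin x"
    using adjoinI[of "0 - p" q x] in_polys by (simp only: e polys_diff polys_0) simp
  show "inverse y \<in> adjoin x" using adjoinI[of q p x] in_polys by (simp add: e)
qed

lemma adjoin_least:
  assumes "type_subfield E'" "E \<subseteq> E'" "x \<in> E'" shows "adjoin x \<subseteq> E'"
proof -
  interpret E': type_subfield E' by fact
  have "polys \<subseteq> E'.polys" unfolding polys_def E'.polys_def using assms(2) by auto
  then show ?thesis unfolding adjoin_def
    by (auto simp: divide_inverse intro!: E'.mult_in E'.inverse_in E'.poly_in assms(3))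
qed

end

text \<open>
  Take \<gamma> = \<theta> + c \<beta>. Over the field generated by \<gamma>, the minimal polynomial h of \<beta> divides both the
  minimal polynomial m of \<beta> over E and m0(\<gamma> - c y), where m0 annihilates \<theta>. For all but finitely many
  c these two polynomials have only the root \<beta> in common. Since m is separable, h is linear.
\<close>
lemma primitive_element_two:
  fixes E :: "'l::{alg_closed_field, field_char_0} set"
  assumes "type_subfield E" and algebraic: "\<And>x. \<exists>p\<in>type_subfield.polys E. p \<noteq> 0 \<and> poly p x = 0"
  obtains \<gamma> where "\<theta> \<in> type_subfield.adjoin E \<gamma>" "\<beta> \<in> type_subfield.adjoin E \<gamma>"
proof -
  interpret E: type_subfield E by fact
  obtain m where m: "m \<in> E.polys" "lead_coeff m = 1" "poly m \<beta> = 0"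
    "\<And>q. q \<in> E.polys \<Longrightarrow> poly q \<beta> = 0 \<Longrightarrow> m dvd q"
  proof -
    obtain p where "p \<in> E.polys" "p \<noteq> 0" "poly p \<beta> = 0" using algebraic[of \<beta>] by blast
    then show ?thesis by (rule E.minimal_polynomial_exists) (rule that)
  qed
  obtain m0 where m0: "m0 \<in> E.polys" "m0 \<noteq> 0" "poly m0 \<theta> = 0" using algebraic[of \<theta>] by blast
  have mne: "m \<noteq> 0" using m(2) by auto
  have dm: "degree m > 0"
  proof (rule ccontr)
    assume "\<not> degree m > 0"
    then obtain c where "m = [:c:]" by (auto elim: degree_eq_zeroE)
    then show False using m(2,3) by simp
  qed
  have simple_root: "poly (pderiv m) \<beta> \<noteq> 0"
  proof
    assume "poly (pderiv m) \<beta> = 0"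
    then have "m dvd pderiv m" using m(1,4) E.polys_pderiv by blast
    moreover have "pderiv m \<noteq> 0" using dm by (simp add: pderiv_eq_0_iff)
    ultimately have "degree m \<le> degree (pderiv m)" by (rule dvd_imp_degree_le)
    then show False using dm by (simp add: degree_pderiv)
  qed
  \<comment> \<open>The values of c for which another common root appears.\<close>
  define bad where "bad = (\<lambda>(s, t). (s - \<theta>) / (\<beta> - t)) ` ({s. poly m0 s = 0} \<times> {t. poly m t = 0})"
  have "finite bad" unfolding bad_def using m0(2) mne by (intro finite_imageI finite_cartesian_product poly_roots_finite)
  moreover have "infinite (range (of_nat :: nat \<Rightarrow> 'l))"
    by (intro range_inj_infinite) (simp add: inj_on_def)
  ultimately have "\<not> range of_nat \<subseteq> bad" using finite_subset by blast
  then obtain n where n: "of_nat n \<notin> bad" by blast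
  define c :: 'l where "c = of_nat n"
  define \<gamma> where "\<gamma> = \<theta> + c * \<beta>"
  define F where "F = E.adjoin \<gamma>"
  interpret F: type_subfield F unfolding F_def by (rule E.subfield_adjoin)
  have EF: "E \<subseteq> F" and gF: "\<gamma> \<in> F" unfolding F_def using E.subset_adjoin E.generator_in_adjoin by auto
  have cF: "c \<in> F" unfolding c_def by (rule F.of_nat_in)
  have EFp: "E.polys \<subseteq> F.polys" unfolding E.polys_def F.polys_def using EF by auto
  obtain h where h: "h \<in> F.polys" "lead_coeff h = 1" "poly h \<beta> = 0"
    "\<And>q. q \<in> F.polys \<Longrightarrow> poly q \<beta> = 0 \<Longrightarrow> h dvd q"
  proof -
    have "m \<in> F.polys" using m(1) EFp by blast
    then show ?thesis using mne m(3) by (rule F.minimal_polynomial_exists) (rule that)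
  qed
  have hm: "h dvd m" using h(4) m(1,3) EFp by blast
  have "pcompose m0 [:\<gamma>, -c:] \<in> F.polys"
    using m0(1) EFp cF gF by (meson F.polys_pcompose F.polys_pCons F.polys_0 F.minus_in subsetD)
  moreover have "poly (pcompose m0 [:\<gamma>, -c:]) \<beta> = 0"
    using m0(3) by (simp add: poly_pcompose \<gamma>_def)
  ultimately have hm0: "h dvd pcompose m0 [:\<gamma>, -c:]" using h(4) by blast
  have only_root: "t = \<beta>" if "poly h t = 0" for t
  proof (rule ccontr)
    assume ne: "t \<noteq> \<beta>"
    have "poly m t = 0" using that hm by (auto elim!: dvdE)
    moreover have "poly m0 (\<theta> + c * (\<beta> - t)) = 0"
    proof -
      obtain r where "pcompose m0 [:\<gamma>, -c:] = h * r" using hm0 by (elim dvdE)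
      then have "poly (pcompose m0 [:\<gamma>, -c:]) t = 0" using that by simp
      then show ?thesis by (simp add: poly_pcompose \<gamma>_def algebra_simps)
    qed
    ultimately have "(\<theta> + c * (\<beta> - t) - \<theta>) / (\<beta> - t) \<in> bad" unfolding bad_def by (intro image_eqI[of _ _ "(\<theta> + c * (\<beta> - t), t)"]) simp_all
    then show False using n ne unfolding c_def by simp
  qed
  obtain h1 where h1: "h = [:-\<beta>, 1:] * h1" using iffD1[OF poly_eq_0_iff_dvd h(3)] by (elim dvdE)
  have "degree h1 = 0"
  proof (rule ccontr)
    assume "degree h1 \<noteq> 0"
    then obtain t where "poly h1 t = 0" using alg_closed_imp_poly_has_root[of h1] by auto
    moreover from this have "t = \<beta>" by (intro only_root) (simp add: h1)
    ultimately have "[:-\<beta>, 1:] dvd h1" by (simp add: poly_eq_0_iff_dvd)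
    then have "[:-\<beta>, 1:] * [:-\<beta>, 1:] dvd m" using hm unfolding h1 by (intro dvd_trans[OF _ hm[unfolded h1]] mult_dvd_mono dvd_refl)
    then obtain r where "m = ([:-\<beta>, 1:] * [:-\<beta>, 1:]) * r" by (rule dvdE)
    then have "m = [:-\<beta>, 1:] * ([:-\<beta>, 1:] * r)" by (simp only: mult.assoc)
    then have "poly (pderiv m) \<beta> = 0" by (simp add: pderiv_mult pderiv_pCons del: mult_pCons_left mult_pCons_right)
    then show False using simple_root by blast
  qed
  then obtain d where "h1 = [:d:]" by (auto elim: degree_eq_zeroE)
  moreover have "lead_coeff h1 = 1" using h(2) by (simp add: h1 lead_coeff_mult del: mult_pCons_left)
  ultimately have "h = [:-\<beta>, 1:]" using h1 by simp
  then have "- \<beta> \<in> F" using h(1) unfolding F.polys_def by (auto dest: spec[of _ 0])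
  then have "- (- \<beta>) \<in> F" by (rule F.minus_in)
  then have b: "\<beta> \<in> F" by simp
  have "\<theta> = \<gamma> - c * \<beta>" by (simp add: \<gamma>_def)
  then have "\<theta> \<in> F" using b cF gF by (simp add: F.diff_in F.mult_in)
  then show ?thesis using that b unfolding F_def by blast
qed

lemma primitive_element:
  fixes E :: "'l::{alg_closed_field, field_char_0} set"
  assumes "type_subfield E" and "\<And>x. \<exists>p\<in>type_subfield.polys E. p \<noteq> 0 \<and> poly p x = 0"
    and "finite S"
  shows "\<exists>\<gamma>. S \<subseteq> type_subfield.adjoin E \<gamma>"
  using assms(3)
proof (induction S)
  case (insert \<beta> S)
  interpret E: type_subfield E by fact
  from insert obtain \<theta> where \<theta>: "S \<subseteq> E.adjoin \<theta>" by blast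
  obtain \<gamma> where \<gamma>: "\<theta> \<in> E.adjoin \<gamma>" "\<beta> \<in> E.adjoin \<gamma>"
    by (rule primitive_element_two[OF assms(1,2)])
  have "E.adjoin \<theta> \<subseteq> E.adjoin \<gamma>"
    using \<gamma>(1) E.subset_adjoin by (intro E.adjoin_least E.subfield_adjoin)
  then show ?case using \<theta> \<gamma>(2) by blast
qed simp

lemma card_simple_roots:
  fixes p :: "'l::alg_closed_field poly"
  assumes "p \<noteq> 0" and simple: "\<And>x. poly p x = 0 \<Longrightarrow> poly (pderiv p) x \<noteq> 0"
  shows "card {x. poly p x = 0} = degree p"
proof -
  obtain A where A: "size A = degree p" "p = smult (lead_coeff p) (\<Prod>x\<in>#A. [:-x, 1:])"
    using alg_closed_imp_factorization[OF assms(1)] by blast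
  have count: "count A x \<le> 1" for x
  proof (rule ccontr)
    assume "\<not> count A x \<le> 1"
    then have "{#x, x#} \<subseteq># A" by (intro mset_subset_eqI) auto
    then obtain B where "A = {#x, x#} + B" by (metis subset_mset.add_diff_inverse)
    then have p: "p = [:-x, 1:] * ([:-x, 1:] * smult (lead_coeff p) (\<Prod>x\<in>#B. [:-x, 1:]))"
      using A(2) by (simp add: mult.assoc del: mult_pCons_left mult_pCons_right)
    have "poly p x = 0" by (subst p) simp
    moreover have "poly (pderiv p) x = 0"
      by (subst p) (simp add: pderiv_smult pderiv_mult pderiv_pCons del: mult_pCons_left mult_pCons_right)
    ultimately show False using simple by blast
  qed
  have "poly p x = 0 \<longleftrightarrow> x \<in># A" for x
    using assms(1) by (subst A(2)) (auto simp: poly_prod_mset prod_mset_zero_iff)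
  then have "{x. poly p x = 0} = set_mset A" by auto
  moreover have "A = mset_set (set_mset A)"
  proof (rule multiset_eqI)
    fix x show "count A x = count (mset_set (set_mset A)) x"
      using count[of x] by (cases "x \<in># A") (auto simp: not_in_iff intro!: antisym Suc_leI)
  qed
  then have "size A = card (set_mset A)" by (metis size_mset_set)
  ultimately show ?thesis using A(1) by simp
qed

lemma field_hom_to_ac: "field_hom (to_ac :: 'f::field \<Rightarrow> 'f alg_closure)"
  by unfold_locales auto

text \<open>
  Take \<theta> to be a primitive element of the splitting field of f, g its minimal polynomial, and write
  the roots of f as h(\<theta>) with polynomials h in H. In this form the statement mentions only
  polynomials over the base field, and can be transported to every extension in which g has a root:
  see \<open>conjugate_roots_generate\<close>.
\<close>
theorem normal_generator:
  fixes f :: "'f::field_char_0 poly"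
  assumes "irreducible f"
  obtains g :: "'f poly" and H :: "'f poly set" where "irreducible g" "lead_coeff g = 1" 
    "finite H" "card H = degree f" "\<And>h. h \<in> H \<Longrightarrow> g dvd pcompose f h"
    "\<And>h h'. h \<in> H \<Longrightarrow> h' \<in> H \<Longrightarrow> h \<noteq> h' \<Longrightarrow> \<not> g dvd h - h'"
proof -
  interpret ac: field_hom "to_ac :: 'f \<Rightarrow> 'f alg_closure" by (rule field_hom_to_ac)
  interpret acp: map_poly_inj_comm_ring_hom "to_ac :: 'f \<Rightarrow> 'f alg_closure" ..
  define E where "E = range (to_ac :: 'f \<Rightarrow> 'f alg_closure)"
  define up where "up = map_poly (to_ac :: 'f \<Rightarrow> 'f alg_closure)"
  interpret E: type_subfield E
  proof
    show "0 \<in> E" "1 \<in> E" unfolding E_def by (auto simp: image_iff intro: exI[of _ 0] exI[of _ 1])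
    show "x + y \<in> E" "x * y \<in> E" if "x \<in> E" "y \<in> E" for x y
      using that unfolding E_def by (auto simp flip: to_ac_add to_ac_mult)
    show "- x \<in> E" "inverse x \<in> E" if "x \<in> E" for x
      using that unfolding E_def by (auto simp flip: to_ac_minus to_ac_inverse)
  qed
  have polysE: "E.polys = range up"
  proof (intro equalityI subsetI)
    fix p assume "p \<in> E.polys"
    then have "coeff p i \<in> E" for i unfolding E.polys_def by blast
    then have "\<And>i. coeff p i \<in> range to_ac" unfolding E_def .
    then have "p = up (map_poly of_ac p)"
      unfolding up_def by (intro poly_eqI) (simp add: coeff_map_poly to_ac_of_ac)
    then show "p \<in> range up" by blast
  next
    fix p assume "p \<in> range up"
    then have "coeff p i \<in> E" for i by (auto simp: up_def E_def)
    then show "p \<in> E.polys" by (simp add: E.polys_def)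
  qed
  have algE: "\<exists>p\<in>E.polys. p \<noteq> 0 \<and> poly p x = 0" for x
  proof -
    obtain p :: "'f poly" where "p \<noteq> 0" "poly (map_poly to_ac p) x = 0" by (rule alg_closure_algebraic)
    then show ?thesis unfolding polysE up_def by auto
  qed
  have f0: "f \<noteq> 0" using assms by auto
  have df: "degree f > 0"
  proof (rule ccontr)
    assume "\<not> degree f > 0"
    then have "is_unit f" using f0 is_unit_iff_degree by auto
    then show False using assms by auto
  qed
  define S where "S = {x. poly (up f) x = 0}"
  have upf: "up f \<noteq> 0" unfolding up_def using f0 by simp
  have finS: "finite S" unfolding S_def using upf by (rule poly_roots_finite)
  have cardS: "card S = degree f"
  proof -
    have "\<not> f dvd pderiv f"
    proof
      assume "f dvd pderiv f"
      moreover have "pderiv f \<noteq> 0" using df by (simp add: pderiv_eq_0_iff)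
      ultimately have "degree f \<le> degree (pderiv f)" by (rule dvd_imp_degree_le)
      then show False using df by (simp add: degree_pderiv)
    qed
    then obtain u v where "u * f + v * pderiv f = 1" using irreducible_bezout[OF assms] by blast
    then have "up u * up f + up v * up (pderiv f) = 1"
      unfolding up_def by (metis acp.hom_add acp.hom_mult acp.hom_one)
    then have uv: "up u * up f + up v * pderiv (up f) = 1" unfolding up_def by (simp add: ac.map_poly_pderiv)
    have "card S = degree (up f)" unfolding S_def
    proof (rule card_simple_roots[OF upf], rule notI)
      fix x assume "poly (up f) x = 0" "poly (pderiv (up f)) x = 0"
      then have "poly (up u * up f + up v * pderiv (up f)) x = 0" by simp
      then show False unfolding uv by simp
    qed
    then show ?thesis unfolding up_def by simp
  qed
  from primitive_element[OF E.type_subfield_axioms algE finS] obtain \<theta> where \<theta>: "S \<subseteq> E.adjoin \<theta>" by blast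
  obtain g' where g': "g' \<in> E.polys" "lead_coeff g' = 1" "poly g' \<theta> = 0"
    "\<And>q. q \<in> E.polys \<Longrightarrow> poly q \<theta> = 0 \<Longrightarrow> g' dvd q"
  proof -
    obtain p where "p \<in> E.polys" "p \<noteq> 0" "poly p \<theta> = 0" using algE[of \<theta>] by blast
    then show ?thesis by (rule E.minimal_polynomial_exists) (rule that)
  qed
  obtain g where g: "g' = up g" using g'(1) polysE by auto
  have dvd: "poly (up q) \<theta> = 0 \<longleftrightarrow> g dvd q" for q
  proof
    assume "poly (up q) \<theta> = 0"
    then have "g' dvd up q" using g'(4) polysE by blast
    then show "g dvd q" unfolding g up_def by (rule ac.dvd_map_poly_hom_imp_dvd)
  next
    assume "g dvd q"
    then show "poly (up q) \<theta> = 0" using g'(3) unfolding g up_def by (auto elim!: dvdE simp: acp.hom_mult)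
  qed
  have lg: "lead_coeff g = 1" using g'(2) unfolding g up_def by simp
  have irr: "irreducible g"
  proof (rule irreducibleI)
    show "g \<noteq> 0" using lg by auto
    show "\<not> is_unit g" using dvd[of 1] unfolding up_def by simp
    fix a b assume ab: "g = a * b"
    then have "poly (up a) \<theta> * poly (up b) \<theta> = 0" using g'(3) unfolding g up_def by (simp add: acp.hom_mult)
    then have "g dvd a \<or> g dvd b" using dvd by auto
    have ne: "a \<noteq> 0" "b \<noteq> 0" using ab lg by auto
    from \<open>g dvd a \<or> g dvd b\<close> show "is_unit a \<or> is_unit b"
    proof
      assume "g dvd a"
      then have "a * b dvd a * 1" using ab by simp
      then have "b dvd 1" using ne by (simp only: dvd_mult_cancel_left) simp
      then show ?thesis by blast
    next
      assume "g dvd b"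
      then have "a * b dvd 1 * b" using ab by simp
      then have "a dvd 1" using ne by (simp only: dvd_mult_cancel_right) simp
      then show ?thesis by blast
    qed
  qed
  have "\<exists>h. poly (up h) \<theta> = x" if "x \<in> S" for x
  proof -
    have "x \<in> E.adjoin \<theta>" using that \<theta> by blast
    then obtain p q where pq: "x = poly (up p) \<theta> / poly (up q) \<theta>" unfolding E.adjoin_def polysE by blast
    show ?thesis
    proof (cases "g dvd q")
      case True
      then have "x = poly (up 0) \<theta>" using pq dvd[of q] by (simp add: up_def)
      then show ?thesis by blast
    next
      case False
      then obtain u v where "u * g + v * q = 1" using irreducible_bezout[OF irr] by blast
      then have "poly (up u) \<theta> * poly (up g) \<theta> + poly (up v) \<theta> * poly (up q) \<theta> = 1"
        unfolding up_def by (metis acp.hom_add acp.hom_mult acp.hom_one poly_1 poly_add poly_mult)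
      then have "poly (up v) \<theta> * poly (up q) \<theta> = 1" using g'(3) g by simp
      then have "x = poly (up (p * v)) \<theta>" unfolding pq up_def
        using inverse_unique[of "poly (up q) \<theta>" "poly (up v) \<theta>"]
        by (simp add: acp.hom_mult divide_inverse up_def mult.commute)
      then show ?thesis by blast
    qed
  qed
  then obtain \<eta> where \<eta>: "\<And>x. x \<in> S \<Longrightarrow> poly (up (\<eta> x)) \<theta> = x" by metis
  have inj: "inj_on \<eta> S" by (rule inj_onI) (metis \<eta>)
  show ?thesis
  proof (rule that[of g "\<eta> ` S"])
    show "irreducible g" "lead_coeff g = 1" "finite (\<eta> ` S)" using irr lg finS by auto
    show "card (\<eta> ` S) = degree f" using card_image[OF inj] cardS by simp
  next
    fix h assume "h \<in> \<eta> ` S"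
    then obtain x where x: "x \<in> S" "h = \<eta> x" by blast
    then have "poly (up (pcompose f h)) \<theta> = 0"
      using \<eta>[OF x(1)] unfolding up_def by (simp add: ac.map_poly_pcompose poly_pcompose S_def[unfolded up_def])
    then show "g dvd pcompose f h" using dvd by blast
  next
    fix h h' assume "h \<in> \<eta> ` S" "h' \<in> \<eta> ` S" "h \<noteq> h'"
    then obtain x y where xy: "x \<in> S" "y \<in> S" "h = \<eta> x" "h' = \<eta> y" "x \<noteq> y" by blast
    have "poly (up (h - h')) \<theta> = x - y" using \<eta> xy unfolding up_def by (simp add: acp.hom_minus)
    then show "\<not> g dvd h - h'" using dvd xy(5) by (metis eq_iff_diff_eq_0)
  qed
qed

text \<open>
  The values h(\<theta>) for h in H are roots of f, they are distinct because g is coprime to the differences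
  h - h', and their number is the degree of f. So they are all the roots of f.
\<close>
lemma conjugate_roots_generate:
  fixes f g :: "'f::field poly" and hom :: "'f \<Rightarrow> 'l::field"
  assumes "field_hom hom" and "irreducible g" and "f \<noteq> 0"
    and H: "finite H" "card H = degree f" "\<And>h. h \<in> H \<Longrightarrow> g dvd pcompose f h"
    "\<And>h h'. h \<in> H \<Longrightarrow> h' \<in> H \<Longrightarrow> h \<noteq> h' \<Longrightarrow> \<not> g dvd h - h'"
    and root: "poly (map_poly hom g) \<theta> = 0" and "poly (map_poly hom f) \<alpha> = 0"
  shows "\<exists>h\<in>H. \<alpha> = poly (map_poly hom h) \<theta>"
proof -
  interpret hom: field_hom hom by fact
  interpret homp: map_poly_inj_comm_ring_hom hom ..
  define \<phi> where "\<phi> h = poly (map_poly hom h) \<theta>" for h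
  have "inj_on \<phi> H"
  proof (rule inj_onI, rule ccontr)
    fix h h' assume h: "h \<in> H" "h' \<in> H" "\<phi> h = \<phi> h'" "h \<noteq> h'"
    then obtain u v where "u * g + v * (h - h') = 1" using irreducible_bezout[OF assms(2)] H(4) by blast
    then have "map_poly hom u * map_poly hom g + map_poly hom v * (map_poly hom h - map_poly hom h') = 1"
      by (metis homp.hom_add homp.hom_mult homp.hom_one homp.hom_minus)
    then have "poly (map_poly hom u * map_poly hom g + map_poly hom v * (map_poly hom h - map_poly hom h')) \<theta> = 1" by simp
    then show False using root h(3) unfolding \<phi>_def by simp
  qed
  then have "card (\<phi> ` H) = degree f" using H(2) by (simp add: card_image)
  define R where "R = {x. poly (map_poly hom f) x = 0}"
  have ne: "map_poly hom f \<noteq> 0" using assms(3) by simp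
  have "\<phi> ` H \<subseteq> R"
  proof safe
    fix h assume "h \<in> H"
    then have "g dvd pcompose f h" by (rule H(3))
    then obtain k where "pcompose f h = g * k" by (rule dvdE)
    then have "pcompose (map_poly hom f) (map_poly hom h) = map_poly hom g * map_poly hom k"
      by (metis hom.map_poly_pcompose homp.hom_mult)
    then have "poly (pcompose (map_poly hom f) (map_poly hom h)) \<theta> = 0" using root by simp
    then show "\<phi> h \<in> R" unfolding R_def \<phi>_def by (simp add: poly_pcompose)
  qed
  moreover have "finite R" "card R \<le> degree f"
    unfolding R_def using poly_roots_finite[OF ne] card_poly_roots_bound[OF ne] by auto
  ultimately have "\<phi> ` H = R" using \<open>card (\<phi> ` H) = degree f\<close> by (metis card_seteq)
  then show ?thesis using assms(9) unfolding R_def \<phi>_def by auto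
qed

section \<open>Orders of Laurent series\<close>

text \<open>
  Zero has every order in this sense, so that sums, products and determinants can be estimated without
  distinguishing cases.
\<close>
definition ord_ge :: "'a::field fls \<Rightarrow> int \<Rightarrow> bool" where
  "ord_ge u n \<longleftrightarrow> (\<forall>k<n. fls_nth u k = 0)"

lemma ord_ge_iff: "ord_ge u n \<longleftrightarrow> u = 0 \<or> n \<le> fls_subdegree u"
proof
  assume v: "ord_ge u n"
  show "u = 0 \<or> n \<le> fls_subdegree u"
  proof (rule ccontr)
    assume "\<not> (u = 0 \<or> n \<le> fls_subdegree u)"
    then have "fls_nth u (fls_subdegree u) = 0" "u \<noteq> 0" using v unfolding ord_ge_def by auto
    then show False by simp
  qed
qed (auto simp: ord_ge_def)

lemma ord_ge_0 [simp]: "ord_ge 0 n"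
  by (simp add: ord_ge_def)

lemma ord_ge_exists: "\<exists>n. ord_ge u n"
  using ord_ge_iff by blast

lemma ord_ge_mono: "ord_ge u n \<Longrightarrow> m \<le> n \<Longrightarrow> ord_ge u m"
  by (simp add: ord_ge_def)

lemma ord_ge_add: "ord_ge u n \<Longrightarrow> ord_ge v n \<Longrightarrow> ord_ge (u + v) n"
  and ord_ge_diff: "ord_ge u n \<Longrightarrow> ord_ge v n \<Longrightarrow> ord_ge (u - v) n"
  and ord_ge_minus: "ord_ge u n \<Longrightarrow> ord_ge (- u) n"
  by (simp_all add: ord_ge_def)

lemma ord_ge_sum: "(\<And>i. i \<in> A \<Longrightarrow> ord_ge (f i) n) \<Longrightarrow> ord_ge (sum f A) n"
  by (induction A rule: infinite_finite_induct) (auto intro: ord_ge_add)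

lemma ord_ge_mult:
  "ord_ge u m \<Longrightarrow> ord_ge v n \<Longrightarrow> ord_ge (u * v) (m + n)"
  unfolding ord_ge_iff by (cases "u = 0 \<or> v = 0") auto

lemma ord_ge_const [simp]: "ord_ge (fls_const c) 0"
  by (simp add: ord_ge_def)

lemma ord_ge_one [simp]: "ord_ge 1 0"
  by (simp add: ord_ge_def)

lemma ord_ge_prod:
  "(\<And>i. i \<in> A \<Longrightarrow> ord_ge (f i) (b i)) \<Longrightarrow> ord_ge (prod f A) (sum b A)"
  by (induction A rule: infinite_finite_induct) (auto intro: ord_ge_mult)

lemma ord_ge_deriv: "ord_ge u n \<Longrightarrow> ord_ge (fls_deriv u) (n - 1)"
  by (simp add: ord_ge_def)

lemma ord_ge_det:
  assumes A: "A \<in> carrier_mat M M"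
    and le: "\<And>i j. i < M \<Longrightarrow> j < M \<Longrightarrow> ord_ge (A $$ (i, j)) (b j)"
  shows "ord_ge (det A) (\<Sum>j<M. b j)"
  unfolding det_def'[OF A]
proof (rule ord_ge_sum)
  fix p assume "p \<in> {p. p permutes {0..<M}}"
  then have p: "p permutes {0..<M}" by simp
  have "ord_ge (\<Prod>i = 0..<M. A $$ (i, p i)) (\<Sum>i = 0..<M. b (p i))"
    using permutes_in_image[OF p] by (intro ord_ge_prod le) auto
  also have "(\<Sum>i = 0..<M. b (p i)) = (\<Sum>j<M. b j)"
    using sum.permute[OF p, of b] by (simp add: o_def atLeast0LessThan)
  finally have "ord_ge (\<Prod>i = 0..<M. A $$ (i, p i)) (\<Sum>j<M. b j)" .
  then show "ord_ge (signof p * (\<Prod>i = 0..<M. A $$ (i, p i))) (\<Sum>j<M. b j)"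
    by (auto simp: sign_def ord_ge_minus)
qed

text \<open>
  Linearly independent series v_i span a space over the constants in which the order of nonzero
  elements is bounded. When a further series v_x is added and combinations v_x + s of arbitrarily high
  order exist, the difference of two of these lies in the old span, so s does not depend on the
  required order, and v_x + s = 0.
\<close>
lemma finite_family_bounded_order:
  fixes v :: "'i \<Rightarrow> 'a::field fls"
  assumes "finite A"
    and "\<And>c. (\<Sum>i\<in>A. fls_const (c i) * v i) = 0 \<Longrightarrow> \<forall>i\<in>A. c i = 0"
  shows "\<exists>R. \<forall>c. ord_ge (\<Sum>i\<in>A. fls_const (c i) * v i) R \<longrightarrow> (\<forall>i\<in>A. c i = 0)"
  using assms
proof (induction A)
  case (insert x A)
  define S where "S c = (\<Sum>i\<in>A. fls_const (c i) * v i)" for c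
  have split: "(\<Sum>i\<in>insert x A. fls_const (c i) * v i) = fls_const (c x) * v x + S c" for c
    unfolding S_def using insert.hyps by simp
  have S_upd: "S (c(x := a)) = S c" for c a
    unfolding S_def using insert.hyps by (intro sum.cong) auto
  have ind: "\<forall>i\<in>A. c i = 0" if "S c = 0" for c
  proof
    fix i assume i: "i \<in> A"
    have "(\<Sum>i\<in>insert x A. fls_const ((c(x := 0)) i) * v i) = 0"
      unfolding split S_upd using that by simp
    then have "\<forall>i\<in>insert x A. (c(x := 0)) i = 0" by (rule insert.prems)
    then have "(c(x := 0)) i = 0" using i by blast
    moreover have "i \<noteq> x" using i insert.hyps by blast
    ultimately show "c i = 0" by simp
  qed
  have "\<exists>R. \<forall>c. ord_ge (S c) R \<longrightarrow> (\<forall>i\<in>A. c i = 0)"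
    using insert.IH ind unfolding S_def by blast
  then obtain R where R: "\<And>c. ord_ge (S c) R \<Longrightarrow> \<forall>i\<in>A. c i = 0" by blast
  show ?case
  proof (rule ccontr)
    assume "\<not> ?thesis"
    then have "\<exists>c. ord_ge (fls_const (c x) * v x + S c) n \<and> \<not> (\<forall>i\<in>insert x A. c i = 0)" for n
      unfolding split by blast
    then obtain c where c: "\<And>n. ord_ge (fls_const (c n x) * v x + S (c n)) n"
       "\<And>n. \<not> (\<forall>i\<in>insert x A. c n i = 0)" by metis
    have cx: "c n x \<noteq> 0" if "n \<ge> R" for n
    proof
      assume 0: "c n x = 0"
      then have "ord_ge (S (c n)) n" using c(1)[of n] by simp
      then have "ord_ge (S (c n)) R" using that by (rule ord_ge_mono)
      then show False using R c(2)[of n] 0 by blast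
    qed
    define d where "d n i = c n i / c n x" for n i
    have Sd: "S (d n) = fls_const (inverse (c n x)) * S (c n)" for n
      unfolding S_def d_def sum_distrib_left
    proof (intro sum.cong refl)
      fix i
      have "fls_const (c n i / c n x) = fls_const (inverse (c n x)) * fls_const (c n i)"
        by (simp add: divide_inverse mult.commute fls_const_mult_const)
      then show "fls_const (c n i / c n x) * v i = fls_const (inverse (c n x)) * (fls_const (c n i) * v i)"
        by (simp only: mult.assoc)
    qed
    have d: "ord_ge (v x + S (d n)) n" if "n \<ge> R" for n
    proof -
      have "v x + S (d n) = fls_const (inverse (c n x)) * (fls_const (c n x) * v x + S (c n))"
      proof -
        have "fls_const (inverse (c n x)) * (fls_const (c n x) * v x) = v x"
          using cx[OF that] by (simp add: mult.assoc[symmetric] fls_const_mult_const)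
        then show ?thesis unfolding Sd by (simp only: distrib_left)
      qed
      then show ?thesis using ord_ge_mult[OF ord_ge_const c(1)[of n]] by simp
    qed
    have const: "\<forall>i\<in>A. d n i = d R i" if "n \<ge> R" for n
    proof -
      have "S (\<lambda>i. d n i - d R i) = (v x + S (d n)) - (v x + S (d R))"
      proof -
        have "S (\<lambda>i. d n i - d R i) = S (d n) - S (d R)"
          unfolding S_def sum_subtractf[symmetric]
          by (intro sum.cong refl) (simp add: left_diff_distrib flip: fls_minus_const)
        then show ?thesis by simp
      qed
      moreover have "ord_ge ((v x + S (d n)) - (v x + S (d R))) R"
        by (intro ord_ge_diff ord_ge_mono[OF d[OF that] that] d order_refl)
      ultimately show ?thesis using R[of "\<lambda>i. d n i - d R i"] by auto
    qed
    have all: "ord_ge (v x + S (d R)) n" if "n \<ge> R" for n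
    proof -
      have "S (d n) = S (d R)"
        unfolding S_def by (intro sum.cong refl) (simp only: bspec[OF const[OF that]])
      then show ?thesis using d[OF that] by simp
    qed
    have "fls_nth (v x + S (d R)) k = 0" for k
      using all[of "max R (k + 1)"] unfolding ord_ge_def by auto
    then have "v x + S (d R) = 0" by (intro fls_eqI) simp
    then have "(\<Sum>i\<in>insert x A. fls_const (((d R)(x := 1)) i) * v i) = 0"
      unfolding split S_upd by simp
    then have "\<forall>i\<in>insert x A. ((d R)(x := 1)) i = 0" by (rule insert.prems)
    then show False by auto
  qed
qed auto

section \<open>Wronskians\<close>

locale derivation =
  fixes \<delta> :: "'f::comm_ring_1 \<Rightarrow> 'f"
  assumes deriv_add: "\<delta> (x + y) = \<delta> x + \<delta> y"
    and deriv_mult: "\<delta> (x * y) = \<delta> x * y + x * \<delta> y"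
begin

lemma deriv_0: "\<delta> 0 = 0" using deriv_add[of 0 0] by simp

lemma deriv_1: "\<delta> 1 = 0" using deriv_mult[of 1 1] by simp

lemma deriv_sum: "\<delta> (sum f A) = (\<Sum>i\<in>A. \<delta> (f i))"
  by (induction A rule: infinite_finite_induct) (simp_all add: deriv_0 deriv_add)

lemma deriv_minus: "\<delta> (- x) = - \<delta> x"
  using deriv_add[of x "-x"] by (simp add: deriv_0 eq_neg_iff_add_eq_0 add.commute)

definition wronskian :: "nat \<Rightarrow> (nat \<Rightarrow> 'f) \<Rightarrow> 'f" where
  "wronskian M u = det (mat M M (\<lambda>(\<rho>, i). (\<delta> ^^ \<rho>) (u i)))"

lemma iterate_linear:
  assumes "\<And>i. i \<in> A \<Longrightarrow> \<delta> (c i) = 0"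
  shows "(\<delta> ^^ \<rho>) (\<Sum>i\<in>A. c i * u i) = (\<Sum>i\<in>A. c i * (\<delta> ^^ \<rho>) (u i))"
  by (induction \<rho>) (simp_all add: deriv_sum deriv_mult assms)

lemma wronskian_linear_change:
  assumes P: "P \<in> carrier_mat M M"
    and const: "\<And>i j. i < M \<Longrightarrow> j < M \<Longrightarrow> \<delta> (P $$ (i, j)) = 0"
    and u': "\<And>i. i < M \<Longrightarrow> u' i = (\<Sum>j<M. P $$ (i, j) * u j)"
  shows "wronskian M u' = wronskian M u * det P"
proof -
  let ?W = "mat M M (\<lambda>(\<rho>, i). (\<delta> ^^ \<rho>) (u i))"
  have "mat M M (\<lambda>(\<rho>, i). (\<delta> ^^ \<rho>) (u' i)) = ?W * transpose_mat P"
  proof (rule eq_matI)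
    fix \<rho> i assume "\<rho> < dim_row (?W * transpose_mat P)" "i < dim_col (?W * transpose_mat P)"
    then have i: "\<rho> < M" "i < M" using P by auto
    have "(\<delta> ^^ \<rho>) (u' i) = (\<Sum>j<M. P $$ (i, j) * (\<delta> ^^ \<rho>) (u j))"
      unfolding u'[OF i(2)] using const i(2) by (intro iterate_linear) auto
    also have "\<dots> = (?W * transpose_mat P) $$ (\<rho>, i)"
      using i P by (simp add: scalar_prod_def atLeast0LessThan mult.commute)
    finally show "mat M M (\<lambda>(\<rho>, i). (\<delta> ^^ \<rho>) (u' i)) $$ (\<rho>, i) = (?W * transpose_mat P) $$ (\<rho>, i)"
      using i by simp
  qed (use P in auto)
  moreover have "det (?W * transpose_mat P) = det ?W * det (transpose_mat P)"
    by (rule det_mult[of _ M]) (use P in auto)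
  ultimately show ?thesis unfolding wronskian_def by (simp add: det_transpose[OF P])
qed

end

lemma wronskian_hom:
  assumes "derivation d" "derivation d'" "comm_ring_hom h" and comm: "\<And>x. h (d x) = d' (h x)"
  shows "h (derivation.wronskian d M u) = derivation.wronskian d' M (\<lambda>i. h (u i))"
proof -
  interpret d: derivation d by fact
  interpret d': derivation d' by fact
  interpret h: comm_ring_hom h by fact
  have iter: "h ((d ^^ \<rho>) x) = (d' ^^ \<rho>) (h x)" for \<rho> x by (induction \<rho>) (simp_all add: comm)
  have "map_mat h (mat M M (\<lambda>(\<rho>, i). (d ^^ \<rho>) (u i))) = mat M M (\<lambda>(\<rho>, i). (d' ^^ \<rho>) (h (u i)))"
    by (rule eq_matI) (auto simp: iter)
  then show ?thesis unfolding d.wronskian_def d'.wronskian_def by (simp flip: h.hom_det)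
qed

text \<open>
  The classical argument: if the Wronskian of the first M functions does not vanish, then the kernel
  vector of the larger matrix may be normalized to have last entry 1. Differentiating its relations
  gives a kernel vector of the smaller matrix, so the derivatives of all entries vanish.
\<close>
lemma wronskian_eq_0_imp_dependent:
  fixes \<delta> :: "'f::field \<Rightarrow> 'f"
  assumes "derivation \<delta>" and "derivation.wronskian \<delta> M u = 0"
  shows "\<exists>c. (\<forall>i<M. \<delta> (c i) = 0) \<and> (\<exists>i<M. c i \<noteq> 0) \<and> (\<Sum>i<M. c i * u i) = 0"
  using assms(2)
proof (induction M)
  case 0
  interpret derivation \<delta> by fact
  show ?case using 0 by (simp add: wronskian_def)
next
  case (Suc M)
  interpret derivation \<delta> by fact
  show ?case
  proof (cases "wronskian M u = 0")
    case True
    from Suc.IH[OF this] obtain c where c: "\<forall>i<M. \<delta> (c i) = 0" "\<exists>i<M. c i \<noteq> 0" "(\<Sum>i<M. c i * u i) = 0" by blast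
    then show ?thesis by (intro exI[of _ "\<lambda>i. if i < M then c i else 0"]) (auto simp: deriv_0 less_Suc_eq)
  next
    case False
    let ?A = "\<lambda>M. mat M M (\<lambda>(\<rho>, i). (\<delta> ^^ \<rho>) (u i))"
    have vanish: "\<forall>i<M. w i = 0" if "\<And>\<rho>. \<rho> < M \<Longrightarrow> (\<Sum>i<M. w i * (\<delta> ^^ \<rho>) (u i)) = 0" for w
    proof (rule ccontr)
      assume ne: "\<not> (\<forall>i<M. w i = 0)"
      have "?A M *\<^sub>v vec M w = 0\<^sub>v M"
        using that by (intro eq_vecI) (simp_all add: scalar_prod_def atLeast0LessThan mult.commute)
      moreover have "vec M w \<noteq> 0\<^sub>v M"
      proof
        assume "vec M w = 0\<^sub>v M"
        then have "vec M w $ i = 0\<^sub>v M $ i" for i by simp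
        then show False using ne by (metis index_vec index_zero_vec(1))
      qed
      ultimately have "det (?A M) = 0"
        by (subst det_0_iff_vec_prod_zero_field[of _ M]) (auto intro!: exI[of _ "vec M w"])
      then show False using False unfolding wronskian_def by blast
    qed
    have "det (?A (Suc M)) = 0" using Suc.prems unfolding wronskian_def .
    then obtain v where v: "v \<in> carrier_vec (Suc M)" "v \<noteq> 0\<^sub>v (Suc M)" "?A (Suc M) *\<^sub>v v = 0\<^sub>v (Suc M)"
      using det_0_iff_vec_prod_zero_field[of "?A (Suc M)" "Suc M"] by auto
    have rel: "(\<Sum>i<Suc M. v $ i * (\<delta> ^^ \<rho>) (u i)) = 0" if "\<rho> < Suc M" for \<rho>
    proof -
      have "(?A (Suc M) *\<^sub>v v) $ \<rho> = 0" unfolding v(3) using that by simp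
      moreover have "(?A (Suc M) *\<^sub>v v) $ \<rho> = (\<Sum>i<Suc M. v $ i * (\<delta> ^^ \<rho>) (u i))"
        using that v(1) by (simp add: scalar_prod_def atLeast0LessThan mult.commute)
      ultimately show ?thesis by simp
    qed
    have vM: "v $ M \<noteq> 0"
    proof
      assume 0: "v $ M = 0"
      have "\<forall>i<M. v $ i = 0" using rel 0 by (intro vanish) simp
      then have "v = 0\<^sub>v (Suc M)" using v(1) 0 by (intro eq_vecI) (auto simp: less_Suc_eq)
      then show False using v(2) by blast
    qed
    define c where "c i = v $ i / v $ M" for i
    have cM: "c M = 1" unfolding c_def using vM by simp
    have crel: "(\<Sum>i<Suc M. c i * (\<delta> ^^ \<rho>) (u i)) = 0" if "\<rho> < Suc M" for \<rho>
    proof -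
      have "(\<Sum>i<Suc M. c i * (\<delta> ^^ \<rho>) (u i)) = (\<Sum>i<Suc M. v $ i * (\<delta> ^^ \<rho>) (u i)) / v $ M"
        unfolding c_def sum_divide_distrib by (intro sum.cong) auto
      then show ?thesis using rel[OF that] by simp
    qed
    have "\<forall>i<M. \<delta> (c i) = 0"
    proof (rule vanish)
      fix \<rho> assume r: "\<rho> < M"
      have "0 = \<delta> (\<Sum>i<Suc M. c i * (\<delta> ^^ \<rho>) (u i))" using r by (subst crel) (simp_all add: deriv_0)
      also have "\<dots> = (\<Sum>i<Suc M. \<delta> (c i) * (\<delta> ^^ \<rho>) (u i)) + (\<Sum>i<Suc M. c i * (\<delta> ^^ Suc \<rho>) (u i))"
        by (simp only: deriv_sum deriv_mult sum.distrib) simp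
      also have "(\<Sum>i<Suc M. c i * (\<delta> ^^ Suc \<rho>) (u i)) = 0" using crel[of "Suc \<rho>"] r by simp
      finally show "(\<Sum>i<M. \<delta> (c i) * (\<delta> ^^ \<rho>) (u i)) = 0" by (simp add: cM deriv_1)
    qed
    moreover have "(\<Sum>i<Suc M. c i * u i) = 0" using crel[of 0] by simp
    ultimately show ?thesis using cM deriv_1 by (intro exI[of _ c]) (auto simp: less_Suc_eq)
  qed
qed

lemma (in derivation) wronskian_unitriangular_change:
  assumes le: "n0 \<le> M"
    and low: "\<And>i. i < n0 \<Longrightarrow> u' i = u i"
    and high: "\<And>i. n0 \<le> i \<Longrightarrow> i < M \<Longrightarrow> u' i = \<epsilon> i * u i + (\<Sum>j<n0. c i j * u j)"
    and sign: "\<And>i. \<epsilon> i = 1 \<or> \<epsilon> i = - 1" and const: "\<And>i j. \<delta> (c i j) = 0"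
  shows "wronskian M u' = wronskian M u \<or> wronskian M u' = - wronskian M u"
proof -
  define P where "P = mat M M (\<lambda>(i, j). if i = j then (if i < n0 then 1 else \<epsilon> i)
      else if n0 \<le> i \<and> j < n0 then c i j else 0)"
  have P: "P \<in> carrier_mat M M" unfolding P_def by simp
  have "\<delta> (\<epsilon> i) = 0" for i using sign[of i] deriv_1 deriv_minus[of 1] by auto
  then have dP: "\<delta> (P $$ (i, j)) = 0" if "i < M" "j < M" for i j
    using that const by (simp add: P_def deriv_0 deriv_1)
  have "u' i = (\<Sum>j<M. P $$ (i, j) * u j)" if i: "i < M" for i
  proof (cases "i < n0")
    case True
    have "(\<Sum>j<M. P $$ (i, j) * u j) = (\<Sum>j<M. if j = i then u i else 0)"
      using i True by (intro sum.cong) (auto simp: P_def)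
    then show ?thesis using i low[OF True] by simp
  next
    case False
    have "(\<Sum>j<M. P $$ (i, j) * u j) = (\<Sum>j<M. (if j = i then \<epsilon> i * u i else 0) + (if j < n0 then c i j * u j else 0))"
      using i False by (intro sum.cong) (auto simp: P_def)
    also have "\<dots> = \<epsilon> i * u i + (\<Sum>j<M. if j < n0 then c i j * u j else 0)"
      using i by (simp add: sum.distrib)
    also have "(\<Sum>j<M. if j < n0 then c i j * u j else 0) = (\<Sum>j<n0. c i j * u j)"
      using le by (intro sum.mono_neutral_cong_right) auto
    finally show ?thesis using high[of i] False i by simp
  qed
  from wronskian_linear_change[OF P dP this] have W: "wronskian M u' = wronskian M u * det P" by simp
  have "det P = prod_list (diag_mat P)"
    by (rule det_lower_triangular[OF _ P]) (auto simp: P_def)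
  also have "\<dots> = (\<Prod>i\<leftarrow>[0..<M]. P $$ (i, i))" using P unfolding diag_mat_def by simp
  finally have det: "det P = (\<Prod>i\<leftarrow>[0..<M]. P $$ (i, i))" .
  have diag: "P $$ (i, i) = 1 \<or> P $$ (i, i) = -1" if "i \<in> set [0..<M]" for i
    using that sign[of i] by (auto simp: P_def)
  then have "(\<Prod>i\<leftarrow>xs. P $$ (i, i)) = 1 \<or> (\<Prod>i\<leftarrow>xs. P $$ (i, i)) = -1" if "set xs \<subseteq> set [0..<M]" for xs
    using that
  proof (induction xs)
    case (Cons i xs)
    have "P $$ (i, i) = 1 \<or> P $$ (i, i) = -1" using diag Cons.prems by simp
    moreover have "(\<Prod>i\<leftarrow>xs. P $$ (i, i)) = 1 \<or> (\<Prod>i\<leftarrow>xs. P $$ (i, i)) = -1" using Cons by simp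
    ultimately show ?case by (elim disjE) simp_all
  qed simp
  then have "det P = 1 \<or> det P = -1" unfolding det by blast
  then show ?thesis using W by auto
qed

section \<open>Polynomials on the branches of a plane curve\<close>

text \<open>
  The value of a polynomial at T, where T = X^(-e) for the variable X of the Laurent series. The
  ramification index e makes room for the series given by Puiseux's theorem.
\<close>
definition at_T :: "nat \<Rightarrow> 'a::field poly \<Rightarrow> 'a fls" where
  "at_T e P = poly (map_poly fls_const P) (fls_X_inv ^ e)"

interpretation fls_const: inj_comm_ring_hom "fls_const :: 'a::comm_ring_1 \<Rightarrow> 'a fls"
  by unfold_locales (auto simp: fls_plus_const fls_const_mult_const)

interpretation at_T: comm_ring_hom "at_T e :: 'a::field poly \<Rightarrow> 'a fls" for e
proof -
  interpret m: map_poly_comm_ring_hom "fls_const :: 'a \<Rightarrow> 'a fls" ..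
  show "comm_ring_hom (at_T e :: 'a poly \<Rightarrow> 'a fls)"
    by unfold_locales (simp_all add: at_T_def m.hom_add m.hom_mult)
qed

lemma at_T_pCons: "at_T e (pCons c P) = fls_const c + fls_X_inv ^ e * at_T e P"
  unfolding at_T_def by (simp add: fls_const.map_poly_pCons_hom)

lemma at_T_const [simp]: "at_T e [:c:] = fls_const c"
  by (simp add: at_T_pCons)

lemma at_T_leading:
  assumes "e > 0"
  shows "ord_ge (at_T e P) (- (int e * int (degree P)))"
    and "fls_nth (at_T e P) (- (int e * int (degree P))) = lead_coeff P"
proof -
  have expand: "at_T e P = (\<Sum>i\<le>degree P. fls_const (coeff P i) * fls_X_inv ^ (e * i))"
    unfolding at_T_def poly_altdef by (simp add: power_mult)
  have nth_term: "fls_nth (fls_const c * fls_X_inv ^ (e * i)) k = (if k = - int (e * i) then c else 0)" for c :: 'a and i k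
    by simp
  have nth_sum: "fls_nth (sum f A) k = (\<Sum>i\<in>A. fls_nth (f i) k)" for f :: "nat \<Rightarrow> 'a fls" and A k
    by (induction A rule: infinite_finite_induct) simp_all
  show "ord_ge (at_T e P) (- (int e * int (degree P)))"
    unfolding expand
  proof (rule ord_ge_sum)
    fix i assume "i \<in> {..degree P}"
    then have "int e * int i \<le> int e * int (degree P)" by (simp add: mult_left_mono)
    then show "ord_ge (fls_const (coeff P i) * fls_X_inv ^ (e * i)) (- (int e * int (degree P)))"
      unfolding ord_ge_def nth_term by auto
  qed
  have "fls_nth (at_T e P) (- (int e * int (degree P))) = (\<Sum>i\<le>degree P. if i = degree P then coeff P i else 0)"
    unfolding expand nth_sum nth_term using assms by (intro sum.cong) auto
  then show "fls_nth (at_T e P) (- (int e * int (degree P))) = lead_coeff P" by simp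
qed

lemma at_T_eq_0_iff: "e > 0 \<Longrightarrow> at_T e P = 0 \<longleftrightarrow> P = 0"
  using at_T_leading(2)[of e P] by (auto simp: leading_coeff_0_iff)

lemma fls_deriv_at_T: "fls_deriv (at_T e P) = at_T e (pderiv P) * fls_deriv (fls_X_inv ^ e)"
  by (induction P) (simp_all add: at_T_pCons pderiv_pCons at_T.hom_add algebra_simps)

lemma fls_deriv_X_inv_power_nonzero:
  assumes "e > 0" shows "fls_deriv (fls_X_inv ^ e :: 'a::field_char_0 fls) \<noteq> 0"
proof
  assume 0: "fls_deriv (fls_X_inv ^ e :: 'a fls) = 0"
  have "fls_nth (fls_deriv (fls_X_inv ^ e :: 'a fls)) (- int e - 1) = - of_nat e"
    by (simp add: fls_X_inv_power_conv_shift_1)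
  then show False using 0 assms by simp
qed

text \<open>The value at t = T and y = \<theta> of a polynomial in two variables t and y, whose outer variable is y.\<close>
definition ev :: "nat \<Rightarrow> 'a::field fls \<Rightarrow> 'a poly poly \<Rightarrow> 'a fls" where
  "ev e \<theta> P = poly (map_poly (at_T e) P) \<theta>"

interpretation ev: comm_ring_hom "ev e \<theta> :: 'a::field poly poly \<Rightarrow> 'a fls" for e \<theta>
proof -
  interpret m: map_poly_comm_ring_hom "at_T e :: 'a poly \<Rightarrow> 'a fls" ..
  show "comm_ring_hom (ev e \<theta> :: 'a poly poly \<Rightarrow> 'a fls)"
    by unfold_locales (simp_all add: ev_def m.hom_add m.hom_mult)
qed

lemma ev_pCons: "ev e \<theta> (pCons a P) = at_T e a + \<theta> * ev e \<theta> P"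
  unfolding ev_def by (simp add: at_T.map_poly_pCons_hom)

lemma ev_const [simp]: "ev e \<theta> [:a:] = at_T e a"
  by (simp add: ev_pCons)

lemma ev_monom: "ev e \<theta> (monom a k) = at_T e a * \<theta> ^ k"
  unfolding ev_def by (simp add: at_T.map_poly_hom_monom poly_monom)

lemma fls_deriv_ev:
  "fls_deriv (ev e \<theta> P) = ev e \<theta> (map_poly pderiv P) * fls_deriv (fls_X_inv ^ e) + ev e \<theta> (pderiv P) * fls_deriv \<theta>"
proof (induction P)
  case (pCons a P)
  then show ?case
    by (simp add: ev_pCons map_poly_pCons pderiv_pCons ev.hom_add fls_deriv_at_T algebra_simps)
qed simp

text \<open>
  The vector field g_y d/dt - g_t d/dy. It is tangent to the curve g = 0, and it has polynomial
  coefficients: no denominators appear when Wronskians are formed with it.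
\<close>
definition tangent_deriv :: "'a::field poly poly \<Rightarrow> 'a poly poly \<Rightarrow> 'a poly poly" where
  "tangent_deriv g P = pderiv g * map_poly pderiv P - map_poly pderiv g * pderiv P"

lemma map_poly_pderiv_add: "map_poly pderiv (P + Q) = map_poly pderiv P + map_poly pderiv (Q :: 'a::field poly poly)"
  by (intro poly_eqI) (simp add: coeff_map_poly pderiv_add)

lemma map_poly_pderiv_mult:
  "map_poly pderiv (P * Q) = map_poly pderiv P * Q + P * map_poly pderiv (Q :: 'a::field poly poly)"
proof (rule poly_eqI)
  fix n
  have ps: "pderiv (sum f A) = (\<Sum>i\<in>A. pderiv (f i))" for f :: "nat \<Rightarrow> 'a poly" and A
    by (induction A rule: infinite_finite_induct) (simp_all add: pderiv_add)
  show "coeff (map_poly pderiv (P * Q)) n = coeff (map_poly pderiv P * Q + P * map_poly pderiv Q) n"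
    unfolding coeff_add coeff_mult by (simp add: coeff_map_poly coeff_mult ps pderiv_mult sum.distrib mult.commute)
qed

lemma derivation_tangent_deriv: "derivation (tangent_deriv g)"
  by unfold_locales (simp_all add: tangent_deriv_def map_poly_pderiv_add map_poly_pderiv_mult
      pderiv_add pderiv_mult algebra_simps)

text \<open>The restriction of \<open>tangent_deriv g\<close> to the branch y = \<theta> of the curve is g_y(T, \<theta>) d/dT.\<close>
definition branch_deriv :: "nat \<Rightarrow> 'a::field poly poly \<Rightarrow> 'a fls \<Rightarrow> 'a fls \<Rightarrow> 'a fls" where
  "branch_deriv e g \<theta> u = ev e \<theta> (pderiv g) / fls_deriv (fls_X_inv ^ e) * fls_deriv u"

lemma derivation_branch_deriv: "derivation (branch_deriv e g \<theta>)"
  by unfold_locales (simp_all add: branch_deriv_def algebra_simps add_divide_distrib)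

lemma ev_tangent_deriv:
  fixes g :: "'a::field_char_0 poly poly"
  assumes "e > 0" "ev e \<theta> g = 0"
  shows "ev e \<theta> (tangent_deriv g P) = branch_deriv e g \<theta> (ev e \<theta> P)"
proof -
  define t where "t = fls_deriv (fls_X_inv ^ e :: 'a fls)"
  have t0: "t \<noteq> 0" unfolding t_def by (rule fls_deriv_X_inv_power_nonzero[OF assms(1)])
  have "ev e \<theta> (map_poly pderiv g) * t + ev e \<theta> (pderiv g) * fls_deriv \<theta> = 0"
    using fls_deriv_ev[of e \<theta> g] assms(2) unfolding t_def by simp
  then have "ev e \<theta> (pderiv g) * fls_deriv \<theta> = - (ev e \<theta> (map_poly pderiv g) * t)"
    by (simp add: eq_neg_iff_add_eq_0 add.commute)
  then have key: "ev e \<theta> (pderiv g) * (fls_deriv \<theta> * z) = - (ev e \<theta> (map_poly pderiv g) * z * t)" for z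
    by (subst mult.assoc[symmetric]) (simp only: minus_mult_left mult.assoc mult.commute[of t z])
  have "branch_deriv e g \<theta> (ev e \<theta> P) * t = ev e \<theta> (pderiv g) * fls_deriv (ev e \<theta> P)"
    unfolding branch_deriv_def t_def[symmetric] using t0 by simp
  also have "\<dots> = ev e \<theta> (pderiv g) * ev e \<theta> (map_poly pderiv P) * t
      + ev e \<theta> (pderiv g) * (fls_deriv \<theta> * ev e \<theta> (pderiv P))"
    unfolding fls_deriv_ev t_def[symmetric] by (simp add: algebra_simps)
  also have "\<dots> = ev e \<theta> (tangent_deriv g P) * t"
    unfolding key tangent_deriv_def by (simp add: ev.hom_minus ev.hom_mult algebra_simps)
  finally have "branch_deriv e g \<theta> (ev e \<theta> P) * t = ev e \<theta> (tangent_deriv g P) * t" .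
  then show ?thesis using t0 by simp
qed

lemma branch_deriv_eq_0_imp_const:
  fixes u :: "'a::field_char_0 fls"
  assumes "e > 0" "ev e \<theta> (pderiv g) \<noteq> 0" "branch_deriv e g \<theta> u = 0"
  shows "u = fls_const (fls_nth u 0)"
proof -
  have d: "fls_deriv u = 0"
    using assms fls_deriv_X_inv_power_nonzero[OF assms(1), where 'a = 'a] unfolding branch_deriv_def by simp
  show ?thesis
  proof (rule fls_eqI)
    fix n
    have "fls_nth (fls_deriv u) (n - 1) = 0" using d by simp
    then show "fls_nth u n = fls_nth (fls_const (fls_nth u 0)) n" by (cases "n = 0") auto
  qed
qed

lemma ord_ge_branch_deriv:
  obtains K where "K \<ge> 0" "\<And>u n \<rho>. ord_ge u n \<Longrightarrow> ord_ge ((branch_deriv e g \<theta> ^^ \<rho>) u) (n - int \<rho> * K)"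
proof -
  obtain k where k: "ord_ge (ev e \<theta> (pderiv g) / fls_deriv (fls_X_inv ^ e)) k"
    using ord_ge_exists by blast
  define K where "K = max 0 (1 - k)"
  have step: "ord_ge (branch_deriv e g \<theta> u) (n - K)" if "ord_ge u n" for u n
    using ord_ge_mult[OF k ord_ge_deriv[OF that]] unfolding branch_deriv_def K_def
    by (rule ord_ge_mono) simp
  have "ord_ge ((branch_deriv e g \<theta> ^^ \<rho>) u) (n - int \<rho> * K)" if "ord_ge u n" for u n \<rho>
    using that
  proof (induction \<rho>)
    case (Suc \<rho>)
    from step[OF Suc.IH[OF Suc.prems]] show ?case by (simp add: algebra_simps)
  qed simp
  then show ?thesis using that[of K] unfolding K_def by simp
qed

lemma monic_division:
  fixes g P :: "'a::idom poly"
  assumes "lead_coeff g = 1" "degree g > 0"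
  shows "\<exists>R. degree R < degree g \<and> g dvd P - R"
proof -
  obtain q r where qr: "pseudo_divmod P g = (q, r)" by force
  have g0: "g \<noteq> 0" using assms by auto
  have "P = g * q + r" "r = 0 \<or> degree r < degree g"
    using pseudo_divmod[OF g0 qr] assms by auto
  then show ?thesis using assms(2) by (intro exI[of _ r]) auto
qed

lemma ev_eq_if_dvd_diff:
  assumes "g dvd P - R" "ev e \<theta> g = 0" shows "ev e \<theta> P = ev e \<theta> R"
proof -
  from assms(1) obtain k where "P - R = g * k" by (rule dvdE)
  then have "ev e \<theta> P - ev e \<theta> R = ev e \<theta> g * ev e \<theta> k" by (metis ev.hom_minus ev.hom_mult)
  then show ?thesis using assms(2) by simp
qed

lemma ev_altdef:
  assumes "degree R < m" shows "ev e \<theta> R = (\<Sum>l<m. at_T e (coeff R l) * \<theta> ^ l)"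
proof -
  have "ev e \<theta> R = (\<Sum>l\<le>degree R. at_T e (coeff R l) * \<theta> ^ l)"
  proof -
    have "R = (\<Sum>l\<le>degree R. monom (coeff R l) l)" by (simp add: poly_as_sum_of_monoms)
    then have "ev e \<theta> R = ev e \<theta> (\<Sum>l\<le>degree R. monom (coeff R l) l)" by simp
    then show ?thesis by (simp add: ev.hom_sum ev_monom)
  qed
  also have "\<dots> = (\<Sum>l<m. at_T e (coeff R l) * \<theta> ^ l)"
    using assms by (intro sum.mono_neutral_left) (auto simp: coeff_eq_0)
  finally show ?thesis .
qed

text \<open>
  The determinant of multiplication by w on C[t][y] / (g), computed in the basis of powers of y. The
  Vandermonde matrix of the roots conjugates this multiplication to a diagonal matrix.
\<close>
lemma norm_is_polynomial:
  fixes g w :: "'a::field poly poly"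
  assumes "lead_coeff g = 1" "degree g = m" "m > 0"
    and \<Theta>: "finite \<Theta>" "card \<Theta> = m" "\<And>\<theta>. \<theta> \<in> \<Theta> \<Longrightarrow> ev e \<theta> g = 0"
  shows "\<exists>n. (\<Prod>\<theta>\<in>\<Theta>. ev e \<theta> w) = at_T e n"
proof -
  obtain ts where ts: "set ts = \<Theta>" "distinct ts" using finite_distinct_list[OF \<Theta>(1)] by blast
  then have len: "length ts = m" using \<Theta>(2) distinct_card by metis
  have "\<forall>k. \<exists>R. degree R < m \<and> g dvd monom 1 k * w - R" using monic_division[of g] assms by metis
  then obtain R where R: "\<And>k. degree (R k) < m" "\<And>k. g dvd monom 1 k * w - R k" by metis
  define B where "B = mat m m (\<lambda>(k, l). coeff (R k) l)"
  define V where "V = mat m m (\<lambda>(l, j). (ts ! j) ^ l)"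
  define Dg where "Dg = mat m m (\<lambda>(i, j). if i = j then ev e (ts ! i) w else 0)"
  have carr: "map_mat (at_T e) B \<in> carrier_mat m m" "V \<in> carrier_mat m m" "Dg \<in> carrier_mat m m"
    unfolding B_def V_def Dg_def by auto
  have "map_mat (at_T e) B * V = V * Dg"
  proof (rule eq_matI)
    fix k j assume "k < dim_row (V * Dg)" "j < dim_col (V * Dg)"
    then have kj: "k < m" "j < m" using carr by auto
    have root: "ev e (ts ! j) g = 0" using \<Theta>(3) ts(1) len kj(2) nth_mem by metis
    have "(map_mat (at_T e) B * V) $$ (k, j) = (\<Sum>l<m. at_T e (coeff (R k) l) * (ts ! j) ^ l)"
      using kj unfolding B_def V_def by (simp add: scalar_prod_def atLeast0LessThan)
    also have "\<dots> = ev e (ts ! j) (R k)" by (rule ev_altdef[OF R(1), symmetric])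
    also have "\<dots> = ev e (ts ! j) (monom 1 k * w)" by (rule ev_eq_if_dvd_diff[OF R(2) root, symmetric])
    also have "\<dots> = (ts ! j) ^ k * ev e (ts ! j) w" by (simp add: ev.hom_mult ev_monom)
    also have "\<dots> = (\<Sum>i<m. (ts ! i) ^ k * (if i = j then ev e (ts ! i) w else 0))"
      using kj by (simp add: if_distrib cong: if_cong)
    also have "\<dots> = (V * Dg) $$ (k, j)"
      using kj unfolding V_def Dg_def by (simp add: scalar_prod_def atLeast0LessThan)
    finally show "(map_mat (at_T e) B * V) $$ (k, j) = (V * Dg) $$ (k, j)" .
  qed (use carr in auto)
  then have "det (map_mat (at_T e) B) * det V = det V * det Dg"
    by (metis det_mult[OF carr(1,2)] det_mult[OF carr(2,3)])
  moreover have "det V \<noteq> 0"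
  proof
    assume "det V = 0"
    then have "det (transpose_mat V) = 0" using det_transpose[OF carr(2)] by simp
    then obtain v where v: "v \<in> carrier_vec m" "v \<noteq> 0\<^sub>v m" "transpose_mat V *\<^sub>v v = 0\<^sub>v m"
      using det_0_iff_vec_prod_zero_field[of "transpose_mat V" m] carr(2) by auto
    define p where "p = (\<Sum>l<m. monom (v $ l) l)"
    have cp: "coeff p l = (if l < m then v $ l else 0)" for l
      unfolding p_def by (simp add: coeff_sum if_distrib cong: if_cong)
    have "p \<noteq> 0"
    proof
      assume "p = 0"
      then have "v $ l = 0" if "l < m" for l using cp[of l] that by simp
      then have "v = 0\<^sub>v m" using v(1) by (intro eq_vecI) auto
      then show False using v(2) by blast
    qed
    have "poly p (ts ! j) = 0" if "j < m" for j
    proof -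
      have "(transpose_mat V *\<^sub>v v) $ j = (\<Sum>l<m. (ts ! j) ^ l * v $ l)"
        using that v(1) unfolding V_def by (simp add: scalar_prod_def atLeast0LessThan)
      then show ?thesis unfolding v(3) p_def using that by (simp add: poly_sum poly_monom mult.commute)
    qed
    then have "\<Theta> \<subseteq> {x. poly p x = 0}" using ts(1) len by (metis (mono_tags, lifting) in_set_conv_nth mem_Collect_eq subsetI)
    then have "m \<le> card {x. poly p x = 0}" using \<Theta>(2) poly_roots_finite[OF \<open>p \<noteq> 0\<close>] card_mono by metis
    moreover have "card {x. poly p x = 0} \<le> degree p" using \<open>p \<noteq> 0\<close> by (rule card_poly_roots_bound)
    moreover have "degree p < m" using cp assms(3) \<open>p \<noteq> 0\<close> by (metis leading_coeff_0_iff)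
    ultimately show False by simp
  qed
  ultimately have "det (map_mat (at_T e) B) = det Dg"
    by (metis mult.commute mult_right_cancel)
  moreover have "det Dg = (\<Prod>\<theta>\<in>\<Theta>. ev e \<theta> w)"
  proof -
    have "det Dg = prod_list (diag_mat Dg)" by (rule det_lower_triangular[OF _ carr(3)]) (auto simp: Dg_def)
    also have "diag_mat Dg = map (\<lambda>\<theta>. ev e \<theta> w) ts" unfolding diag_mat_def Dg_def using len
      by (intro nth_equalityI) auto
    finally show ?thesis using prod.distinct_set_conv_list[OF ts(2), of "\<lambda>\<theta>. ev e \<theta> w"] ts(1) by simp
  qed
  ultimately have "(\<Prod>\<theta>\<in>\<Theta>. ev e \<theta> w) = at_T e (det B)" by (simp add: at_T.hom_det)
  then show ?thesis by blast
qed

section \<open>The Wronskian of an approximation\<close>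

lemma sum_div_mod:
  "(\<Sum>i<a * b. f (i div b) (i mod b)) = (\<Sum>l<a. \<Sum>j<b. f l j)" for f :: "nat \<Rightarrow> nat \<Rightarrow> 'c::comm_monoid_add"
proof (induction a)
  case (Suc a)
  have "{..<Suc a * b} = {..<a * b} \<union> {a * b..<a * b + b}" by auto
  then have "(\<Sum>i<Suc a * b. f (i div b) (i mod b)) =
      (\<Sum>i<a * b. f (i div b) (i mod b)) + (\<Sum>i\<in>{a * b..<a * b + b}. f (i div b) (i mod b))"
    by (simp add: sum.union_disjoint[symmetric] ivl_disj_int)
  also have "(\<Sum>i\<in>{a * b..<a * b + b}. f (i div b) (i mod b)) = (\<Sum>j<b. f a j)"
  proof (rule sum.reindex_bij_witness[of _ "\<lambda>j. a * b + j" "\<lambda>i. i - a * b"])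
    fix i assume i: "i \<in> {a * b..<a * b + b}"
    then have "i div b = a" by (intro div_nat_eqI) (auto simp: algebra_simps)
    then show "f a (i - a * b) = f (i div b) (i mod b)" by (simp add: modulo_nat_def)
  qed auto
  finally show ?case using Suc.IH by simp
qed simp

text \<open>The monomial t^j y^k with i = k L + j: for i < m L these are the monomials with j < L and k < m.\<close>
definition basis_poly :: "nat \<Rightarrow> nat \<Rightarrow> 'a::field poly poly" where
  "basis_poly L i = monom (monom 1 (i mod L)) (i div L)"

lemma basis_expansion:
  fixes R :: "'a::field poly poly"
  assumes "degree R < m" and "\<And>k. degree (coeff R k) < L"
  shows "R = (\<Sum>i<m * L. [:[:coeff (coeff R (i div L)) (i mod L):]:] * basis_poly L i)"
proof -
  have "(\<Sum>i<m * L. [:[:coeff (coeff R (i div L)) (i mod L):]:] * basis_poly L i)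
      = (\<Sum>k<m. \<Sum>j<L. monom (monom (coeff (coeff R k) j) j) k)"
    unfolding basis_poly_def
    by (subst sum_div_mod[where f = "\<lambda>k j. [:[:coeff (coeff R k) j:]:] * monom (monom 1 j) k"])
       (simp add: smult_monom)
  also have "\<dots> = (\<Sum>k<m. monom (coeff R k) k)"
  proof (intro sum.cong refl)
    fix k
    have "(\<Sum>j<L. monom (monom (coeff (coeff R k) j) j) k) = monom (\<Sum>j<L. monom (coeff (coeff R k) j) j) k"
      by (intro poly_eqI) (simp add: coeff_sum)
    also have "(\<Sum>j<L. monom (coeff (coeff R k) j) j) = coeff R k"
      using assms(2)[of k] by (intro poly_eqI) (auto simp: coeff_sum if_distrib coeff_eq_0 cong: if_cong)
    finally show "(\<Sum>j<L. monom (monom (coeff (coeff R k) j) j) k) = monom (coeff R k) k" .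
  qed
  also have "\<dots> = R"
    using assms(1) by (intro poly_eqI) (auto simp: coeff_sum if_distrib coeff_eq_0 cong: if_cong)
  finally show ?thesis by simp
qed

lemma coeff_basis_combination:
  assumes "k < m" "j < L"
  shows "coeff (coeff (\<Sum>i<m * L. [:[:c i:]:] * basis_poly L i) k) j = (c (k * L + j) :: 'a::field)"
proof -
  have L: "L > 0" using assms by simp
  have "coeff (coeff (\<Sum>i<m * L. [:[:c i:]:] * basis_poly L i) k) j
      = (\<Sum>i<m * L. if i = k * L + j then c i else 0)"
    unfolding basis_poly_def coeff_sum
  proof (intro sum.cong refl)
    fix i
    have "(i div L = k \<and> i mod L = j) \<longleftrightarrow> i = k * L + j" using assms by (metis L add.commute div_mult_mod_eq div_mult_self3 div_less add_0 mod_less mod_mult_self3 not_less0 neq0_conv add.right_neutral)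
    then show "coeff (coeff ([:[:c i:]:] * monom (monom 1 (i mod L)) (i div L)) k) j = (if i = k * L + j then c i else 0)"
      by (auto simp: smult_monom)
  qed
  also have "k * L + j < m * L"
  proof -
    have "k * L + j < Suc k * L" using assms by simp
    also have "\<dots> \<le> m * L" using assms by (intro mult_right_mono) auto
    finally show ?thesis .
  qed
  then have "(\<Sum>i<m * L. if i = k * L + j then c i else 0) = c (k * L + j)" by simp
  finally show ?thesis .
qed

text \<open>
  Multiplication by A on C[t][y] / (g) raises the degree in t by at most D. It suffices to look at the
  powers of y, because powers of t commute with reduction modulo g.
\<close>
definition raises_degree_by :: "'a::field poly poly \<Rightarrow> nat \<Rightarrow> 'a poly poly \<Rightarrow> bool" where
  "raises_degree_by g D A \<longleftrightarrow> (\<forall>k<degree g.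
     \<exists>R. degree R < degree g \<and> (\<forall>i. degree (coeff R i) \<le> D) \<and> g dvd A * monom 1 k - R)"

lemma raises_degree_by_mono: "raises_degree_by g D A \<Longrightarrow> D \<le> D' \<Longrightarrow> raises_degree_by g D' A"
  unfolding raises_degree_by_def by (meson order_trans)

lemma raises_degree_by_exists:
  fixes g A :: "'a::field poly poly"
  assumes "lead_coeff g = 1" "degree g > 0"
  shows "\<exists>D. raises_degree_by g D A"
proof -
  define m where "m = degree g"
  have "\<forall>k. \<exists>R. degree R < m \<and> g dvd A * monom 1 k - R"
    unfolding m_def using monic_division[OF assms] by blast
  then obtain R where R: "\<And>k. degree (R k) < m" "\<And>k. g dvd A * monom 1 k - R k" by metis
  define D where "D = Max ((\<lambda>(k, i). degree (coeff (R k) i)) ` ({..<m} \<times> {..m}))"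
  have "degree (coeff (R k) i) \<le> D" if "k < m" for k i
  proof (cases "i \<le> m")
    case True
    then show ?thesis unfolding D_def using that by (intro Max_ge) auto
  next
    case False
    then have "coeff (R k) i = 0" using R(1)[of k] by (intro coeff_eq_0) simp
    then show ?thesis by simp
  qed
  then show ?thesis using R unfolding raises_degree_by_def m_def by blast
qed

text \<open>
  The family whose Wronskian is studied. The block of products with x 0 comes first: this makes the
  change of family in \<open>approx_wronskian_small\<close> triangular.
\<close>
definition approx_system :: "nat \<Rightarrow> nat \<Rightarrow> (nat \<Rightarrow> 'a poly) \<Rightarrow> nat \<Rightarrow> 'a::field poly poly" where
  "approx_system m L x i = [:x (i div (m * L)):] * basis_poly L (i mod (m * L))"

definition approx_wronskian :: "'a::field poly poly \<Rightarrow> nat \<Rightarrow> (nat \<Rightarrow> 'a poly) \<Rightarrow> 'a poly poly" where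
  "approx_wronskian g L x =
     derivation.wronskian (tangent_deriv g) (3 * (degree g * L)) (approx_system (degree g) L x)"

lemma ev_approx_wronskian:
  fixes g :: "'a::field_char_0 poly poly"
  assumes "e > 0" "ev e \<theta> g = 0"
  shows "ev e \<theta> (approx_wronskian g L x) =
    derivation.wronskian (branch_deriv e g \<theta>) (3 * (degree g * L)) (\<lambda>i. ev e \<theta> (approx_system (degree g) L x i))"
  unfolding approx_wronskian_def
  by (rule wronskian_hom[OF derivation_tangent_deriv derivation_branch_deriv ev.comm_ring_hom_axioms])
     (rule ev_tangent_deriv[OF assms])

text \<open>
  A relation with constant coefficients is a polynomial relation of degree less than m in \<theta>. By the
  independence of the powers of \<theta> it splits into relations between x 0, x 1, x 2 with polynomial
  coefficients of degree less than L.
\<close>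
lemma approx_wronskian_nonzero:
  fixes g :: "'a::field_char_0 poly poly"
  assumes e: "e > 0" and root: "ev e \<theta> g = 0" and deg: "degree g > 0"
    and indep: "\<And>P. degree P < degree g \<Longrightarrow> ev e \<theta> P = 0 \<Longrightarrow> P = 0"
    and no_rel: "\<And>B. (\<And>l. l < 3 \<Longrightarrow> degree (B l) < L) \<Longrightarrow> (\<Sum>l<3. B l * x l) = 0 \<Longrightarrow> \<forall>l<3. B l = 0"
    and L: "L > 0"
  shows "ev e \<theta> (approx_wronskian g L x) \<noteq> 0"
proof
  define m where "m = degree g"
  define M where "M = 3 * (m * L)"
  define u where "u i = ev e \<theta> (approx_system m L x i)" for i
  assume "ev e \<theta> (approx_wronskian g L x) = 0"
  then have "derivation.wronskian (branch_deriv e g \<theta>) M u = 0"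
    unfolding ev_approx_wronskian[OF e root] u_def M_def m_def .
  then obtain c where c: "\<forall>i<M. branch_deriv e g \<theta> (c i) = 0" "\<exists>i<M. c i \<noteq> 0" "(\<Sum>i<M. c i * u i) = 0"
    using wronskian_eq_0_imp_dependent[OF derivation_branch_deriv] by blast
  have "ev e \<theta> (pderiv g) \<noteq> 0"
  proof
    assume "ev e \<theta> (pderiv g) = 0"
    moreover have "degree (pderiv g) < degree g" using deg by (simp add: degree_pderiv)
    ultimately have "pderiv g = 0" using indep by blast
    then show False using deg by (simp add: pderiv_eq_0_iff)
  qed
  then have cc: "c i = fls_const (fls_nth (c i) 0)" if "i < M" for i
    using branch_deriv_eq_0_imp_const[OF e] c(1) that by blast
  define d where "d i = fls_nth (c i) 0" for i
  define B where "B l = (\<Sum>i<m * L. [:[:d (l * (m * L) + i):]:] * basis_poly L i)" for l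
  have "(\<Sum>i<M. c i * u i) = ev e \<theta> (\<Sum>i<M. [:[:d i:]:] * approx_system m L x i)"
    unfolding ev.hom_sum
  proof (intro sum.cong refl)
    fix i assume "i \<in> {..<M}"
    then have "c i = fls_const (d i)" using cc unfolding d_def by simp
    then show "c i * u i = ev e \<theta> ([:[:d i:]:] * approx_system m L x i)"
      by (simp only: u_def ev.hom_mult ev_const at_T_const)
  qed
  also have "(\<Sum>i<M. [:[:d i:]:] * approx_system m L x i)
     = (\<Sum>i<3 * (m * L). [:[:d ((i div (m * L)) * (m * L) + i mod (m * L)):]:] * ([:x (i div (m * L)):] * basis_poly L (i mod (m * L))))"
    unfolding M_def approx_system_def by (simp add: div_mult_mod_eq)
  also have "\<dots> = (\<Sum>l<3. \<Sum>i<m * L. [:[:d (l * (m * L) + i):]:] * ([:x l:] * basis_poly L i))"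
    by (rule sum_div_mod)
  also have "\<dots> = (\<Sum>l<3. [:x l:] * B l)"
    unfolding B_def sum_distrib_left by (simp add: mult.commute mult.left_commute)
  finally have 0: "ev e \<theta> (\<Sum>l<3. [:x l:] * B l) = 0" using c(3) by simp
  have dB: "degree (B l) < m" "degree (coeff (B l) k) < L" for l k
  proof -
    have "degree (B l) \<le> m - 1" unfolding B_def
    proof (rule degree_sum_le)
      fix i assume "i \<in> {..<m * L}"
      then have "i div L < m" by (simp add: less_mult_imp_div_less)
      then have "i div L \<le> m - 1" by simp
      moreover have "degree ([:[:d (l * (m * L) + i):]:] * basis_poly L i) \<le> i div L"
        unfolding basis_poly_def by (simp add: smult_monom degree_monom_le)
      ultimately show "degree ([:[:d (l * (m * L) + i):]:] * basis_poly L i) \<le> m - 1" by simp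
    qed simp
    then show "degree (B l) < m" using deg unfolding m_def by simp
    have "degree (coeff (B l) k) \<le> L - 1" unfolding B_def coeff_sum
    proof (rule degree_sum_le)
      fix i assume "i \<in> {..<m * L}"
      have "i mod L \<le> L - 1" using L by (simp add: Suc_leI le_diff_conv2 flip: less_Suc_eq_le)
      then show "degree (coeff ([:[:d (l * (m * L) + i):]:] * basis_poly L i) k) \<le> L - 1"
        unfolding basis_poly_def by (auto simp: smult_monom intro: order_trans[OF degree_monom_le])
    qed simp
    then show "degree (coeff (B l) k) < L" using L by simp
  qed
  have "degree (\<Sum>l<3. [:x l:] * B l) < m"
    using dB(1) deg unfolding m_def by (intro degree_sum_less) (auto intro: le_less_trans[OF degree_smult_le])
  then have "(\<Sum>l<3. [:x l:] * B l) = 0" using indep 0 unfolding m_def by blast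
  then have "coeff (\<Sum>l<3. [:x l:] * B l) k = 0" for k by simp
  then have "(\<Sum>l<3. coeff (B l) k * x l) = 0" for k by (simp add: coeff_sum mult.commute)
  then have Bk: "\<forall>l<3. coeff (B l) k = 0" for k using no_rel[of "\<lambda>l. coeff (B l) k"] dB(2) by blast
  have "d i = 0" if "i < M" for i
  proof -
    define l where "l = i div (m * L)"
    define r where "r = i mod (m * L)"
    have mL: "m * L > 0" using L deg unfolding m_def by simp
    have r: "r < m * L" unfolding r_def using mL by simp
    have l: "l < 3" unfolding l_def using that mL unfolding M_def by (simp add: less_mult_imp_div_less)
    have "r div L < m" "r mod L < L" using r L by (auto simp: less_mult_imp_div_less)
    then have "coeff (coeff (B l) (r div L)) (r mod L) = d (l * (m * L) + (r div L * L + r mod L))"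
      unfolding B_def by (rule coeff_basis_combination)
    also have "l * (m * L) + (r div L * L + r mod L) = i" unfolding l_def r_def by (simp only: div_mult_mod_eq)
    finally show ?thesis using Bk l by simp
  qed
  then show False using c(2) cc unfolding d_def by (metis fls_const_0)
qed

text \<open>
  The parameter Q stands for the order of 1 / q, and A l is meant to represent the
  l-th power of a series \<alpha>, so that A l x 0 - x l is small. The constant K may depend on everything
  except Q and x, whereas C leaves a margin in the hypotheses.
\<close>
lemma approx_wronskian_small:
  fixes g :: "'a::field_char_0 poly poly"
  assumes e: "e > 0" and root: "ev e \<theta> g = 0" and deg: "degree g > 0"
    and red: "\<And>l. l < 3 \<Longrightarrow> raises_degree_by g D (A l)"
    and L: "L = N + D + 1"
  shows "\<exists>K. \<forall>Q x. (\<forall>l<3. ord_ge (at_T e (x l)) (- Q - C)) \<and>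
       (\<forall>l\<in>{1, 2}. ord_ge (ev e \<theta> (A l) * at_T e (x 0) - at_T e (x l)) (Q - C)) \<longrightarrow>
       ord_ge (ev e \<theta> (approx_wronskian g L x)) (Q * (int (degree g) * (int N + 1 - 3 * int D)) - K)"
proof -
  let ?v = "ev e \<theta>" and ?d = "branch_deriv e g \<theta>"
  define m where "m = degree g"
  define s where "s = m * L"
  define M where "M = 3 * s"
  define b where "b i = (basis_poly L i :: 'a poly poly)" for i
  interpret derivation "?d" by (rule derivation_branch_deriv)
  have s0: "s > 0" unfolding s_def m_def using deg L by simp
  obtain K1 where K1: "K1 \<ge> 0" "\<And>u n \<rho>. ord_ge u n \<Longrightarrow> ord_ge ((?d ^^ \<rho>) u) (n - int \<rho> * K1)"
    using ord_ge_branch_deriv by blast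
  have "\<forall>i. \<exists>n. ord_ge (?v (b i)) n" using ord_ge_exists by blast
  then obtain n where n: "\<And>i. ord_ge (?v (b i)) (n i)" by metis
  define K2 where "K2 = Max ((\<lambda>i. - n i) ` {..<s})"
  have K2: "ord_ge (?v (b i)) (- K2)" if "i < s" for i
  proof (rule ord_ge_mono[OF n])
    have "- n i \<le> K2" unfolding K2_def using that by (intro Max_ge) auto
    then show "- K2 \<le> n i" by simp
  qed
  define K where "K = int M * (K2 + C + int M * K1)"
  have expand: "\<exists>c. ?v (A l) * ?v (b i) = (\<Sum>j<s. fls_const (c j) * ?v (b j))"
    if l: "l < 3" and i: "i < s" "i mod L \<le> N" for l i
  proof -
    have "i div L < m" using i unfolding s_def by (simp add: less_mult_imp_div_less)
    then obtain R where R: "degree R < m" "\<And>i. degree (coeff R i) \<le> D" "g dvd A l * monom 1 (i div L) - R"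
      using red[OF l] unfolding m_def raises_degree_by_def by blast
    define R' where "R' = [:monom 1 (i mod L):] * R"
    have cR': "coeff R' k = monom 1 (i mod L) * coeff R k" for k unfolding R'_def by simp
    have "degree R' < m" unfolding R'_def using R(1) by (auto intro: le_less_trans[OF degree_smult_le])
    moreover have "degree (coeff R' k) < L" for k
    proof -
      have "degree (coeff R' k) \<le> i mod L + degree (coeff R k)"
        unfolding cR' by (rule order_trans[OF degree_mult_le]) (simp add: degree_monom_eq)
      then show ?thesis using R(2)[of k] i(2) L by simp
    qed
    ultimately have R'exp: "R' = (\<Sum>j<s. [:[:coeff (coeff R' (j div L)) (j mod L):]:] * b j)"
      unfolding s_def b_def by (rule basis_expansion)
    have bi: "b i = [:monom 1 (i mod L):] * monom 1 (i div L)"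
      unfolding b_def basis_poly_def by (simp add: smult_monom)
    have "?v (A l) * ?v (b i) = ?v [:monom 1 (i mod L):] * ?v (A l * monom 1 (i div L))"
      unfolding bi by (simp only: ev.hom_mult mult_ac)
    also have "\<dots> = ?v R'" unfolding ev_eq_if_dvd_diff[OF R(3) root] R'_def by (simp only: ev.hom_mult)
    also have "\<dots> = (\<Sum>j<s. fls_const (coeff (coeff R' (j div L)) (j mod L)) * ?v (b j))"
      by (subst R'exp) (simp only: ev.hom_sum ev.hom_mult ev_const at_T_const)
    finally show ?thesis by (rule exI[of _ "\<lambda>j. coeff (coeff R' (j div L)) (j mod L)"])
  qed
  show ?thesis
  proof (intro exI[of _ K] allI impI)
    fix Q :: int and x :: "nat \<Rightarrow> 'a poly"
    assume "(\<forall>l<3. ord_ge (at_T e (x l)) (- Q - C)) \<and>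
       (\<forall>l\<in>{1, 2}. ord_ge (?v (A l) * at_T e (x 0) - at_T e (x l)) (Q - C))"
    then have x: "\<And>l. l < 3 \<Longrightarrow> ord_ge (at_T e (x l)) (- Q - C)"
      and ax: "\<And>l. l \<in> {1, 2} \<Longrightarrow> ord_ge (?v (A l) * at_T e (x 0) - at_T e (x l)) (Q - C)" by auto
    define u where "u i = ?v (approx_system m L x i)" for i
    have u: "u i = at_T e (x (i div s)) * ?v (b (i mod s))" for i
      unfolding u_def approx_system_def s_def b_def by (simp only: ev.hom_mult ev_const)
    \<comment> \<open>The indices of the functions that are replaced by small ones.\<close>
    define special where "special i \<longleftrightarrow> s \<le> i \<and> (i mod s) mod L \<le> N" for i
    have divs: "i div s \<in> {1, 2}" if "s \<le> i" "i < M" for i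
    proof -
      have "i div s < 3" using that(2) unfolding M_def by (simp add: less_mult_imp_div_less)
      moreover have "0 < i div s" using that(1) s0 by (simp add: div_greater_zero_iff)
      ultimately show ?thesis by auto
    qed
    have "\<forall>i. \<exists>c. s \<le> i \<and> i < M \<and> special i \<longrightarrow>
       ?v (A (i div s)) * ?v (b (i mod s)) = (\<Sum>j<s. fls_const (c j) * ?v (b j))"
    proof
      fix i show "\<exists>c. s \<le> i \<and> i < M \<and> special i \<longrightarrow>
        ?v (A (i div s)) * ?v (b (i mod s)) = (\<Sum>j<s. fls_const (c j) * ?v (b j))"
      proof (cases "s \<le> i \<and> i < M \<and> special i")
        case True
        then have "i div s < 3" using divs[of i] by auto
        moreover have "i mod s < s" using s0 by simp
        ultimately show ?thesis using expand[of "i div s" "i mod s"] True unfolding special_def by blast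
      qed blast
    qed
    then obtain c where c: "\<And>i. s \<le> i \<Longrightarrow> i < M \<Longrightarrow> special i \<Longrightarrow>
       ?v (A (i div s)) * ?v (b (i mod s)) = (\<Sum>j<s. fls_const (c i j) * ?v (b j))" by metis
    define u' where "u' i = (if special i then (?v (A (i div s)) * at_T e (x 0) - at_T e (x (i div s))) * ?v (b (i mod s)) else u i)" for i
    have "wronskian M u' = wronskian M u \<or> wronskian M u' = - wronskian M u"
    proof (rule wronskian_unitriangular_change[of s M u' u "\<lambda>i. if special i then -1 else 1"
          "\<lambda>i j. if special i then fls_const (c i j) else 0"])
      show "s \<le> M" unfolding M_def by simp
      show "u' i = u i" if "i < s" for i using that unfolding u'_def special_def by simp
      show "(if special i then - 1 else 1) = 1 \<or> (if special i then - 1 else 1) = (-1 :: 'a fls)" for i by simp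
      show "?d (if special i then fls_const (c i j) else 0) = 0" for i j
        by (simp add: branch_deriv_def)
      fix i assume i: "s \<le> i" "i < M"
      show "u' i = (if special i then - 1 else 1) * u i + (\<Sum>j<s. (if special i then fls_const (c i j) else 0) * u j)"
      proof (cases "special i")
        case True
        have "(\<Sum>j<s. fls_const (c i j) * u j) = at_T e (x 0) * (\<Sum>j<s. fls_const (c i j) * ?v (b j))"
          unfolding sum_distrib_left u by (intro sum.cong) auto
        also have "\<dots> = at_T e (x 0) * (?v (A (i div s)) * ?v (b (i mod s)))"
          using c[OF i True] by simp
        finally show ?thesis using True unfolding u'_def by (simp add: u algebra_simps)
      qed (simp add: u'_def)
    qed
    moreover have "?v (approx_wronskian g L x) = wronskian M u"
      unfolding ev_approx_wronskian[OF e root] u_def M_def s_def m_def ..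
    moreover have "ord_ge (wronskian M u') (Q * (int m * (int N + 1 - 3 * int D)) - K)"
    proof -
      define \<beta> where "\<beta> i = (if special i then Q else - Q) - (K2 + C + int M * K1)" for i
      have "ord_ge (wronskian M u') (\<Sum>i<M. \<beta> i)"
        unfolding wronskian_def
      proof (rule ord_ge_det)
        fix \<rho> i assume \<rho>: "\<rho> < M" and i: "i < M"
        have "i mod s < s" using s0 by simp
        then have bi: "ord_ge (?v (b (i mod s))) (- K2)" by (rule K2)
        have "ord_ge (u' i) ((if special i then Q else - Q) - C + - K2)"
        proof (cases "special i")
          case True
          then have "i div s \<in> {1, 2}" using divs i unfolding special_def by blast
          then show ?thesis unfolding u'_def using True ord_ge_mult[OF ax bi] by simp
        next
          case False
          have "i div s < 3" using i unfolding M_def by (simp add: less_mult_imp_div_less)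
          then show ?thesis unfolding u'_def u using False ord_ge_mult[OF x bi] by simp
        qed
        then have "ord_ge ((?d ^^ \<rho>) (u' i)) ((if special i then Q else - Q) - C + - K2 - int \<rho> * K1)"
          by (rule K1(2))
        moreover have "int \<rho> * K1 \<le> int M * K1" using \<rho> K1(1) by (intro mult_right_mono) auto
        ultimately have "ord_ge ((?d ^^ \<rho>) (u' i)) (\<beta> i)"
          unfolding \<beta>_def by (elim ord_ge_mono) simp
        then show "ord_ge (mat M M (\<lambda>(\<rho>, i). (?d ^^ \<rho>) (u' i)) $$ (\<rho>, i)) (\<beta> i)"
          using \<rho> i by simp
      qed simp
      also have "(\<Sum>i<M. \<beta> i) = (\<Sum>i<M. if special i then Q else - Q) - K"
        unfolding \<beta>_def sum_subtractf K_def by simp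
      also have "(\<Sum>i<M. if special i then Q else - Q) = Q * (int m * (int N + 1 - 3 * int D))"
      proof -
        \<comment> \<open>One block of s functions of order - Q; two blocks with m (N + 1) functions of order Q and m D of order - Q.\<close>
        define h where "h l r = (if 1 \<le> l \<and> r mod L \<le> N then Q else - Q)" for l r :: nat
        have "(\<Sum>i<M. if special i then Q else - Q) = (\<Sum>i<3 * s. h (i div s) (i mod s))"
          unfolding M_def h_def special_def using s0 by (intro sum.cong) (auto simp: Suc_le_eq div_greater_zero_iff)
        also have "\<dots> = (\<Sum>l<3. \<Sum>r<s. h l r)" by (rule sum_div_mod)
        also have "\<dots> = (\<Sum>r<s. - Q) + 2 * (\<Sum>r<s. h 1 r)"
          unfolding h_def by (simp add: numeral_3_eq_3 lessThan_Suc)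
        also have "(\<Sum>r<s. h 1 r) = (\<Sum>k<m. \<Sum>j<L. if j \<le> N then Q else - Q)"
          unfolding s_def h_def using sum_div_mod[of "\<lambda>k j. if j \<le> N then Q else - Q" L m] by simp
        also have "(\<Sum>j<L. if j \<le> N then Q else - Q) = (int N + 1) * Q - int D * Q"
        proof -
          have "{..<L} = {..N} \<union> {N<..<L}" using L by auto
          moreover have "(\<Sum>j\<in>{..N} \<union> {N<..<L}. if j \<le> N then Q else - Q) = (\<Sum>j\<le>N. Q) + (\<Sum>j\<in>{N<..<L}. - Q)"
            by (subst sum.union_disjoint) auto
          ultimately show ?thesis using L by (simp add: algebra_simps)
        qed
        finally show ?thesis unfolding s_def using L by (simp add: algebra_simps)
      qed
      finally show ?thesis .
    qed
    ultimately show "ord_ge (?v (approx_wronskian g L x)) (Q * (int (degree g) * (int N + 1 - 3 * int D)) - K)"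
      unfolding m_def by (metis add.inverse_inverse ord_ge_minus)
  qed
qed

text \<open>
  The multiple c \<alpha> lies in C[T][\<theta>] for every root \<theta> of g, and \<open>approx_wronskian_small\<close> is applied to
  it and to the triple q, c p, c^2 r.
\<close>
theorem no_simultaneous_approximation:
  fixes g :: "'a::field_char_0 poly poly" and \<alpha> :: "'a fls"
  assumes e: "e > 0" and monic: "lead_coeff g = 1" and deg: "degree g > 0"
    and \<Theta>: "finite \<Theta>" "card \<Theta> = degree g" "\<And>\<theta>. \<theta> \<in> \<Theta> \<Longrightarrow> ev e \<theta> g = 0"
    and indep: "\<And>\<theta> P. \<theta> \<in> \<Theta> \<Longrightarrow> degree P < degree g \<Longrightarrow> ev e \<theta> P = 0 \<Longrightarrow> P = 0"
    and c0: "c \<noteq> 0" and gen: "\<And>\<theta>. \<theta> \<in> \<Theta> \<Longrightarrow> \<exists>A. at_T e c * \<alpha> = ev e \<theta> A"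
    and \<alpha>: "\<And>B. (\<Sum>l<3. at_T e (B l) * \<alpha> ^ l) = 0 \<Longrightarrow> \<forall>l<3::nat. B l = 0"
    and approx: "\<And>d. \<exists>q p r. d \<le> degree q \<and> degree p \<le> degree q \<and> degree r \<le> degree q \<and>
       ord_ge (at_T e q * \<alpha> - at_T e p) (int e * int (degree q)) \<and>
       ord_ge (at_T e q * \<alpha>\<^sup>2 - at_T e r) (int e * int (degree q))"
  shows False
proof -
  define m where "m = degree g"
  have m0: "m > 0" unfolding m_def by (rule deg)
  obtain A1 where A1: "\<And>\<theta>. \<theta> \<in> \<Theta> \<Longrightarrow> at_T e c * \<alpha> = ev e \<theta> (A1 \<theta>)" using gen by metis
  have "\<forall>\<theta> l. \<exists>D. raises_degree_by g D (A1 \<theta> ^ l)" using raises_degree_by_exists[OF monic deg] by blast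
  then obtain D1 where D1: "\<And>\<theta> l. raises_degree_by g (D1 \<theta> l) (A1 \<theta> ^ l)" by metis
  define D where "D = Max ((\<lambda>(\<theta>, l). D1 \<theta> l) ` (\<Theta> \<times> {..<3}))"
  have D: "raises_degree_by g D (A1 \<theta> ^ l)" if "\<theta> \<in> \<Theta>" "l < 3" for \<theta> l
    by (rule raises_degree_by_mono[OF D1]) (use that \<Theta>(1) in \<open>auto simp: D_def intro!: Max_ge\<close>)
  \<comment> \<open>The choice that makes the exponent N + 1 - 3 D of the estimate equal to 1.\<close>
  define N where "N = 3 * D"
  define L where "L = N + D + 1"
  have L0: "L > 0" unfolding L_def by simp
  define a where "a = at_T e c * \<alpha>"
  have evA: "ev e \<theta> ((A1 \<theta>) ^ l) = a ^ l" if "\<theta> \<in> \<Theta>" for \<theta> l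
    using A1[OF that] unfolding a_def by (simp add: ev.hom_power)
  define C where "C = int e * (2 * int (degree c))"
  have C0: "C \<ge> 0" unfolding C_def by simp
  have "\<exists>K. \<forall>Q x. (\<forall>l<3. ord_ge (at_T e (x l)) (- Q - C)) \<and>
       (\<forall>l\<in>{1, 2}. ord_ge (a ^ l * at_T e (x 0) - at_T e (x l)) (Q - C)) \<longrightarrow>
       ord_ge (ev e \<theta> (approx_wronskian g L x)) (Q * int m - K)" if \<theta>: "\<theta> \<in> \<Theta>" for \<theta>
    using approx_wronskian_small[where A = "\<lambda>l. A1 \<theta> ^ l" and C = C, OF e \<Theta>(3)[OF \<theta>] deg D[OF \<theta>] L_def]
    unfolding evA[OF \<theta>] N_def m_def by simp
  then obtain K where K: "\<And>\<theta> Q x. \<theta> \<in> \<Theta> \<Longrightarrow> (\<And>l. l < 3 \<Longrightarrow> ord_ge (at_T e (x l)) (- Q - C)) \<Longrightarrow>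
       (\<And>l. l \<in> {1, 2} \<Longrightarrow> ord_ge (a ^ l * at_T e (x 0) - at_T e (x l)) (Q - C)) \<Longrightarrow>
       ord_ge (ev e \<theta> (approx_wronskian g L x)) (Q * int m - K \<theta>)" by metis
  define Kmax where "Kmax = Max (insert 0 (K ` \<Theta>))"
  have Kmax: "K \<theta> \<le> Kmax" if "\<theta> \<in> \<Theta>" for \<theta> unfolding Kmax_def using that \<Theta>(1) by (intro Max_ge) auto
  define v where "v = (\<lambda>(l, j). at_T e (monom 1 j) * a ^ l)"
  have combination: "(\<Sum>p\<in>{..<3} \<times> {..<L}. fls_const (d p) * v p)
      = (\<Sum>l<3. at_T e (\<Sum>j<L. monom (d (l, j)) j) * a ^ l)" for d :: "nat \<times> nat \<Rightarrow> 'a"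
  proof -
    have "at_T e (monom (d (l, j)) j) = fls_const (d (l, j)) * at_T e (monom 1 j)" for l j
      using at_T.hom_mult[of e "[:d (l, j):]" "monom 1 j"] by (simp add: smult_monom)
    then show ?thesis unfolding v_def
      by (simp add: sum.cartesian_product case_prod_unfold at_T.hom_sum sum_distrib_right mult.assoc)
  qed
  have "\<exists>R. \<forall>d. ord_ge (\<Sum>p\<in>{..<3} \<times> {..<L}. fls_const (d p) * v p) R \<longrightarrow> (\<forall>p\<in>{..<3} \<times> {..<L}. d p = 0)"
  proof (rule finite_family_bounded_order)
    fix d :: "nat \<times> nat \<Rightarrow> 'a"
    define B where "B l = (\<Sum>j<L. monom (d (l, j)) j)" for l
    assume "(\<Sum>p\<in>{..<3} \<times> {..<L}. fls_const (d p) * v p) = 0"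
    then have "(\<Sum>l<3. at_T e (B l * c ^ l) * \<alpha> ^ l) = 0"
      unfolding combination B_def a_def by (simp add: at_T.hom_mult at_T.hom_power power_mult_distrib mult.assoc)
    then have "\<forall>l<3. B l * c ^ l = 0" by (rule \<alpha>)
    then have Bl: "\<forall>l<3. B l = 0" using c0 by simp
    have "d (l, j) = 0" if "l < 3" "j < L" for l j
    proof -
      have "coeff (B l) j = d (l, j)" unfolding B_def using that by (simp add: coeff_sum)
      then show ?thesis using Bl that by simp
    qed
    then show "\<forall>p\<in>{..<3} \<times> {..<L}. d p = 0" by auto
  qed simp
  then obtain R where R: "\<And>d. ord_ge (\<Sum>p\<in>{..<3} \<times> {..<L}. fls_const (d p) * v p) R
      \<Longrightarrow> \<forall>p\<in>{..<3} \<times> {..<L}. d p = 0" by blast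
  have R': "\<forall>l<3. B l = 0" if degB: "\<And>l. l < 3 \<Longrightarrow> degree (B l) < L"
    and small: "ord_ge (\<Sum>l<3. at_T e (B l) * a ^ l) R" for B
  proof -
    have B: "(\<Sum>j<L. monom (coeff (B l) j) j) = B l" if "l < 3" for l
      using degB[OF that] by (intro poly_eqI) (auto simp: coeff_sum coeff_eq_0)
    then have "(\<Sum>l<3. at_T e (\<Sum>j<L. monom (coeff (B l) j) j) * a ^ l) = (\<Sum>l<3. at_T e (B l) * a ^ l)"
      by (intro sum.cong) simp_all
    then have "\<forall>p\<in>{..<3} \<times> {..<L}. coeff (B (fst p)) (snd p) = 0"
      using R[of "\<lambda>p. coeff (B (fst p)) (snd p)"] small unfolding combination by simp
    then have "coeff (B l) j = 0" if "l < 3" "j < L" for l j using that by auto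
    then have "(\<Sum>j<L. monom (coeff (B l) j) j) = 0" if "l < 3" for l using that by (intro sum.neutral) auto
    then have "B l = 0" if "l < 3" for l using B[OF that] that by simp
    then show ?thesis by blast
  qed
  \<comment> \<open>All constants above are independent of q, so the degree of q may now be chosen large enough.\<close>
  define d where "d = nat (\<bar>R\<bar> + 2 * C + int e * int L + Kmax + 1)"
  have "Kmax \<ge> 0" unfolding Kmax_def using \<Theta>(1) by (intro Max_ge) auto
  then have d: "int d = \<bar>R\<bar> + 2 * C + int e * int L + Kmax + 1" unfolding d_def using C0 by simp
  obtain q p r where deg_q: "d \<le> degree q" and dp: "degree p \<le> degree q" "degree r \<le> degree q"
    and ap: "ord_ge (at_T e q * \<alpha> - at_T e p) (int e * int (degree q))"
      "ord_ge (at_T e q * \<alpha>\<^sup>2 - at_T e r) (int e * int (degree q))"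
    using approx by blast
  define n where "n = int e * int (degree q)"
  have n: "n \<ge> \<bar>R\<bar> + 2 * C + int e * int L + Kmax + 1"
  proof -
    have "int d \<le> int (degree q)" using deg_q by simp
    also have "\<dots> \<le> n" unfolding n_def using e by (simp add: mult_le_cancel_right1)
    finally show ?thesis using d by simp
  qed
  define x where "x l = (if l = 0 then q else if l = 1 then c * p else c ^ 2 * r)" for l :: nat
  have vT: "ord_ge (at_T e P) (- (int e * int k))" if "degree P \<le> k" for P :: "'a poly" and k :: nat
    using at_T_leading(1)[OF e, of P] by (rule ord_ge_mono) (use that in \<open>simp add: mult_left_mono\<close>)
  have eL: "int e * int L \<ge> 0" by simp
  then have "d > 0" using d eL \<open>Kmax \<ge> 0\<close> C0 by linarith
  then have "degree q > 0" using deg_q by simp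
  then have q0: "q \<noteq> 0" by auto
  have xsmall: "ord_ge (at_T e (x l)) (- n - C)" for l
  proof -
    have "degree (c * p) \<le> degree c + degree p" by (rule degree_mult_le)
    moreover have "degree (c ^ 2 * r) \<le> degree (c ^ 2) + degree r" by (rule degree_mult_le)
    moreover have "degree (c ^ 2) \<le> 2 * degree c" using degree_power_le[of c 2] by (simp add: mult.commute)
    ultimately have "degree (x l) \<le> degree q + 2 * degree c" using dp unfolding x_def by auto
    from vT[OF this] show ?thesis unfolding n_def C_def by (simp add: algebra_simps)
  qed
  have axsmall: "ord_ge (a ^ l * at_T e (x 0) - at_T e (x l)) (n - C)" if "l \<in> {1, 2}" for l
  proof -
    have c1: "ord_ge (at_T e c) (- C)"
      using vT[of c "2 * degree c"] unfolding C_def by simp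
    have "degree (c ^ 2) \<le> 2 * degree c" using degree_power_le[of c 2] by (simp add: mult.commute)
    then have c2: "ord_ge (at_T e (c ^ 2)) (- C)"
      using vT[of "c ^ 2" "2 * degree c"] unfolding C_def by simp
    from that consider "l = 1" | "l = 2" by blast
    then show ?thesis
    proof cases
      case 1
      have "a ^ l * at_T e (x 0) - at_T e (x l) = at_T e c * (at_T e q * \<alpha> - at_T e p)"
        unfolding 1 x_def a_def by (simp add: at_T.hom_mult algebra_simps)
      then show ?thesis using ord_ge_mult[OF c1 ap(1)] unfolding n_def by simp
    next
      case 2
      have "a ^ l * at_T e (x 0) - at_T e (x l) = at_T e (c ^ 2) * (at_T e q * \<alpha>\<^sup>2 - at_T e r)"
        unfolding 2 x_def a_def by (simp add: at_T.hom_mult at_T.hom_power power_mult_distrib algebra_simps)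
      then show ?thesis using ord_ge_mult[OF c2 ap(2)] unfolding n_def by simp
    qed
  qed
  \<comment> \<open>The relation exhibits q (B 0 + B 1 a + B 2 a^2) as a combination of small terms, and q is large.\<close>
  have no_rel: "\<forall>l<3. B l = 0" if degB: "\<And>l. l < 3 \<Longrightarrow> degree (B l) < L" and rel: "(\<Sum>l<3. B l * x l) = 0" for B
  proof (rule R'[OF degB])
    define z where "z = (\<Sum>l<3. at_T e (B l) * a ^ l)"
    have rel': "(\<Sum>l<3. at_T e (B l) * at_T e (x l)) = 0"
      using arg_cong[OF rel, of "at_T e"] by (simp add: at_T.hom_sum at_T.hom_mult)
    have "at_T e q * z = (\<Sum>l<3. at_T e (B l) * (a ^ l * at_T e (x 0))) - (\<Sum>l<3. at_T e (B l) * at_T e (x l))"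
      unfolding z_def sum_distrib_left rel' by (simp add: x_def mult_ac)
    also have "\<dots> = (\<Sum>l<3. at_T e (B l) * (a ^ l * at_T e (x 0) - at_T e (x l)))"
      by (simp add: right_diff_distrib sum_subtractf)
    finally have qz: "at_T e q * z = (\<Sum>l<3. at_T e (B l) * (a ^ l * at_T e (x 0) - at_T e (x l)))" .
    have "ord_ge (at_T e q * z) (- (int e * int L) + (n - C))"
      unfolding qz
    proof (rule ord_ge_sum)
      fix l :: nat assume l: "l \<in> {..<3}"
      show "ord_ge (at_T e (B l) * (a ^ l * at_T e (x 0) - at_T e (x l))) (- (int e * int L) + (n - C))"
      proof (cases "l = 0")
        case False
        then have "l \<in> {1, 2}" using l by auto
        moreover have "degree (B l) \<le> L" using degB l by (simp add: less_imp_le)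
        ultimately show ?thesis by (intro ord_ge_mult vT axsmall)
      qed simp
    qed
    moreover have "fls_subdegree (at_T e q) = - n"
      unfolding n_def
    proof (rule fls_subdegree_eqI)
      show "fls_nth (at_T e q) (- (int e * int (degree q))) \<noteq> 0" using at_T_leading(2)[OF e, of q] q0 by simp
      show "fls_nth (at_T e q) k = 0" if "k < - (int e * int (degree q))" for k
        using at_T_leading(1)[OF e, of q] that unfolding ord_ge_def by blast
    qed
    ultimately have "z = 0 \<or> 2 * n - C - int e * int L \<le> fls_subdegree z"
      using q0 at_T_eq_0_iff[OF e, of q] unfolding ord_ge_iff by (cases "z = 0") auto
    moreover have "R \<le> 2 * n - C - int e * int L" using n C0 eL \<open>Kmax \<ge> 0\<close> by linarith
    ultimately show "ord_ge (\<Sum>l<3. at_T e (B l) * a ^ l) R"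
      unfolding z_def[symmetric] ord_ge_iff by auto
  qed
  define w where "w = approx_wronskian g L x"
  have wsmall: "ord_ge (ev e \<theta> w) 1" if "\<theta> \<in> \<Theta>" for \<theta>
  proof (rule ord_ge_mono)
    show "ord_ge (ev e \<theta> w) (n * int m - K \<theta>)"
      unfolding w_def by (rule K[OF that xsmall axsmall])
    have "n \<ge> 0" unfolding n_def by simp
    then have "n \<le> n * int m" using m0 by (simp add: mult_le_cancel_left1)
    then show "1 \<le> n * int m - K \<theta>" using n Kmax[OF that] C0 by (smt (verit) mult_nonneg_nonneg of_nat_0_le_iff)
  qed
  have wne: "ev e \<theta> w \<noteq> 0" if "\<theta> \<in> \<Theta>" for \<theta>
    unfolding w_def by (rule approx_wronskian_nonzero[OF e \<Theta>(3)[OF that] deg indep[OF that] no_rel L0])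
  obtain P where P: "(\<Prod>\<theta>\<in>\<Theta>. ev e \<theta> w) = at_T e P"
    using norm_is_polynomial[OF monic m_def[symmetric] m0 \<Theta>(1) \<Theta>(2)[folded m_def] \<Theta>(3)] by blast
  have "at_T e P \<noteq> 0" unfolding P[symmetric] using wne \<Theta>(1) by simp
  then have "P \<noteq> 0" by auto
  have "ord_ge (at_T e P) (\<Sum>\<theta>\<in>\<Theta>. 1)" unfolding P[symmetric] by (rule ord_ge_prod) (rule wsmall)
  moreover have "- (int e * int (degree P)) < (\<Sum>\<theta>\<in>\<Theta>. 1)"
    using m0 \<Theta>(2) unfolding m_def by (simp add: le_less_trans[of _ 0])
  ultimately have "fls_nth (at_T e P) (- (int e * int (degree P))) = 0" unfolding ord_ge_def by blast
  then show False using at_T_leading(2)[OF e, of P] \<open>P \<noteq> 0\<close> by simp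
qed

section \<open>Palindromic continued fractions\<close>

lemma poly_T_eq_at_T: "poly_T = at_T (Suc 0)"
  by (rule ext) (simp add: poly_T_def at_T_def)

lemma fls_nth_at_T_1: "fls_nth (at_T (Suc 0) P) k = (if k \<le> 0 then coeff P (nat (- k)) else 0)"
proof (induction P arbitrary: k)
  case (pCons c P)
  have "fls_nth (fls_X_inv * at_T (Suc 0) P) k = fls_nth (at_T (Suc 0) P) (k + 1)"
    by (simp add: fls_X_inv_times_conv_shift)
  then have nth: "fls_nth (at_T (Suc 0) (pCons c P)) k = (if k = 0 then c else 0) + fls_nth (at_T (Suc 0) P) (k + 1)"
    by (simp add: at_T_pCons)
  show ?case
  proof (cases "k < 0")
    case True
    then have "nat (- k) = Suc (nat (- (k + 1)))" by simp
    then show ?thesis using True unfolding nth pCons.IH by simp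
  qed (auto simp: nth pCons.IH)
qed simp

lemma ord_ge_fractional_part: "ord_ge (\<beta> - poly_T (poly_floor \<beta>)) 1"
  unfolding ord_ge_def
proof (intro allI impI)
  fix k :: int assume "k < 1"
  then show "fls_nth (\<beta> - poly_T (poly_floor \<beta>)) k = 0"
    by (cases "k = 0") (auto simp: poly_T_eq_at_T fls_nth_at_T_1 poly_floor_def coeff_pCons split: nat.split)
qed

text \<open>
  The continuant of a list of partial quotients; the recursion runs through the list from the front,
  while that of the convergents appends to its end. The two are related by \<open>continuant_snoc\<close>, and
  invariance under reversal follows.
\<close>
fun continuant :: "'a::comm_ring_1 list \<Rightarrow> 'a" where
  "continuant [] = 1"
| "continuant [x] = x"
| "continuant (x # y # zs) = x * continuant (y # zs) + continuant zs"

lemma continuant_snoc: "continuant (xs @ [u, v]) = v * continuant (xs @ [u]) + continuant xs"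
  by (induction xs rule: continuant.induct) (simp_all add: algebra_simps)

lemma continuant_rev: "continuant (rev xs) = continuant xs"
proof (induction xs rule: continuant.induct)
  case (3 x y zs)
  have "continuant (rev (x # y # zs)) = x * continuant (rev (y # zs)) + continuant (rev zs)"
    using continuant_snoc[of "rev zs" y x] by simp
  then show ?case using 3 by simp
qed simp_all

fun cf_denominator :: "(nat \<Rightarrow> 'a::comm_ring_1) \<Rightarrow> nat \<Rightarrow> 'a" where
  "cf_denominator a 0 = 1"
| "cf_denominator a (Suc 0) = a 1"
| "cf_denominator a (Suc (Suc n)) = a (Suc (Suc n)) * cf_denominator a (Suc n) + cf_denominator a n"

fun cf_numerator :: "(nat \<Rightarrow> 'a::comm_ring_1) \<Rightarrow> nat \<Rightarrow> 'a" where
  "cf_numerator a 0 = 0"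
| "cf_numerator a (Suc 0) = 1"
| "cf_numerator a (Suc (Suc n)) = a (Suc (Suc n)) * cf_numerator a (Suc n) + cf_numerator a n"

lemma cf_denominator_continuant: "cf_denominator a n = continuant (map a [1..<Suc n])"
proof (induction n rule: cf_denominator.induct[where ?P = "\<lambda>_ n. cf_denominator a n = continuant (map a [1..<Suc n])" and ?a0.0 = a])
  case (3 a' n)
  then show ?case using continuant_snoc[of "map a [1..<Suc n]" "a (Suc n)" "a (Suc (Suc n))"] by simp
qed simp_all

lemma cf_numerator_continuant: "cf_numerator a (Suc n) = continuant (map a [2..<Suc (Suc n)])"
proof (induction n rule: induct_nat_012)
  case (ge2 n)
  then show ?case using continuant_snoc[of "map a [2..<Suc (Suc n)]" "a (Suc (Suc n))" "a (Suc (Suc (Suc n)))"] by simp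
qed (simp_all add: numeral_2_eq_2)

text \<open>
  The numerator is the continuant of a_2, ..., a_(n+1), the denominator that of a_1, ..., a_n, and for
  a palindrome these lists are reversals of each other.
\<close>
lemma palindrome_numerator_eq_denominator:
  assumes pal: "\<And>j. 1 \<le> j \<Longrightarrow> j \<le> Suc n \<Longrightarrow> a j = a (Suc n + 1 - j)"
  shows "cf_numerator a (Suc n) = cf_denominator a n"
proof -
  define xs where "xs = map a [1..<Suc (Suc n)]"
  have "rev xs = xs"
  proof (rule nth_equalityI)
    fix i assume "i < length (rev xs)"
    then have i: "i < Suc n" unfolding xs_def by (simp del: upt_Suc)
    have "rev xs ! i = xs ! (n - i)" using i unfolding xs_def by (simp add: rev_nth del: upt_Suc)
    also have "\<dots> = a (Suc (n - i))" using i unfolding xs_def by (simp del: upt_Suc)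
    also have "\<dots> = a (Suc i)" using pal[of "Suc (n - i)"] i by (simp add: Suc_diff_le)
    also have "\<dots> = xs ! i" using i unfolding xs_def by (simp del: upt_Suc)
    finally show "rev xs ! i = xs ! i" .
  qed simp
  have "tl xs = map a [2..<Suc (Suc n)]" unfolding xs_def by (simp add: map_tl[symmetric] numeral_2_eq_2 del: upt_Suc)
  then have "cf_numerator a (Suc n) = continuant (rev (tl xs))" by (simp add: cf_numerator_continuant continuant_rev)
  also have "rev (tl xs) = butlast xs" by (metis \<open>rev xs = xs\<close> butlast_rev)
  also have "butlast xs = map a [1..<Suc n]" unfolding xs_def by (simp add: map_butlast[symmetric])
  finally show ?thesis by (simp add: cf_denominator_continuant)
qed

locale infinite_cf =
  fixes \<alpha> :: "'a::field fls" and a :: "nat \<Rightarrow> 'a poly"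
  assumes cf: "has_infinite_cf \<alpha> a" and a0: "a 0 = 0"
begin

definition z :: "nat \<Rightarrow> 'a fls" where "z = complete_quotient \<alpha>"
definition q :: "nat \<Rightarrow> 'a poly" where "q = cf_denominator a"
definition p :: "nat \<Rightarrow> 'a poly" where "p = cf_numerator a"
definition err :: "nat \<Rightarrow> 'a fls" where "err n = poly_T (q n) * \<alpha> - poly_T (p n)"

lemma z_Suc: "z (Suc n) = 1 / (z n - poly_T (a n))"
  and remainder_nonzero: "z n - poly_T (a n) \<noteq> 0"
  and remainder_small: "ord_ge (z n - poly_T (a n)) 1"
proof -
  have an: "a n = poly_floor (z n)" "z n \<noteq> poly_T (a n)" using cf unfolding has_infinite_cf_def z_def by blast+
  show "z (Suc n) = 1 / (z n - poly_T (a n))" unfolding z_def an(1)[unfolded z_def] by simp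
  show "z n - poly_T (a n) \<noteq> 0" using an(2) by simp
  show "ord_ge (z n - poly_T (a n)) 1" unfolding an(1) by (rule ord_ge_fractional_part)
qed

lemma subdegree_z: "fls_subdegree (z (Suc n)) = - int (degree (a (Suc n)))"
  and z_nonzero: "z (Suc n) \<noteq> 0" and degree_a: "degree (a (Suc n)) > 0"
proof -
  have "fls_subdegree (z n - poly_T (a n)) \<ge> 1"
    using remainder_small[of n] remainder_nonzero[of n] unfolding ord_ge_iff by simp
  then have neg: "fls_subdegree (z (Suc n)) < 0"
    unfolding z_Suc using remainder_nonzero[of n] by (simp add: fls_divide_subdegree)
  show nz: "z (Suc n) \<noteq> 0" unfolding z_Suc using remainder_nonzero[of n] by simp
  define r where "r = z (Suc n) - poly_T (a (Suc n))"
  have aT: "poly_T (a (Suc n)) = z (Suc n) - r" unfolding r_def by simp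
  have r: "fls_nth r k = 0" if "k < 1" for k
    using remainder_small[of "Suc n"] that unfolding r_def ord_ge_def by simp
  have "fls_subdegree (poly_T (a (Suc n))) = fls_subdegree (z (Suc n))"
    unfolding aT by (rule fls_subdegree_eqI) (use neg nz in \<open>auto simp: r\<close>)
  moreover have "a (Suc n) \<noteq> 0" using calculation neg unfolding poly_T_eq_at_T by auto
  moreover have "fls_subdegree (at_T (Suc 0) (a (Suc n))) = - int (degree (a (Suc n)))"
  proof (rule fls_subdegree_eqI)
    show "fls_nth (at_T (Suc 0) (a (Suc n))) (- int (degree (a (Suc n)))) \<noteq> 0"
      using \<open>a (Suc n) \<noteq> 0\<close> by (simp add: fls_nth_at_T_1)
    show "fls_nth (at_T (Suc 0) (a (Suc n))) k = 0" if "k < - int (degree (a (Suc n)))" for k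
      using that by (auto simp: fls_nth_at_T_1 intro!: coeff_eq_0)
  qed
  ultimately show "fls_subdegree (z (Suc n)) = - int (degree (a (Suc n)))" unfolding poly_T_eq_at_T by simp
  then show "degree (a (Suc n)) > 0" using neg by simp
qed

lemma degree_q_Suc: "degree (q (Suc n)) = degree (a (Suc n)) + degree (q n) \<and> q (Suc n) \<noteq> 0"
proof (induction n)
  case 0
  then show ?case using degree_a[of 0] by (auto simp: q_def)
next
  case (Suc n)
  have "q (Suc (Suc n)) = a (Suc (Suc n)) * q (Suc n) + q n" unfolding q_def by simp
  moreover have ne: "a (Suc (Suc n)) \<noteq> 0" using degree_a[of "Suc n"] by auto
  moreover have "degree (a (Suc (Suc n)) * q (Suc n)) = degree (a (Suc (Suc n))) + degree (q (Suc n))"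
    using ne Suc by (simp add: degree_mult_eq)
  moreover have "degree (q n) < degree (a (Suc (Suc n))) + degree (q (Suc n))"
    using Suc degree_a[of n] by simp
  ultimately have "degree (q (Suc (Suc n))) = degree (a (Suc (Suc n))) + degree (q (Suc n))"
    by (simp add: degree_add_eq_left)
  then show ?case using degree_a[of "Suc n"] by auto
qed

lemma degree_q_ge: "n \<le> degree (q n)"
proof (induction n)
  case (Suc n)
  then show ?case using degree_q_Suc[of n] degree_a[of n] by simp
qed simp

lemma degree_p_le: "degree (p n) \<le> degree (q n) \<and> degree (p (Suc n)) \<le> degree (q (Suc n))"
proof (induction n)
  case 0
  then show ?case by (simp add: p_def)
next
  case (Suc n)
  have "p (Suc (Suc n)) = a (Suc (Suc n)) * p (Suc n) + p n" unfolding p_def by simp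
  moreover have "degree (a (Suc (Suc n)) * p (Suc n)) \<le> degree (q (Suc (Suc n)))"
    using degree_mult_le[of "a (Suc (Suc n))" "p (Suc n)"] Suc degree_q_Suc[of "Suc n"] by linarith
  moreover have "degree (p n) \<le> degree (q (Suc (Suc n)))"
    using Suc degree_q_Suc[of n] degree_q_Suc[of "Suc n"] by linarith
  ultimately show ?case using Suc by (simp add: degree_add_le)
qed

text \<open>
  This is the identity \<alpha> = (p_(n+1) z_(n+2) + p_n) / (q_(n+1) z_(n+2) + q_n) for the complete quotient
  z_(n+2), solved for the errors. It determines their orders.
\<close>
lemma err_recursion: "err (Suc n) * z (Suc (Suc n)) = - err n"
proof (induction n)
  case 0
  have a: "\<alpha> \<noteq> 0" "z (Suc 0) = 1 / \<alpha>"
    using z_Suc[of 0] remainder_nonzero[of 0] by (auto simp: z_def a0 poly_T_eq_at_T)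
  then have "err (Suc 0) = - \<alpha> * (z (Suc 0) - poly_T (a (Suc 0)))"
    by (simp add: err_def q_def p_def poly_T_eq_at_T field_simps)
  moreover have "err 0 = \<alpha>" by (simp add: err_def q_def p_def poly_T_eq_at_T)
  ultimately show ?case using z_Suc[of "Suc 0"] remainder_nonzero[of "Suc 0"] by simp
next
  case (Suc n)
  have "err (Suc (Suc n)) = poly_T (a (Suc (Suc n))) * err (Suc n) + err n"
    unfolding err_def q_def p_def poly_T_eq_at_T by (simp add: at_T.hom_add at_T.hom_mult algebra_simps)
  also have "err n = - (err (Suc n) * z (Suc (Suc n)))" using Suc by simp
  finally have "err (Suc (Suc n)) = - err (Suc n) * (z (Suc (Suc n)) - poly_T (a (Suc (Suc n))))"
    by (simp add: algebra_simps)
  then show ?case using z_Suc[of "Suc (Suc n)"] remainder_nonzero[of "Suc (Suc n)"] by simp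
qed

lemma subdegree_err: "err n \<noteq> 0 \<and> fls_subdegree (err n) = int (degree (q (Suc n)))"
proof (induction n)
  case 0
  have "z (Suc 0) = 1 / \<alpha>" "\<alpha> \<noteq> 0" using z_Suc[of 0] remainder_nonzero[of 0] by (auto simp: z_def a0 poly_T_eq_at_T)
  moreover have "err 0 = \<alpha>" by (simp add: err_def q_def p_def poly_T_eq_at_T)
  moreover have "fls_subdegree (z (Suc 0)) = - fls_subdegree \<alpha>" using calculation by (simp add: fls_divide_subdegree)
  ultimately show ?case using subdegree_z[of 0] by (simp add: q_def)
next
  case (Suc n)
  have ne: "err (Suc n) \<noteq> 0" using err_recursion[of n] Suc by auto
  have "fls_subdegree (err (Suc n) * z (Suc (Suc n))) = int (degree (q (Suc n)))"
    unfolding err_recursion using Suc by simp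
  then have "fls_subdegree (err (Suc n)) - int (degree (a (Suc (Suc n)))) = int (degree (q (Suc n)))"
    using ne z_nonzero[of "Suc n"] subdegree_z[of "Suc n"] by simp
  then show ?case using ne degree_q_Suc[of "Suc n"] by simp
qed

text \<open>
  An error q_n \<alpha> - p_n is nonzero and arbitrarily small, so a denominator B of \<alpha> would give a nonzero
  polynomial B (q_n \<alpha> - p_n) of absolute value less than 1.
\<close>
lemma irrational:
  assumes "poly_T B * \<alpha> = poly_T A" shows "B = 0"
proof (rule ccontr)
  assume B: "B \<noteq> 0"
  define n where "n = degree B"
  have "poly_T B * err n = poly_T (q n * A - B * p n)"
    using assms unfolding err_def poly_T_eq_at_T by (simp add: at_T.hom_minus at_T.hom_mult algebra_simps)
  then have eq: "at_T (Suc 0) B * err n = at_T (Suc 0) (q n * A - B * p n)" unfolding poly_T_eq_at_T .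
  define P where "P = q n * A - B * p n"
  have "at_T (Suc 0) P \<noteq> 0" using eq[symmetric] B subdegree_err[of n] at_T_eq_0_iff[of "Suc 0" B] unfolding P_def by auto
  then have "P \<noteq> 0" by auto
  have "ord_ge (at_T (Suc 0) P) (- int (degree B) + int (degree (q (Suc n))))"
    unfolding P_def eq[symmetric] using subdegree_err[of n] at_T_leading(1)[of "Suc 0" B]
    by (intro ord_ge_mult) (auto simp: ord_ge_iff)
  moreover have "int (degree (q (Suc n))) > int (degree B)" using degree_q_ge[of "Suc n"] unfolding n_def by simp
  ultimately have "fls_nth (at_T (Suc 0) P) (- int (degree P)) = 0" unfolding ord_ge_def by auto
  then show False using at_T_leading(2)[of "Suc 0" P] \<open>P \<noteq> 0\<close> by simp
qed

text \<open>
  Since p_n = q_(n-1), the error of the approximation to \<alpha>^2 is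
  q_n \<alpha>^2 - p_(n-1) = \<alpha> (q_n \<alpha> - p_n) + (q_(n-1) \<alpha> - p_(n-1)).
\<close>
lemma palindromic_approximations:
  assumes "begins_with_long_palindromes a"
  shows "\<exists>Q P R. d \<le> degree Q \<and> degree P \<le> degree Q \<and> degree R \<le> degree Q \<and>
     ord_ge (poly_T Q * \<alpha> - poly_T P) (int (degree Q)) \<and>
     ord_ge (poly_T Q * \<alpha>\<^sup>2 - poly_T R) (int (degree Q))"
proof -
  from assms obtain n where "n > d" and pal: "\<forall>j. 1 \<le> j \<and> j \<le> n \<longrightarrow> a j = a (n + 1 - j)"
    unfolding begins_with_long_palindromes_def infinite_nat_iff_unbounded by blast
  then obtain k where k: "n = Suc k" by (cases n) auto
  have pq: "p n = q k" unfolding p_def q_def k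
    by (rule palindrome_numerator_eq_denominator) (use pal k in auto)
  have mono: "degree (q k) \<le> degree (q n)" using degree_q_Suc[of k] unfolding k by simp
  have err: "ord_ge (err n) (int (degree (q n)))" "ord_ge (err k) (int (degree (q n)))"
    using subdegree_err[of n] subdegree_err[of k] degree_q_Suc[of n] unfolding ord_ge_iff k by auto
  have \<alpha>: "ord_ge \<alpha> 0"
    using remainder_small[of 0] by (simp add: z_def a0 poly_T_eq_at_T ord_ge_mono[of _ 1])
  have "poly_T (q n) * \<alpha>\<^sup>2 - poly_T (p k) = \<alpha> * err n + err k"
    unfolding err_def pq by (simp add: power2_eq_square algebra_simps)
  moreover have "ord_ge (\<alpha> * err n) (int (degree (q n)))"
    using ord_ge_mult[OF \<alpha> err(1)] by simp
  ultimately have "ord_ge (poly_T (q n) * \<alpha>\<^sup>2 - poly_T (p k)) (int (degree (q n)))"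
    using err(2) by (simp add: ord_ge_add)
  moreover have "ord_ge (poly_T (q n) * \<alpha> - poly_T (p n)) (int (degree (q n)))"
    using err(1) unfolding err_def .
  moreover have "d \<le> degree (q n)" using degree_q_ge[of n] \<open>n > d\<close> by simp
  moreover have "degree (p k) \<le> degree (q n)" using degree_p_le[of k] mono by simp
  ultimately show ?thesis using degree_p_le[of n] by blast
qed

end

section \<open>Extension of the field of constants\<close>

instance alg_closure :: (field) field_gcd ..

definition fls_map :: "('a::zero \<Rightarrow> 'b::zero) \<Rightarrow> 'a fls \<Rightarrow> 'b fls" where
  "fls_map h f = Abs_fls (\<lambda>n. h (fls_nth f n))"

lemma fls_map_nth: "h 0 = 0 \<Longrightarrow> fls_nth (fls_map h f) n = h (fls_nth f n)"
  unfolding fls_map_def by (rule nth_Abs_fls_lower_bound[of "fls_subdegree f"]) simp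

lemma (in field_hom) fls_subdegree_map: "fls_subdegree (fls_map hom f) = fls_subdegree f"
proof (cases "f = 0")
  case True
  moreover have "fls_map hom 0 = 0" by (rule fls_eqI) (simp add: fls_map_nth)
  ultimately show ?thesis by simp
next
  case False
  show ?thesis by (rule fls_subdegree_eqI) (simp_all add: fls_map_nth False)
qed

lemma (in field_hom) field_hom_fls_map: "field_hom (fls_map hom)"
proof unfold_locales
  show "fls_map hom (x * y) = fls_map hom x * fls_map hom y" for x y
  proof (rule fls_eqI)
    fix n
    show "fls_nth (fls_map hom (x * y)) n = fls_nth (fls_map hom x * fls_map hom y) n"
      unfolding fls_map_nth[of hom, OF hom_zero] fls_times_nth(1) fls_subdegree_map
      by (simp add: hom_sum hom_mult)
  qed
qed (rule fls_eqI; simp add: fls_map_nth hom_add)+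

lemma (in field_hom) fls_map_at_T: "fls_map hom (at_T e P) = at_T e (map_poly hom P)"
proof -
  interpret m: field_hom "fls_map hom" by (rule field_hom_fls_map)
  have const: "fls_map hom (fls_const c) = fls_const (hom c)" for c
    by (rule fls_eqI) (simp add: fls_map_nth)
  have X: "fls_map hom (fls_X_inv ^ e) = fls_X_inv ^ e"
    by (rule fls_eqI) (simp add: fls_map_nth)
  show ?thesis
    by (induction P) (simp_all add: at_T_pCons const X m.hom_add m.hom_mult map_poly_pCons_hom)
qed

lemma (in field_hom) fls_map_ev: "fls_map hom (ev e \<theta> P) = ev e (fls_map hom \<theta>) (map_poly (map_poly hom) P)"
proof -
  interpret m: field_hom "fls_map hom" by (rule field_hom_fls_map)
  show ?thesis
    by (induction P) (simp_all add: ev_pCons m.hom_add m.hom_mult fls_map_at_T map_poly_pCons)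
qed

text \<open>
  The coordinate of a vector with respect to the element b of a basis of the closure over the base
  field.
\<close>
lemma linear_functional_nonzero:
  fixes b :: "'a::field alg_closure"
  assumes "b \<noteq> 0"
  obtains \<Lambda> :: "'a alg_closure \<Rightarrow> 'a" where "\<Lambda> 0 = 0" "\<And>x y. \<Lambda> (x + y) = \<Lambda> x + \<Lambda> y"
    "\<And>x k. \<Lambda> (x * to_ac k) = \<Lambda> x * k" "\<Lambda> b \<noteq> 0"
proof -
  interpret vs: Vector_Spaces.vector_space "\<lambda>k x :: 'a alg_closure. to_ac k * x"
    by unfold_locales (simp_all add: algebra_simps)
  have ind: "vs.independent {b}" using assms by (simp add: vs.dependent_single)
  define S where "S = vs.extend_basis {b}"
  have S: "vs.independent S" "vs.span S = UNIV" "b \<in> S"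
    unfolding S_def using vs.independent_extend_basis[OF ind] vs.span_extend_basis[OF ind]
      vs.extend_basis_superset[OF ind] by auto
  define \<Lambda> where "\<Lambda> x = vs.representation S x b" for x
  show ?thesis
  proof (rule that[of \<Lambda>])
    show "\<Lambda> 0 = 0" unfolding \<Lambda>_def by (simp add: vs.representation_zero)
    show "\<Lambda> (x + y) = \<Lambda> x + \<Lambda> y" for x y
      unfolding \<Lambda>_def using vs.representation_add[OF S(1)] S(2) by simp
    show "\<Lambda> (x * to_ac k) = \<Lambda> x * k" for x k
    proof -
      have "vs.representation S (to_ac k * x) b = k * vs.representation S x b"
        using vs.representation_scale[OF S(1), of x k] S(2) by simp
      then show ?thesis unfolding \<Lambda>_def by (metis mult.commute)
    qed
    show "\<Lambda> b \<noteq> 0" unfolding \<Lambda>_def using vs.representation_basis[OF S(1,3)] by simp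
  qed
qed

text \<open>
  A functional \<Lambda> that is linear over the base field, applied to the coefficients of a relation over
  the closure, yields a relation over the base field; it is nontrivial if \<Lambda> does not vanish on some
  coefficient of the given relation.
\<close>
lemma independence_over_closure:
  fixes \<alpha> :: "'a::field fls"
  assumes indep: "\<And>B. (\<Sum>l<n. at_T e (B l) * \<alpha> ^ l) = 0 \<Longrightarrow> \<forall>l<n. B l = 0"
    and rel: "(\<Sum>l<n. at_T e (B l) * fls_map to_ac \<alpha> ^ l) = 0"
  shows "\<forall>l<n. B l = 0"
proof (rule ccontr)
  assume "\<not> (\<forall>l<n. B l = 0)"
  then obtain l0 where l0: "l0 < n" "B l0 \<noteq> 0" by blast
  then obtain j0 where j0: "coeff (B l0) j0 \<noteq> 0" by (metis leading_coeff_0_iff)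
  obtain \<Lambda> where \<Lambda>: "\<Lambda> 0 = 0" "\<And>x y. \<Lambda> (x + y) = \<Lambda> x + \<Lambda> y"
    "\<And>x k. \<Lambda> (x * to_ac k) = \<Lambda> x * k" "\<Lambda> (coeff (B l0) j0) \<noteq> (0 :: 'a)"
    using linear_functional_nonzero[OF j0] by blast
  interpret ac: field_hom "to_ac :: 'a \<Rightarrow> 'a alg_closure" by (rule field_hom_to_ac)
  interpret m: field_hom "fls_map (to_ac :: 'a \<Rightarrow> 'a alg_closure)" by (rule ac.field_hom_fls_map)
  have nth: "fls_nth (at_T e (map_poly \<Lambda> P) * \<beta>) k = \<Lambda> (fls_nth (at_T e P * fls_map to_ac \<beta>) k)" for P \<beta> k
  proof (induction P arbitrary: k)
    case 0 then show ?case using \<Lambda>(1) by simp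
  next
    case (pCons c P)
    have sh: "fls_nth (fls_X_inv ^ e * u) k = fls_nth u (k + int e)" for u :: "'x::field fls" and k
      by (simp add: fls_X_inv_power_times_conv_shift)
    have "map_poly \<Lambda> (pCons c P) = pCons (\<Lambda> c) (map_poly \<Lambda> P)"
      using \<Lambda>(1) pCons(1) by (intro poly_eqI) (auto simp: coeff_map_poly coeff_pCons split: nat.split)
    then show ?case
      by (simp add: at_T_pCons distrib_right mult.assoc sh pCons.IH \<Lambda> fls_map_nth)
  qed
  have \<Lambda>sum: "\<Lambda> (sum f A) = (\<Sum>i\<in>A. \<Lambda> (f i))" for f :: "nat \<Rightarrow> 'a alg_closure" and A
    by (induction A rule: infinite_finite_induct) (simp_all add: \<Lambda>)
  have nth_sum: "fls_nth (sum f A) k = (\<Sum>i\<in>A. fls_nth (f i) k)" for f :: "nat \<Rightarrow> 'x::field fls" and A k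
    by (induction A rule: infinite_finite_induct) simp_all
  have "(\<Sum>l<n. at_T e (map_poly \<Lambda> (B l)) * \<alpha> ^ l) = 0"
  proof (rule fls_eqI)
    fix k
    have "fls_nth (\<Sum>l<n. at_T e (map_poly \<Lambda> (B l)) * \<alpha> ^ l) k = \<Lambda> (fls_nth (\<Sum>l<n. at_T e (B l) * fls_map to_ac \<alpha> ^ l) k)"
      by (simp add: nth_sum nth \<Lambda>sum m.hom_power)
    then show "fls_nth (\<Sum>l<n. at_T e (map_poly \<Lambda> (B l)) * \<alpha> ^ l) k = fls_nth 0 k" unfolding rel by (simp add: \<Lambda>)
  qed
  then have "map_poly \<Lambda> (B l0) = 0" using indep[of "\<lambda>l. map_poly \<Lambda> (B l)"] l0(1) by blast
  then have "coeff (map_poly \<Lambda> (B l0)) j0 = 0" by simp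
  then show False using \<Lambda>(1,4) by (simp add: coeff_map_poly)
qed

section \<open>Algebraic series with simultaneous approximations\<close>

text \<open>
  The value at T of a rational function; by \<open>frac_at_T_Fract\<close> it does not depend on the chosen
  fraction if e is positive.
\<close>
definition frac_at_T :: "nat \<Rightarrow> 'a::field poly fract \<Rightarrow> 'a fls" where
  "frac_at_T e x = (SOME v. \<exists>P Q. Q \<noteq> 0 \<and> x = Fract P Q \<and> v = at_T e P / at_T e Q)"

lemma frac_at_T_Fract:
  assumes e: "e > 0" and Q: "Q \<noteq> 0"
  shows "frac_at_T e (Fract P Q) = at_T e P / at_T e Q"
proof -
  have "\<exists>v P' Q'. Q' \<noteq> 0 \<and> Fract P Q = Fract P' Q' \<and> v = at_T e P' / at_T e Q'" using Q by blast
  from someI_ex[OF this] obtain P' Q' where v: "Q' \<noteq> 0" "Fract P Q = Fract P' Q'" 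
    "frac_at_T e (Fract P Q) = at_T e P' / at_T e Q'" unfolding frac_at_T_def by blast
  then have "P * Q' = P' * Q" using Q by (simp add: eq_fract)
  then have "at_T e P * at_T e Q' = at_T e P' * at_T e Q" by (metis at_T.hom_mult)
  then show ?thesis using v Q at_T_eq_0_iff[OF e, of Q] at_T_eq_0_iff[OF e, of Q'] by (simp add: frac_eq_eq)
qed

lemma frac_at_T_to_fract: "e > 0 \<Longrightarrow> frac_at_T e (to_fract P) = at_T e P"
  by (simp add: to_fract_def frac_at_T_Fract)

lemma field_hom_frac_at_T:
  assumes e: "e > 0" shows "field_hom (frac_at_T e :: 'a::field poly fract \<Rightarrow> 'a fls)"
proof unfold_locales
  fix x y :: "'a poly fract"
  obtain P Q where x: "x = Fract P Q" "Q \<noteq> 0" by (cases x)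
  obtain P' Q' where y: "y = Fract P' Q'" "Q' \<noteq> 0" by (cases y)
  have ne: "at_T e Q \<noteq> 0" "at_T e Q' \<noteq> 0" using x y at_T_eq_0_iff[OF e] by auto
  show "frac_at_T e (x + y) = frac_at_T e x + frac_at_T e y"
    using x y ne by (simp add: frac_at_T_Fract[OF e] at_T.hom_add at_T.hom_mult field_simps)
  show "frac_at_T e (x * y) = frac_at_T e x * frac_at_T e y"
    using x y by (simp add: frac_at_T_Fract[OF e] at_T.hom_mult)
next
  show "frac_at_T e (0 :: 'a poly fract) = 0" "frac_at_T e (1 :: 'a poly fract) = 1"
    unfolding Zero_fract_def One_fract_def by (simp_all add: frac_at_T_Fract[OF e])
qed

lemma fls_compose_power_at_T:
  assumes "e > 0" shows "fls_compose_power (at_T (Suc 0) P) e = at_T e P"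
proof -
  interpret h: field_hom "\<lambda>a::'a fls. fls_compose_power a e" using assms by (rule field_hom_fls_compose_power)
  have X: "fls_compose_power (fls_X_inv :: 'a fls) e = fls_X_inv ^ e"
    using assms by (simp add: fls_X_inv_power_conv_shift_1)
  show ?thesis using assms
    by (induction P) (simp_all add: at_T_pCons X h.hom_add h.hom_mult del: fls_compose_power_X_inv)
qed

lemma fls_compose_power_frac_at_T:
  assumes e: "e > 0" shows "fls_compose_power (frac_at_T (Suc 0) x) e = frac_at_T e x"
proof -
  interpret h: field_hom "\<lambda>a::'a fls. fls_compose_power a e" using e by (rule field_hom_fls_compose_power)
  obtain P Q where x: "x = Fract P Q" "Q \<noteq> 0" by (cases x)
  have "fls_compose_power (at_T (Suc 0) P * inverse (at_T (Suc 0) Q)) e = at_T e P * inverse (at_T e Q)"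
    by (simp only: h.hom_mult h.hom_inverse fls_compose_power_at_T[OF e])
  then show ?thesis using x e by (simp add: frac_at_T_Fract divide_inverse)
qed

text \<open>
  This turns polynomials over C(T) into polynomials in two variables, at the cost of a common
  denominator c.
\<close>
lemma clear_denominators:
  assumes e: "e > 0" and "\<And>i. \<exists>P Q. Q \<noteq> 0 \<and> coeff p i = at_T e P / at_T e Q"
  shows "\<exists>c A. c \<noteq> 0 \<and> (\<forall>x. at_T e c * poly p x = ev e x A)"
  using assms(2)
proof (induction p)
  case 0
  then show ?case by (intro exI[of _ 1] exI[of _ 0]) simp
next
  case (pCons a p)
  have "\<exists>P Q. Q \<noteq> 0 \<and> coeff p i = at_T e P / at_T e Q" for i using pCons.prems[of "Suc i"] by simp
  then obtain c A where c: "c \<noteq> 0" "\<And>x. at_T e c * poly p x = ev e x A" using pCons.IH by blast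
  obtain P Q where Q: "Q \<noteq> 0" "a = at_T e P / at_T e Q" using pCons.prems[of 0] by auto
  have Q0: "at_T e Q \<noteq> 0" using Q(1) at_T_eq_0_iff[OF e] by blast
  have "at_T e (Q * c) * poly (pCons a p) x = ev e x ([:P * c:] + [:0, Q:] * A)" for x
  proof -
    have "at_T e (Q * c) * poly (pCons a p) x = at_T e P * at_T e c + at_T e Q * x * (at_T e c * poly p x)"
      using Q0 by (simp add: Q(2) at_T.hom_mult field_simps)
    also have "\<dots> = ev e x ([:P * c:] + [:0, Q:] * A)"
    proof -
      have "ev e x [:0, Q:] = x * at_T e Q" by (simp add: ev_pCons)
      then show ?thesis unfolding c(2) by (simp only: ev.hom_add ev.hom_mult ev_const at_T.hom_mult mult_ac)
    qed
    finally show ?thesis .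
  qed
  moreover have "Q * c \<noteq> 0" using Q(1) c(1) by simp
  ultimately show ?case by blast
qed

text \<open>
  If m is the degree of g and s a common denominator of its coefficients, then G = s^m g(y / s) has
  polynomial coefficients, and its roots are those of g multiplied by s.
\<close>
lemma scaled_root:
  fixes g :: "'a::field poly fract poly"
  assumes "lead_coeff g = 1"
  shows "\<exists>s G. s \<noteq> 0 \<and> lead_coeff G = 1 \<and> degree G = degree g \<and>
    (\<forall>e>0. \<forall>\<theta>. ev e \<theta> G = 0 \<longrightarrow> poly (map_poly (frac_at_T e) g) (\<theta> / at_T e s) = 0)"
proof -
  have "\<forall>k. \<exists>P Q. Q \<noteq> 0 \<and> coeff g k = Fract P Q" by (metis Fract_cases)
  then obtain P Q where PQ: "\<And>k. Q k \<noteq> 0" "\<And>k. coeff g k = Fract (P k) (Q k)" by metis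
  define m where "m = degree g"
  define s where "s = (\<Prod>k<m. Q k)"
  have s0: "s \<noteq> 0" unfolding s_def using PQ(1) by simp
  define b where "b k = P k * (\<Prod>j\<in>{..<m} - {k}. Q j) * s ^ (m - k - 1)" for k
  define G where "G = monom 1 m + (\<Sum>k<m. monom (b k) k)"
  have cG: "coeff G k = (if k = m then 1 else if k < m then b k else 0)" for k
    unfolding G_def by (simp add: coeff_sum)
  have dG: "degree G = m"
  proof (rule antisym)
    show "degree G \<le> m" by (rule degree_le) (simp add: cG)
    show "m \<le> degree G" by (rule le_degree) (simp add: cG)
  qed
  have lG: "lead_coeff G = 1" by (simp add: dG cG)
  have "poly (map_poly (frac_at_T e) g) (\<theta> / at_T e s) = 0" if e: "e > 0" and 0: "ev e \<theta> G = 0" for e \<theta>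
  proof -
    interpret h: field_hom "frac_at_T e :: 'a poly fract \<Rightarrow> 'a fls" by (rule field_hom_frac_at_T[OF e])
    define S where "S = at_T e s"
    have S0: "S \<noteq> 0" unfolding S_def using s0 at_T_eq_0_iff[OF e] by blast
    have coeff: "at_T e (coeff G k) = frac_at_T e (coeff g k) * S ^ (m - k)" if "k \<le> m" for k
    proof (cases "k = m")
      case True
      then show ?thesis using assms by (simp add: cG m_def)
    next
      case False
      then have k: "k < m" using that by simp
      have "s = Q k * (\<Prod>j\<in>{..<m} - {k}. Q j)" unfolding s_def using k by (simp add: prod.remove)
      then have "S = at_T e (Q k) * at_T e (\<Prod>j\<in>{..<m} - {k}. Q j)" unfolding S_def by (metis at_T.hom_mult)
      moreover have "at_T e (Q k) \<noteq> 0" using PQ(1) at_T_eq_0_iff[OF e] by blast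
      moreover have "S ^ (m - k) = S * S ^ (m - k - 1)" using k by (metis Suc_diff_1 power_Suc zero_less_diff)
      ultimately have "frac_at_T e (coeff g k) * S ^ (m - k) = at_T e (P k) * at_T e (\<Prod>j\<in>{..<m} - {k}. Q j) * S ^ (m - k - 1)"
        unfolding PQ(2) frac_at_T_Fract[OF e PQ(1)] by simp
      then show ?thesis using k unfolding S_def by (simp add: cG b_def at_T.hom_mult at_T.hom_power)
    qed
    have "ev e \<theta> G = (\<Sum>k\<le>m. at_T e (coeff G k) * \<theta> ^ k)"
      using ev_altdef[of G "Suc m"] dG by (simp add: lessThan_Suc_atMost)
    also have "\<dots> = S ^ m * (\<Sum>k\<le>m. frac_at_T e (coeff g k) * (\<theta> / S) ^ k)"
      unfolding sum_distrib_left
    proof (intro sum.cong refl)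
      fix k assume "k \<in> {..m}"
      then have k: "k \<le> m" by simp
      then have "S ^ m = S ^ (m - k) * S ^ k" by (metis le_add_diff_inverse2 power_add)
      then show "at_T e (coeff G k) * \<theta> ^ k = S ^ m * (frac_at_T e (coeff g k) * (\<theta> / S) ^ k)"
        unfolding coeff[OF k] using S0 by (simp add: power_divide)
    qed
    also have "(\<Sum>k\<le>m. frac_at_T e (coeff g k) * (\<theta> / S) ^ k) = poly (map_poly (frac_at_T e) g) (\<theta> / S)"
      unfolding poly_altdef m_def by simp
    finally show ?thesis using 0 S0 unfolding S_def by simp
  qed
  then show ?thesis using s0 lG dG unfolding m_def by blast
qed

text \<open>
  The polynomial f is a minimal polynomial of \<alpha> over C(T), g a generator of its splitting field, and G
  its integral multiple. Puiseux's theorem provides the ramification index e for which G splits, and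
  everything is transported along the substitution of X^e for X.
\<close>
theorem palindromic_not_algebraic_over_closure:
  fixes \<alpha> :: "'a::{alg_closed_field, field_gcd, field_char_0} fls"
  assumes indep: "\<And>B. (\<Sum>l<3. at_T (Suc 0) (B l) * \<alpha> ^ l) = 0 \<Longrightarrow> \<forall>l<3::nat. B l = 0"
    and approx: "\<And>d. \<exists>q p r. d \<le> degree q \<and> degree p \<le> degree q \<and> degree r \<le> degree q \<and>
       ord_ge (at_T (Suc 0) q * \<alpha> - at_T (Suc 0) p) (int (degree q)) \<and>
       ord_ge (at_T (Suc 0) q * \<alpha>\<^sup>2 - at_T (Suc 0) r) (int (degree q))"
    and root: "ev (Suc 0) \<alpha> P = 0"
  shows "P = 0"
proof (rule ccontr)
  assume P0: "P \<noteq> 0"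
  let ?\<iota> = "frac_at_T :: nat \<Rightarrow> 'a poly fract \<Rightarrow> 'a fls"
  let ?m1 = "map_poly (?\<iota> (Suc 0))"
  interpret i1: field_hom "?\<iota> (Suc 0)" by (rule field_hom_frac_at_T) simp
  interpret tf: inj_idom_hom "to_fract :: 'a poly \<Rightarrow> 'a poly fract" by unfold_locales auto
  have ev_frac: "ev e \<theta> R = poly (map_poly (?\<iota> e) (map_poly to_fract R)) \<theta>" if "e > 0" for e \<theta> R
  proof -
    interpret h: field_hom "?\<iota> e" by (rule field_hom_frac_at_T[OF that])
    have "map_poly (?\<iota> e) (map_poly to_fract R) = map_poly (at_T e) R"
      by (rule poly_eqI) (simp add: coeff_map_poly frac_at_T_to_fract[OF that])
    then show ?thesis unfolding ev_def by simp
  qed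
  have "map_poly to_fract P \<noteq> 0 \<and> poly (?m1 (map_poly to_fract P)) \<alpha> = 0"
    using root P0 ev_frac[of "Suc 0"] by simp
  then have "\<exists>f. (f \<noteq> 0 \<and> poly (?m1 f) \<alpha> = 0) \<and>
     (\<forall>h. h \<noteq> 0 \<and> poly (?m1 h) \<alpha> = 0 \<longrightarrow> degree f \<le> degree h)"
    by (rule ex_has_least_nat)
  then obtain f where f: "f \<noteq> 0" "poly (?m1 f) \<alpha> = 0"
    "\<And>h. h \<noteq> 0 \<Longrightarrow> poly (?m1 h) \<alpha> = 0 \<Longrightarrow> degree f \<le> degree h" by blast
  interpret i1p: map_poly_inj_comm_ring_hom "?\<iota> (Suc 0)" ..
  have irr_f: "irreducible f"
  proof (rule irreducibleI)
    show "f \<noteq> 0" by (rule f(1))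
    show "\<not> is_unit f"
    proof
      assume "is_unit f"
      then obtain u where "1 = f * u" by (rule dvdE)
      then have "?m1 f * ?m1 u = 1" by (metis i1p.hom_mult i1p.hom_one)
      then have "poly (?m1 f * ?m1 u) \<alpha> = 1" by simp
      then show False using f(2) by simp
    qed
    fix x y assume xy: "f = x * y"
    then have ne: "x \<noteq> 0" "y \<noteq> 0" using f(1) by auto
    then have deg: "degree f = degree x + degree y" using xy by (simp add: degree_mult_eq)
    have "poly (?m1 x) \<alpha> * poly (?m1 y) \<alpha> = 0"
      using f(2) unfolding xy by (simp add: i1p.hom_mult)
    then have "degree y = 0 \<or> degree x = 0" using f(3)[OF ne(1)] f(3)[OF ne(2)] deg by auto
    then show "is_unit x \<or> is_unit y" using ne by (auto simp: is_unit_iff_degree)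
  qed
  obtain g H where g: "irreducible g" "lead_coeff g = 1" and H: "finite H" "card H = degree f"
    "\<And>h. h \<in> H \<Longrightarrow> g dvd pcompose f h"
    "\<And>h h'. h \<in> H \<Longrightarrow> h' \<in> H \<Longrightarrow> h \<noteq> h' \<Longrightarrow> \<not> g dvd h - h'"
    using normal_generator[OF irr_f] by blast
  have dg: "degree g > 0"
  proof (rule ccontr)
    assume "\<not> degree g > 0"
    then have "is_unit g" using g(2) is_unit_iff_degree[of g] by auto
    then show False using g(1) by auto
  qed
  obtain s G where s0: "s \<noteq> 0" and G: "lead_coeff G = 1" "degree G = degree g"
    and Groot: "\<And>e \<theta>. e > 0 \<Longrightarrow> ev e \<theta> G = 0 \<Longrightarrow> poly (map_poly (?\<iota> e) g) (\<theta> / at_T e s) = 0"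
    using scaled_root[OF g(2)] by blast
  have degG: "degree (map_poly (at_T e) G) = degree G" if "e > 0" for e
    by (rule degree_map_poly) (simp add: at_T_eq_0_iff[OF that])
  have "lead_coeff (map_poly (at_T (Suc 0)) G) = 1"
    using G(1) by (simp add: degG coeff_map_poly)
  then obtain e where e: "e > 0" and sp: "splits (map_poly (\<lambda>a. fls_compose_power a e) (map_poly (at_T (Suc 0)) G))"
    using puiseux by blast
  interpret cp: field_hom "\<lambda>a::'a fls. fls_compose_power a e" by (rule field_hom_fls_compose_power[OF e])
  let ?cp = "map_poly (\<lambda>a. fls_compose_power a e)" and ?me = "map_poly (?\<iota> e)"
  interpret ie: field_hom "?\<iota> e" by (rule field_hom_frac_at_T[OF e])
  interpret iep: map_poly_inj_comm_ring_hom "?\<iota> e" ..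
  have "?cp (map_poly (at_T (Suc 0)) G) = map_poly (at_T e) G"
    by (rule poly_eqI) (simp add: coeff_map_poly fls_compose_power_at_T[OF e])
  then obtain as where as: "map_poly (at_T e) G = (\<Prod>a\<leftarrow>as. [:-a, 1:])" using sp unfolding splits_def by auto
  define \<Theta> where "\<Theta> = set as"
  have evG: "ev e \<theta> G = (\<Prod>a\<leftarrow>as. \<theta> - a)" for \<theta>
    unfolding ev_def as by (induction as) (simp_all add: algebra_simps)
  have \<Theta>root: "ev e \<theta> G = 0" if "\<theta> \<in> \<Theta>" for \<theta>
    using that unfolding evG \<Theta>_def by (simp add: prod_list_zero_iff image_iff)
  \<comment> \<open>Irreducibility of g, expressed for its integral multiple.\<close>
  have indep_\<theta>: "R = 0" if \<theta>: "\<theta> \<in> \<Theta>" and R: "degree R < degree G" "ev e \<theta> R = 0" for \<theta> R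
  proof (rule ccontr)
    assume R0: "R \<noteq> 0"
    define S where "S = pcompose (map_poly to_fract R) [:0, to_fract s:]"
    have "degree S = degree R" unfolding S_def using s0 by (simp add: degree_pcompose)
    moreover have "S \<noteq> 0"
    proof
      assume "S = 0"
      then have "s ^ degree R * lead_coeff R = 0"
        unfolding S_def by (metis coeff_0 coeff_pcompose_scale coeff_map_poly tf.hom_zero tf.hom_0_iff tf.hom_mult tf.hom_power)
      then show False using s0 R0 by simp
    qed
    ultimately have "\<not> g dvd S" using R(1) G(2) dvd_imp_degree_le[of g S] by auto
    then obtain u v where "u * g + v * S = 1" using irreducible_bezout[OF g(1)] by blast
    then have uv: "?me u * ?me g + ?me v * ?me S = 1"
      by (metis iep.hom_add iep.hom_mult iep.hom_one)
    have "at_T e s \<noteq> 0" using s0 at_T_eq_0_iff[OF e] by blast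
    then have "poly (?me S) (\<theta> / at_T e s) = ev e \<theta> R"
      unfolding S_def ev_frac[OF e] ie.map_poly_pcompose
      by (simp add: poly_pcompose ie.map_poly_pCons_hom frac_at_T_to_fract[OF e])
    then have "poly (?me u * ?me g + ?me v * ?me S) (\<theta> / at_T e s) = 0"
      using R(2) Groot[OF e \<Theta>root[OF \<theta>]] by simp
    then show False unfolding uv by simp
  qed
  have dist: "distinct as"
  proof (rule ccontr)
    assume "\<not> distinct as"
    then obtain xs ys zs y where asx: "as = xs @ [y] @ ys @ [y] @ zs" by (metis not_distinct_decomp)
    define T where "T = (\<Prod>a\<leftarrow>xs @ ys @ zs. [:-a, 1:])"
    have "map_poly (at_T e) G = [:-y, 1:] * ([:-y, 1:] * T)"
      unfolding as asx T_def by (simp add: mult_ac del: mult_pCons_left mult_pCons_right)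
    then have "poly (pderiv (map_poly (at_T e) G)) y = 0"
      by (simp add: pderiv_mult pderiv_pCons del: mult_pCons_left mult_pCons_right)
    moreover have "pderiv (map_poly (at_T e) G) = map_poly (at_T e) (pderiv G)"
    proof (rule poly_eqI)
      fix k
      have "at_T e (of_nat n :: 'a poly) = of_nat n" for n by (rule at_T.hom_of_nat)
      then show "coeff (pderiv (map_poly (at_T e) G)) k = coeff (map_poly (at_T e) (pderiv G)) k"
        by (simp add: coeff_pderiv coeff_map_poly at_T.hom_mult del: of_nat_Suc)
    qed
    ultimately have "ev e y (pderiv G) = 0" unfolding ev_def by simp
    moreover have "y \<in> \<Theta>" unfolding \<Theta>_def asx by simp
    moreover have "degree (pderiv G) < degree G" using dg G(2) by (simp add: degree_pderiv)
    ultimately have "pderiv G = 0" using indep_\<theta> by blast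
    then show False using dg G(2) by (simp add: pderiv_eq_0_iff)
  qed
  have "degree (map_poly (at_T e) G) = length as"
    unfolding as by (induction as) (simp_all add: degree_mult_eq prod_list_zero_iff image_iff del: mult_pCons_left)
  then have card: "card \<Theta> = degree G" unfolding degG[OF e] \<Theta>_def using dist by (simp add: distinct_card)
  define \<beta> where "\<beta> = fls_compose_power \<alpha> e"
  have f\<beta>: "poly (?me f) \<beta> = 0"
  proof -
    have "?cp (?m1 f) = ?me f"
      by (rule poly_eqI) (simp add: coeff_map_poly fls_compose_power_frac_at_T[OF e])
    then have "poly (?me f) \<beta> = fls_compose_power (poly (?m1 f) \<alpha>) e"
      unfolding \<beta>_def using cp.poly_map_poly by metis
    then show ?thesis using f(2) by simp
  qed
  have "\<forall>h. \<exists>c A. c \<noteq> 0 \<and> (\<forall>x. at_T e c * poly (?me (pcompose h [:0, inverse (to_fract s):])) x = ev e x A)"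
  proof
    fix h
    show "\<exists>c A. c \<noteq> 0 \<and> (\<forall>x. at_T e c * poly (?me (pcompose h [:0, inverse (to_fract s):])) x = ev e x A)"
    proof (rule clear_denominators[OF e])
      fix i
      obtain P Q where "Q \<noteq> 0" "coeff (pcompose h [:0, inverse (to_fract s):]) i = Fract P Q" by (metis Fract_cases)
      then show "\<exists>P Q. Q \<noteq> 0 \<and> coeff (?me (pcompose h [:0, inverse (to_fract s):])) i = at_T e P / at_T e Q"
        by (auto simp: frac_at_T_Fract[OF e])
    qed
  qed
  then obtain c A where c: "\<And>h. c h \<noteq> 0"
    and cA: "\<And>h x. at_T e (c h) * poly (?me (pcompose h [:0, inverse (to_fract s):])) x = ev e x (A h)" by metis
  define c' where "c' = (\<Prod>h\<in>H. c h)"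
  have c'0: "c' \<noteq> 0" unfolding c'_def using c H(1) by simp
  \<comment> \<open>One of the finitely many h in H expresses the image of \<alpha>; the product of the denominators of all h serves for every root.\<close>
  have gen: "\<exists>A. at_T e c' * \<beta> = ev e \<theta> A" if \<theta>: "\<theta> \<in> \<Theta>" for \<theta>
  proof -
    obtain h where h: "h \<in> H" "\<beta> = poly (?me h) (\<theta> / at_T e s)"
      using conjugate_roots_generate[OF ie.field_hom_axioms g(1) f(1) H Groot[OF e \<Theta>root[OF \<theta>]] f\<beta>] by blast
    have "poly (?me (pcompose h [:0, inverse (to_fract s):])) \<theta> = \<beta>"
      unfolding h(2) ie.map_poly_pcompose
      by (simp add: poly_pcompose ie.map_poly_pCons_hom ie.hom_inverse frac_at_T_to_fract[OF e] divide_inverse)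
    then have "at_T e (c h) * \<beta> = ev e \<theta> (A h)" using cA[of h \<theta>] by simp
    moreover have "c' = (\<Prod>h\<in>H - {h}. c h) * c h" unfolding c'_def using h(1) H(1) by (simp add: prod.remove mult.commute)
    ultimately have "at_T e c' * \<beta> = ev e \<theta> ([:\<Prod>h\<in>H - {h}. c h:] * A h)"
      by (simp only: at_T.hom_mult ev.hom_mult ev_const mult.assoc)
    then show ?thesis by blast
  qed
  show False
  proof (rule no_simultaneous_approximation[OF e G(1) _ _ card \<Theta>root indep_\<theta> c'0 gen])
    show "degree G > 0" using dg G(2) by simp
    show "finite \<Theta>" unfolding \<Theta>_def by simp
    show "\<forall>l<3. B l = 0" if rel: "(\<Sum>l<3. at_T e (B l) * \<beta> ^ l) = 0" for B
    proof -
      have "fls_compose_power (\<Sum>l<3. at_T (Suc 0) (B l) * \<alpha> ^ l) e = (\<Sum>l<3. at_T e (B l) * \<beta> ^ l)"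
        unfolding \<beta>_def cp.hom_sum cp.hom_mult cp.hom_power fls_compose_power_at_T[OF e] ..
      then have "(\<Sum>l<3. at_T (Suc 0) (B l) * \<alpha> ^ l) = 0" using rel by simp
      then show ?thesis by (rule indep)
    qed
    fix d
    obtain q p r where qpr: "d \<le> degree q" "degree p \<le> degree q" "degree r \<le> degree q"
      "ord_ge (at_T (Suc 0) q * \<alpha> - at_T (Suc 0) p) (int (degree q))"
      "ord_ge (at_T (Suc 0) q * \<alpha>\<^sup>2 - at_T (Suc 0) r) (int (degree q))"
      using approx by blast
    have cpv: "ord_ge (fls_compose_power u e) (int e * n)" if "ord_ge u n" for u :: "'a fls" and n
      using that unfolding ord_ge_iff fls_subdegree_compose_power[OF e] by (auto simp: mult_left_mono)
    have "fls_compose_power (at_T (Suc 0) q * \<alpha> - at_T (Suc 0) p) e = at_T e q * \<beta> - at_T e p"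
      "fls_compose_power (at_T (Suc 0) q * \<alpha>\<^sup>2 - at_T (Suc 0) r) e = at_T e q * \<beta>\<^sup>2 - at_T e r"
      unfolding \<beta>_def cp.hom_minus cp.hom_mult cp.hom_power fls_compose_power_at_T[OF e] by (rule refl)+
    then show "\<exists>q p r. d \<le> degree q \<and> degree p \<le> degree q \<and> degree r \<le> degree q \<and>
       ord_ge (at_T e q * \<beta> - at_T e p) (int e * int (degree q)) \<and>
       ord_ge (at_T e q * \<beta>\<^sup>2 - at_T e r) (int e * int (degree q))"
      using qpr cpv[OF qpr(4)] cpv[OF qpr(5)] by metis
  qed
qed

text \<open>
  A nontrivial relation between 1, \<alpha> and \<alpha>^2 would make \<alpha> rational, which an infinite continued
  fraction excludes, or quadratic. Independence, approximations and the algebraic equation of \<alpha> are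
  all preserved by extending the constants to the algebraic closure of K.
\<close>
theorem theorem5:
  fixes \<alpha> :: "'a::field_char_0 fls"
    and a :: "nat \<Rightarrow> 'a poly"
  assumes "has_infinite_cf \<alpha> a"
    and "a 0 = 0"
    and "begins_with_long_palindromes a"
  shows "\<not> algebraic_over rational_functions_T \<alpha> \<or> quadratic_over rational_functions_T \<alpha>"
proof (rule ccontr)
  assume "\<not> ?thesis"
  then have alg: "algebraic_over rational_functions_T \<alpha>" and nq: "\<not> quadratic_over rational_functions_T \<alpha>" by auto
  interpret infinite_cf \<alpha> a using assms(1,2) by unfold_locales
  let ?t = "at_T (Suc 0) :: 'a poly \<Rightarrow> 'a fls"
  have t0: "?t P = 0 \<longleftrightarrow> P = 0" for P by (rule at_T_eq_0_iff) simp
  have irr: "B = 0" if "?t B * \<alpha> = ?t A" for A B using irrational that unfolding poly_T_eq_at_T by blast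
  have ratT: "x \<in> rational_functions_T \<longleftrightarrow> (\<exists>P Q. Q \<noteq> 0 \<and> x = ?t P / ?t Q)" for x
    unfolding rational_functions_T_def poly_T_eq_at_T by blast
  have indep: "\<forall>l<3::nat. B l = 0" if rel: "(\<Sum>l<3. ?t (B l) * \<alpha> ^ l) = 0" for B
  proof -
    have rel': "?t (B 0) + ?t (B 1) * \<alpha> + ?t (B 2) * \<alpha>\<^sup>2 = 0"
      using rel by (simp add: numeral_3_eq_3 numeral_2_eq_2)
    have B2: "B 2 = 0"
    proof (rule ccontr)
      assume B2: "B 2 \<noteq> 0"
      define p where "p = [:?t (B 0) / ?t (B 2), ?t (B 1) / ?t (B 2), 1:]"
      have "1 = ?t 1 / ?t 1" "(0 :: 'a fls) = ?t 0 / ?t 1" by simp_all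
      then have "1 \<in> (rational_functions_T :: 'a fls set)" "0 \<in> (rational_functions_T :: 'a fls set)"
        unfolding ratT by (metis one_neq_zero)+
      moreover have "?t (B 0) / ?t (B 2) \<in> rational_functions_T" "?t (B 1) / ?t (B 2) \<in> rational_functions_T"
        unfolding ratT using B2 by blast+
      ultimately have "\<forall>i. coeff p i \<in> rational_functions_T"
        unfolding p_def by (auto simp: coeff_pCons split: nat.split)
      moreover have "lead_coeff p = 1" "degree p = 2" unfolding p_def by simp_all
      moreover have "poly p \<alpha> = 0"
      proof -
        have "?t (B 2) * poly p \<alpha> = ?t (B 0) + ?t (B 1) * \<alpha> + ?t (B 2) * \<alpha>\<^sup>2"
          unfolding p_def using B2 t0[of "B 2"] by (simp add: field_simps power2_eq_square)
        then show ?thesis using rel' B2 t0[of "B 2"] by simp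
      qed
      moreover have "2 \<le> degree h" if h: "\<forall>i. coeff h i \<in> rational_functions_T" "h \<noteq> 0" "poly h \<alpha> = 0" for h
      proof (rule ccontr)
        assume "\<not> 2 \<le> degree h"
        then have "degree h \<le> 1" by simp
        then have hp: "poly h \<alpha> = coeff h 0 + coeff h 1 * \<alpha>" and h01: "h = [:coeff h 0, coeff h 1:]"
        proof -
          show "h = [:coeff h 0, coeff h 1:]"
            using \<open>degree h \<le> 1\<close> by (intro poly_eqI) (auto simp: coeff_pCons coeff_eq_0 split: nat.split)
          then have "poly h \<alpha> = poly [:coeff h 0, coeff h 1:] \<alpha>" by (rule arg_cong)
          then show "poly h \<alpha> = coeff h 0 + coeff h 1 * \<alpha>" by (simp add: mult.commute)
        qed
        obtain P Q where PQ: "Q \<noteq> 0" "coeff h 0 = ?t P / ?t Q" using h(1) unfolding ratT by blast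
        obtain P' Q' where PQ': "Q' \<noteq> 0" "coeff h 1 = ?t P' / ?t Q'" using h(1) unfolding ratT by blast
        have "?t P / ?t Q + ?t P' / ?t Q' * \<alpha> = 0" using h(3) unfolding hp PQ PQ' .
        then have "?t P * ?t Q' + ?t P' * ?t Q * \<alpha> = 0" using PQ(1) PQ'(1) t0[of Q] t0[of Q'] by (simp add: field_simps)
        then have "?t (P' * Q) * \<alpha> = ?t (- (P * Q'))" by (simp add: at_T.hom_mult at_T.hom_uminus eq_neg_iff_add_eq_0 add.commute)
        then have "P' * Q = 0" by (rule irr)
        then have "P' = 0" using PQ(1) by simp
        then have "coeff h 1 = 0" using PQ'(2) by simp
        then have "coeff h 0 = 0" using h(3) hp by simp
        then show False using h01 \<open>coeff h 1 = 0\<close> h(2) by simp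
      qed
      ultimately have "minimal_polynomial_over rational_functions_T \<alpha> p" "degree p = 2"
        unfolding minimal_polynomial_over_def by auto
      then show False using nq unfolding quadratic_over_def by blast
    qed
    then have "?t (B 1) * \<alpha> = ?t (- B 0)" using rel' by (simp add: at_T.hom_uminus eq_neg_iff_add_eq_0 add.commute)
    then have B1: "B 1 = 0" by (rule irr)
    then have "B 0 = 0" using rel' B2 t0[of "B 0"] by simp
    then show ?thesis using B1 B2 by (auto simp: numeral_3_eq_3 less_Suc_eq numeral_2_eq_2)
  qed
  obtain p where p: "\<forall>i. coeff p i \<in> rational_functions_T" "p \<noteq> 0" "poly p \<alpha> = 0"
    using alg unfolding algebraic_over_def by blast
  have "\<exists>P Q. Q \<noteq> 0 \<and> coeff p i = at_T (Suc 0) P / at_T (Suc 0) Q" for i using p(1) unfolding ratT by blast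
  from clear_denominators[OF _ this] obtain c A where cA: "c \<noteq> 0" "\<And>x. ?t c * poly p x = ev (Suc 0) x A" by auto
  have A0: "A \<noteq> 0"
  proof
    assume "A = 0"
    then have "poly p x = 0" for x using cA t0[of c] by simp
    then show False using p(2) poly_all_0_iff_0 by blast
  qed
  interpret ac: field_hom "to_ac :: 'a \<Rightarrow> 'a alg_closure" by (rule field_hom_to_ac)
  interpret acp: map_poly_inj_comm_ring_hom "to_ac :: 'a \<Rightarrow> 'a alg_closure" ..
  interpret m: field_hom "fls_map (to_ac :: 'a \<Rightarrow> 'a alg_closure)" by (rule ac.field_hom_fls_map)
  define \<alpha>' where "\<alpha>' = fls_map (to_ac :: 'a \<Rightarrow> 'a alg_closure) \<alpha>"
  have "map_poly (map_poly to_ac) A = (0 :: 'a alg_closure poly poly)"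
  proof (rule palindromic_not_algebraic_over_closure[of \<alpha>'])
    show "\<forall>l<3. B l = 0" if "(\<Sum>l<3. at_T (Suc 0) (B l) * \<alpha>' ^ l) = 0" for B
      using that unfolding \<alpha>'_def by (intro independence_over_closure[OF indep])
    show "ev (Suc 0) \<alpha>' (map_poly (map_poly to_ac) A) = 0"
      unfolding \<alpha>'_def ac.fls_map_ev[symmetric] cA(2)[symmetric] p(3) by simp
    fix d
    obtain q p r where qpr: "d \<le> degree q" "degree p \<le> degree q" "degree r \<le> degree q"
      "ord_ge (?t q * \<alpha> - ?t p) (int (degree q))"
      "ord_ge (?t q * \<alpha>\<^sup>2 - ?t r) (int (degree q))"
      using palindromic_approximations[OF assms(3), of d] unfolding poly_T_eq_at_T by blast
    have mv: "ord_ge (fls_map to_ac u) n" if "ord_ge u n" for u :: "'a fls" and n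
      using that unfolding ord_ge_def by (simp add: fls_map_nth)
    have "ord_ge (at_T (Suc 0) (map_poly to_ac q) * \<alpha>' - at_T (Suc 0) (map_poly to_ac p)) (int (degree q))"
      using mv[OF qpr(4)] unfolding \<alpha>'_def m.hom_minus m.hom_mult ac.fls_map_at_T .
    moreover have "ord_ge (at_T (Suc 0) (map_poly to_ac q) * \<alpha>'\<^sup>2 - at_T (Suc 0) (map_poly to_ac r)) (int (degree q))"
      using mv[OF qpr(5)] unfolding \<alpha>'_def m.hom_minus m.hom_mult m.hom_power ac.fls_map_at_T .
    ultimately show "\<exists>q p r. d \<le> degree q \<and> degree p \<le> degree q \<and> degree r \<le> degree q \<and>
       ord_ge (at_T (Suc 0) q * \<alpha>' - at_T (Suc 0) p) (int (degree q)) \<and>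
       ord_ge (at_T (Suc 0) q * \<alpha>'\<^sup>2 - at_T (Suc 0) r) (int (degree q))"
      using qpr(1-3) by (intro exI[of _ "map_poly to_ac q"] exI[of _ "map_poly to_ac p"] exI[of _ "map_poly to_ac r"]) simp
  qed
  then have "coeff (map_poly (map_poly to_ac) A) i = (0 :: 'a alg_closure poly)" for i by simp
  then have "coeff A i = 0" for i using acp.hom_0_iff by (simp add: coeff_map_poly)
  then show False using A0 by (simp add: poly_eq_iff)
qed

end
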